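(* Let $n\ge 1$ and $m\ge 1$ be integers, let $0<\beta<1$, and let $\Omega\in L^s(S^{n-1})$ $(s>1)$ be homogeneous of degree zero on $\mathbb{R}^n$. Let $1<s'<p<n/\beta$ where $1/s+1/s'=1$, let $1/q=1/p-\beta/n$, let $0<\kappa<p/q$, and let $w$ be a weight with $w^{s'}\in A(p/s',q/s')$. Let $A$ be a function on $\mathbb{R}^n$ with $D^{\gamma}A\in\dot{\Lambda}_{\beta}(\mathbb{R}^n)$ for every multi-index $\gamma$ with $|\gamma|=m-1$. Then there is a constant $C>0$, independent of $f$ and $A$, such that for all $f\in L^{p,\kappa}(w^p,w^q)$ $$\|T_{\Omega}^{A}f\|_{L^{q,\kappa q/p}(w^q)}\leq C\sum_{|\gamma|=m-1}\|D^{\gamma}A\|_{\dot{\Lambda}_{\beta}}\,\|f\|_{L^{p,\kappa}(w^p,w^q)}$$ and $$\|M_{\Omega}^{A}f\|_{L^{q,\kappa q/p}(w^q)}\leq C\sum_{|\gamma|=m-1}\|D^{\gamma}A\|_{\dot{\Lambda}_{\beta}}\,\|f\|_{L^{p,\kappa}(w^p,w^q)}.$$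
   Context: A weight is a locally integrable function on $\mathbb{R}^n$ with values in $(0,\infty)$ almost everywhere; for a weight $v$ and measurable $E$, $v(E)=\int_E v(x)\,dx$ (so $w^q(B)=\int_B w(x)^q dx$). $\Omega$ homogeneous of degree zero means $\Omega(\lambda x)=\Omega(x)$ for $\lambda>0$, $x\ne0$. Weighted Morrey spaces: for $1\le p<\infty$, $0<\kappa<1$ and weights $u,v$, $L^{p,\kappa}(u,v)$ is the space of $f$ with $$\|f\|_{L^{p,\kappa}(u,v)}=\sup_B\Big(\frac{1}{v(B)^{\kappa}}\int_B|f(x)|^pu(x)\,dx\Big)^{1/p}<\infty,$$ the supremum over all balls $B\subset\mathbb{R}^n$; $L^{p,\kappa}(u)=L^{p,\kappa}(u,u)$. Class $A(p,q)$, $1<p<q<\infty$: $w\in A(p,q)$ if there is $C>1$ such that for every ball $B$ $$\Big(\frac{1}{|B|}\int_Bw^q\,dx\Big)^{1/q}\Big(\frac{1}{|B|}\int_Bw^{-p/(p-1)}\,dx\Big)^{(p-1)/p}\leq C.$$ Lipschitz space, $0<\beta<1$: $\dot{\Lambda}_\beta(\mathbb{R}^n)$ is the set of $g$ with $|g(x)-g(y)|\le C|x-y|^\beta$ for all $x,y$; the smallest such $C$ is $\|g\|_{\dot{\Lambda}_\beta}$. Taylor remainder: $R_m(A;x,y)=A(x)-\sum_{|\gamma|<m}\frac{1}{\gamma!}D^{\gamma}A(y)(x-y)^{\gamma}$, with the usual multi-index notation. Operators: $$T_{\Omega}^{A}f(x)=\int_{\mathbb{R}^n}\frac{\Omega(x-y)}{|x-y|^{n+m-1}}R_m(A;x,y)f(y)\,dy,$$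 $$M_{\Omega}^{A}f(x)=\sup_{r>0}\frac{1}{r^{n+m-1}}\int_{|x-y|<r}|\Omega(x-y)R_m(A;x,y)f(y)|\,dy.$$ *)

theory Defs
  imports "HOL-Analysis.Analysis"
begin

text \<open>The space $\mathbb{R}^n$ is \<^typ>\<open>real^'n\<close>, with $n$ = \<^term>\<open>CARD('n)\<close>; functions on it are
  complex valued (which includes the real valued ones) and measurable means Lebesgue measurable.
  Norms and averages are taken in \<^typ>\<open>ennreal\<close>, so that an inequality between them also asserts
  finiteness of the left-hand side whenever the right-hand side is finite.\<close>

text \<open>Powers in \<^typ>\<open>ennreal\<close>; only used with a positive exponent.\<close>

definition ennreal_powr :: "ennreal \<Rightarrow> real \<Rightarrow> ennreal" where
  "ennreal_powr x a = (if x = top then top else ennreal (enn2real x powr a))"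

definition balls :: "(real^'n) set set" where
  "balls = {ball c r | c r. 0 < r}"


subsection \<open>Weights and Morrey spaces\<close>

definition weight :: "(real^'n \<Rightarrow> real) \<Rightarrow> bool" where
  "weight v \<longleftrightarrow> v \<in> borel_measurable lebesgue
     \<and> (\<forall>K. compact K \<longrightarrow> set_integrable lebesgue K v)
     \<and> (AE x in lebesgue. 0 < v x)"

definition weight_of :: "(real^'n \<Rightarrow> real) \<Rightarrow> (real^'n) set \<Rightarrow> ennreal" where
  "weight_of v E = (\<integral>\<^sup>+ x \<in> E. ennreal (v x) \<partial>lebesgue)"

text \<open>The norm depends on $f$ only through $|f|$ and is defined on the modulus, so that it applies
  both to \<^typ>\<open>complex\<close> valued functions and to the maximal operator, whose values are in
  \<^typ>\<open>ennreal\<close>.\<close>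

definition morrey_norm ::
  "real \<Rightarrow> real \<Rightarrow> (real^'n \<Rightarrow> real) \<Rightarrow> (real^'n \<Rightarrow> real) \<Rightarrow> (real^'n \<Rightarrow> ennreal) \<Rightarrow> ennreal" where
  "morrey_norm p \<kappa> u v F = ennreal_powr
     (SUP B\<in>balls. (\<integral>\<^sup>+ x \<in> B. ennreal_powr (F x) p * ennreal (u x) \<partial>lebesgue)
                      / ennreal_powr (weight_of v B) \<kappa>)
     (1 / p)"

definition modulus :: "(real^'n \<Rightarrow> complex) \<Rightarrow> real^'n \<Rightarrow> ennreal" where
  "modulus f x = ennreal (cmod (f x))"

definition morrey_space ::
  "real \<Rightarrow> real \<Rightarrow> (real^'n \<Rightarrow> real) \<Rightarrow> (real^'n \<Rightarrow> real) \<Rightarrow> (real^'n \<Rightarrow> complex) set" where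
  "morrey_space p \<kappa> u v =
     {f. f \<in> borel_measurable lebesgue \<and> morrey_norm p \<kappa> u v (modulus f) < top}"

definition A_class :: "real \<Rightarrow> real \<Rightarrow> (real^'n \<Rightarrow> real) set" where
  "A_class p q = {w. \<exists>C>1. \<forall>B\<in>balls.
      ennreal_powr ((\<integral>\<^sup>+ x \<in> B. ennreal (w x powr q) \<partial>lebesgue) / emeasure lebesgue B) (1 / q)
    * ennreal_powr ((\<integral>\<^sup>+ x \<in> B. ennreal (w x powr (- (p / (p - 1)))) \<partial>lebesgue)
                      / emeasure lebesgue B) ((p - 1) / p)
    \<le> ennreal C}"


subsection \<open>The space $L^s(S^{n-1})$ and homogeneity\<close>

text \<open>Surface measure in polar coordinates: $\sigma(E) = n\,|\{r\theta : \theta \in E,\ 0 < r < 1\}|$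
  for Borel $E \subseteq S^{n-1}$, and then its completion. For $n = 1$ this is the counting measure on
  $\{-1, 1\}$.\<close>

definition sphere_measure :: "(real^'n) measure" where
  "sphere_measure = completion (scale_measure (of_nat CARD('n))
     (distr (restrict_space lborel (ball 0 1 - {0})) (restrict_space borel (sphere 0 1)) sgn))"

definition sphere_Lp :: "real \<Rightarrow> (real^'n \<Rightarrow> complex) set" where
  "sphere_Lp s = {\<Omega>. \<Omega> \<in> borel_measurable sphere_measure
     \<and> (\<integral>\<^sup>+ x. ennreal (cmod (\<Omega> x) powr s) \<partial>sphere_measure) < top}"

definition homogeneous_zero :: "(real^'n \<Rightarrow> complex) \<Rightarrow> bool" where
  "homogeneous_zero \<Omega> \<longleftrightarrow> (\<forall>t>0. \<forall>x. x \<noteq> 0 \<longrightarrow> \<Omega> (t *\<^sub>R x) = \<Omega> x)"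


subsection \<open>Lipschitz spaces\<close>

definition Lip_space :: "real \<Rightarrow> (real^'n \<Rightarrow> complex) set" where
  "Lip_space \<beta> = {g. \<exists>C. \<forall>x y. cmod (g x - g y) \<le> C * norm (x - y) powr \<beta>}"

definition Lip_norm :: "real \<Rightarrow> (real^'n \<Rightarrow> complex) \<Rightarrow> real" where
  "Lip_norm \<beta> g = Inf {C. \<forall>x y. cmod (g x - g y) \<le> C * norm (x - y) powr \<beta>}"


subsection \<open>Multi-indices, derivatives and Taylor remainders\<close>

definition multi_size :: "('n::finite \<Rightarrow> nat) \<Rightarrow> nat" where
  "multi_size \<gamma> = (\<Sum>i\<in>UNIV. \<gamma> i)"

definition multi_fact :: "('n::finite \<Rightarrow> nat) \<Rightarrow> nat" where
  "multi_fact \<gamma> = (\<Prod>i\<in>UNIV. fact (\<gamma> i))"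

definition multi_power :: "real^'n \<Rightarrow> ('n \<Rightarrow> nat) \<Rightarrow> real" where
  "multi_power x \<gamma> = (\<Prod>i\<in>UNIV. (x $ i) ^ \<gamma> i)"

definition partial_deriv :: "'n \<Rightarrow> (real^'n \<Rightarrow> complex) \<Rightarrow> real^'n \<Rightarrow> complex" where
  "partial_deriv i f x = vector_derivative (\<lambda>t. f (x + t *\<^sub>R axis i 1)) (at 0)"

text \<open>\<open>Ck k f\<close>: \<open>f\<close> is $k$ times continuously differentiable on the whole space.\<close>

primrec Ck :: "nat \<Rightarrow> (real^'n \<Rightarrow> complex) \<Rightarrow> bool" where
  "Ck 0 f = continuous_on UNIV f"
| "Ck (Suc k) f = (continuous_on UNIV f
     \<and> (\<forall>i. (\<forall>x. (\<lambda>t. f (x + t *\<^sub>R axis i 1)) differentiable (at 0)) \<and> Ck k (partial_deriv i f)))"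

text \<open>$D^\gamma$ differentiates \<open>\<gamma> i\<close> times in direction \<open>i\<close>, for every \<open>i\<close>. The index type carries no
  order, so the order of differentiation is an arbitrary fixed one; it is immaterial for functions
  of class $C^{|\gamma|}$, the only ones to which the operator is applied.\<close>

definition multi_deriv :: "('n \<Rightarrow> nat) \<Rightarrow> (real^'n \<Rightarrow> complex) \<Rightarrow> real^'n \<Rightarrow> complex" where
  "multi_deriv \<gamma> f = fold partial_deriv (SOME is. \<forall>i. count_list is i = \<gamma> i) f"

definition taylor_remainder ::
  "nat \<Rightarrow> (real^'n \<Rightarrow> complex) \<Rightarrow> real^'n \<Rightarrow> real^'n \<Rightarrow> complex" where
  "taylor_remainder m A x y = A x - (\<Sum>\<gamma> | multi_size \<gamma> < m.
     1 / of_nat (multi_fact \<gamma>) * multi_deriv \<gamma> A y * of_real (multi_power (x - y) \<gamma>))"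

lemma finite_multi_size_le: "finite {\<gamma> :: 'n::finite \<Rightarrow> nat. multi_size \<gamma> \<le> k}"
proof (rule finite_subset)
  show "{\<gamma> :: 'n \<Rightarrow> nat. multi_size \<gamma> \<le> k} \<subseteq> UNIV \<rightarrow>\<^sub>E {..k}"
  proof
    fix \<gamma> :: "'n \<Rightarrow> nat" assume "\<gamma> \<in> {\<gamma>. multi_size \<gamma> \<le> k}"
    moreover have "\<gamma> i \<le> multi_size \<gamma>" for i
      unfolding multi_size_def by (rule member_le_sum) auto
    ultimately show "\<gamma> \<in> UNIV \<rightarrow>\<^sub>E {..k}"
      by (auto intro: order_trans)
  qed
  show "finite ((UNIV :: 'n set) \<rightarrow>\<^sub>E {..k})"
    by (intro finite_PiE) auto
qed

lemma ex_count_list_eq: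
  fixes \<gamma> :: "'n::finite \<Rightarrow> nat"
  shows "\<exists>is. \<forall>i. count_list is i = \<gamma> i"
proof -
  obtain js :: "'n list" where js: "set js = UNIV" "distinct js"
    using finite_distinct_list[of "UNIV :: 'n set"] by auto
  have rep: "count_list (replicate k j) i = (if i = j then k else 0)" for k and i j :: 'n
    by (induction k) auto
  have "count_list (concat (map (\<lambda>j. replicate (\<gamma> j) j) ks)) i = (if i \<in> set ks then \<gamma> i else 0)"
    if "distinct ks" for ks :: "'n list" and i
    using that by (induction ks) (auto simp: rep)
  from this[OF js(2)] js(1) show ?thesis by auto
qed


subsection \<open>The operators\<close>

definition T_integrand ::
  "nat \<Rightarrow> (real^'n \<Rightarrow> complex) \<Rightarrow> (real^'n \<Rightarrow> complex) \<Rightarrow> (real^'n \<Rightarrow> complex)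
     \<Rightarrow> real^'n \<Rightarrow> real^'n \<Rightarrow> complex" where
  "T_integrand m \<Omega> A f x y = \<Omega> (x - y) / of_real (norm (x - y) ^ (CARD('n) + m - 1))
     * taylor_remainder m A x y * f y"

definition T_op ::
  "nat \<Rightarrow> (real^'n \<Rightarrow> complex) \<Rightarrow> (real^'n \<Rightarrow> complex) \<Rightarrow> (real^'n \<Rightarrow> complex)
     \<Rightarrow> real^'n \<Rightarrow> complex" where
  "T_op m \<Omega> A f x = (LINT y|lebesgue. T_integrand m \<Omega> A f x y)"

definition M_op ::
  "nat \<Rightarrow> (real^'n \<Rightarrow> complex) \<Rightarrow> (real^'n \<Rightarrow> complex) \<Rightarrow> (real^'n \<Rightarrow> complex)
     \<Rightarrow> real^'n \<Rightarrow> ennreal" where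
  "M_op m \<Omega> A f x = (SUP r\<in>{0<..}. ennreal (1 / r ^ (CARD('n) + m - 1))
     * (\<integral>\<^sup>+ y \<in> {y. norm (x - y) < r}.
          ennreal (cmod (\<Omega> (x - y) * taylor_remainder m A x y * f y)) \<partial>lebesgue))"

end

theory Submission
  imports Defs
begin

text \<open>Taylor's theorem gives \<open>\<bar>R\<^sub>m(A;x,y)\<bar> \<le> C \<Lambda> \<bar>x - y\<bar>\<^bsup>m-1+\<beta>\<^esup>\<close> with \<open>\<Lambda>\<close> the sum of the Lipschitz norms, so
  both operators are dominated pointwise by the rough fractional integral of \<open>\<bar>f\<bar>\<close> of order \<open>\<beta>\<close>. Hoelder's
  inequality with \<open>\<Omega> \<in> L\<^sup>s\<close> on dyadic annuli dominates the latter by the sum over \<open>j\<close> of the powers \<open>1/s'\<close> of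
  \<open>2\<^bsup>-j(n-\<alpha>)\<^esup>\<close> times the integral of \<open>g = \<bar>f\<bar>\<^bsup>s'\<^esup>\<close> over \<open>B(x, 2\<^sup>j)\<close>, where \<open>\<alpha> = \<beta> s'\<close>.

  On a ball \<open>B(z, r)\<close> this sum is split at \<open>2\<^sup>j = r\<close>. The large scales form a geometric series by the Morrey condition
  and reverse doubling. The small scales only see the restriction of \<open>g\<close> to a dilate of the ball and are
  controlled by the weighted strong type bound. That bound is proved by duality. The \<open>A(P,Q)\<close> condition with
  \<open>P = p/s'\<close>, \<open>Q = q/s'\<close> factors the bilinear form over a family of lattice balls into a product of averages with
  respect to the measures \<open>w\<^sup>q dx\<close> and \<open>\<sigma> dx\<close>, \<open>\<sigma>\<close> the dual weight. Since \<open>p < q\<close>, Hoelder's inequality leaves room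
  in the exponents, and each factor is bounded by an embedding of \<open>L\<^sup>P\<close> into a weighted \<open>l\<^bsup>P1\<^esup>\<close> with \<open>P < P1\<close>. This
  replaces maximal functions, sparse domination and the openness of the \<open>A\<^sub>p\<close> classes.\<close>

subsection \<open>Powers and Hoelder's inequality in the extended reals\<close>

text \<open>The obstacle is overlap at infinitely many scales: every point lies in lattice balls of
  every size, so an embedding of L^P into l^P (\<open>P1 = P\<close>) would meet a divergent overlap
  sum. With \<open>P < P1\<close> the overlap carries a positive power of the measure, and reverse
  doubling makes it a geometric series. The strict gap p < q supplies this room twice: an exponent
  \<open>r1\<close> strictly between p and q serves one measure, and its conjugate
  \<open>r2\<close>, beyond the conjugate of q, serves the other.

  Doubling and reverse doubling come from one consequence of the A(P,Q) condition: a subset filling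
  a fixed share of the volume of a ball carries a fixed share of its weight. The same condition
  supplies local integrability of w^q and of the dual weight, which \<open>weight\<close> does not
  give.

  The second strict gap, \<kappa> < p/q, gives the decay at large scales. Completed measures cause
  the remaining trouble: \<Omega> and f are replaced by Borel versions where joint measurability in
  (x, y) is required, and integrands not shown to be measurable are handled by monotonicity and
  scaling alone.\<close>

lemma ennreal_powr_ennreal [simp]: "0 \<le> x \<Longrightarrow> ennreal_powr (ennreal x) a = ennreal (x powr a)"
  by (simp add: ennreal_powr_def)

lemma ennreal_powr_top [simp]: "ennreal_powr top a = top"
  by (simp add: ennreal_powr_def)

lemma ennreal_powr_0 [simp]: "ennreal_powr 0 a = 0"
  by (simp add: ennreal_powr_def)

lemma ennreal_powr_1 [simp]: "ennreal_powr 1 a = 1"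
  by (simp add: ennreal_powr_def)

lemma ennreal_powr_one [simp]: "ennreal_powr x 1 = x"
  by (cases x) auto

lemma ennreal_powr_eq_0_iff [simp]: "ennreal_powr x a = 0 \<longleftrightarrow> x = 0"
  by (cases x) (auto simp: ennreal_eq_0_iff)

lemma ennreal_powr_eq_top_iff [simp]: "ennreal_powr x a = top \<longleftrightarrow> x = top"
  by (cases x) auto

lemma ennreal_powr_mono: "x \<le> y \<Longrightarrow> 0 \<le> a \<Longrightarrow> ennreal_powr x a \<le> ennreal_powr y a"
  by (cases x; cases y) (auto simp: powr_mono2 top_unique ennreal_leI)

lemma ennreal_powr_mult: "ennreal_powr (x * y) a = ennreal_powr x a * ennreal_powr y a"
proof (cases "x = top \<or> y = top")
  case True
  then show ?thesis by (cases "x = 0"; cases "y = 0") (auto simp: ennreal_mult_top ennreal_top_mult)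
next
  case False
  then show ?thesis by (cases x; cases y) (auto simp: ennreal_mult[symmetric] powr_mult)
qed

lemma ennreal_powr_powr: "ennreal_powr (ennreal_powr x a) b = ennreal_powr x (a * b)"
  by (cases x) (auto simp: powr_powr)

lemma ennreal_powr_add: "ennreal_powr x (a + b) = ennreal_powr x a * ennreal_powr x b"
  by (cases x) (auto simp: powr_add ennreal_mult[symmetric])

lemma ennreal_powr_le_iff: "0 < a \<Longrightarrow> ennreal_powr x a \<le> y \<longleftrightarrow> x \<le> ennreal_powr y (1 / a)"
proof
  assume a: "0 < a" and "ennreal_powr x a \<le> y"
  then have "ennreal_powr (ennreal_powr x a) (1/a) \<le> ennreal_powr y (1/a)"
    by (intro ennreal_powr_mono) auto
  with a show "x \<le> ennreal_powr y (1/a)" by (simp add: ennreal_powr_powr)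
next
  assume a: "0 < a" and "x \<le> ennreal_powr y (1 / a)"
  then have "ennreal_powr x a \<le> ennreal_powr (ennreal_powr y (1/a)) a"
    by (intro ennreal_powr_mono) auto
  with a show "ennreal_powr x a \<le> y" by (simp add: ennreal_powr_powr)
qed

lemma borel_measurable_ennreal_powr [measurable]:
  assumes [measurable]: "f \<in> borel_measurable M"
  shows "(\<lambda>x. ennreal_powr (f x) a) \<in> borel_measurable M"
proof -
  have [measurable]: "{x \<in> space M. f x = top} \<in> sets M" by (intro borel_measurable_eq) auto
  show ?thesis unfolding ennreal_powr_def by (intro measurable_If) auto
qed

lemma ennreal_powr_plus_le:
  assumes "0 < a"
  shows "ennreal_powr (x + y) a \<le> ennreal (2 powr a) * (ennreal_powr x a + ennreal_powr y a)"
proof -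
  have "ennreal_powr (x + y) a \<le> ennreal_powr (2 * max x y) a"
    using assms by (intro ennreal_powr_mono) (auto simp: mult_2 add_mono)
  also have "\<dots> = ennreal (2 powr a) * ennreal_powr (max x y) a"
    using ennreal_powr_ennreal[of 2 a] by (simp add: ennreal_powr_mult)
  also have "ennreal_powr (max x y) a \<le> ennreal_powr x a + ennreal_powr y a"
    by (auto simp: max_def)
  finally show ?thesis by (simp add: mult_left_mono)
qed

lemma Youngs_inequality_ennreal:
  assumes "1 < p" "1 < q" "1/p + 1/q = 1"
  shows "x * y \<le> ennreal_powr x p * ennreal (1/p) + ennreal_powr y q * ennreal (1/q)"
proof (cases "x = top \<or> y = top")
  case True
  have "ennreal (1/p) \<noteq> 0" "ennreal (1/q) \<noteq> 0" using assms by (auto simp: ennreal_eq_0_iff)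
  then show ?thesis using True by (auto simp: ennreal_top_mult)
next
  case False
  then obtain a b where ab: "x = ennreal a" "y = ennreal b" "0 \<le> a" "0 \<le> b"
    by (cases x; cases y) auto
  have "a * b \<le> a powr p / p + b powr q / q"
    by (rule Youngs_inequality) (use assms ab in auto)
  then show ?thesis using ab assms
    by (simp add: ennreal_mult[symmetric] ennreal_plus[symmetric] ennreal_leI del: ennreal_plus)
qed

lemma nn_integral_Holder:
  assumes pq: "1 < p" "1 < q" "1/p + 1/q = 1"
    and [measurable]: "f \<in> borel_measurable M" "g \<in> borel_measurable M"
  shows "(\<integral>\<^sup>+x. f x * g x \<partial>M)
    \<le> ennreal_powr (\<integral>\<^sup>+x. ennreal_powr (f x) p \<partial>M) (1/p) * ennreal_powr (\<integral>\<^sup>+x. ennreal_powr (g x) q \<partial>M) (1/q)"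
proof -
  let ?X = "\<integral>\<^sup>+x. ennreal_powr (f x) p \<partial>M" and ?Y = "\<integral>\<^sup>+x. ennreal_powr (g x) q \<partial>M"
  consider (zero) "?X = 0 \<or> ?Y = 0" | (top) "?X \<noteq> 0" "?Y \<noteq> 0" "?X = top \<or> ?Y = top"
    | (fin) "?X \<noteq> 0" "?Y \<noteq> 0" "?X \<noteq> top" "?Y \<noteq> top" by blast
  then show ?thesis
  proof cases
    case zero
    then have "AE x in M. f x * g x = 0"
      by (auto simp: nn_integral_0_iff_AE)
    then have "(\<integral>\<^sup>+x. f x * g x \<partial>M) = 0" by (simp add: nn_integral_0_iff_AE)
    then show ?thesis by simp
  next
    case top
    then show ?thesis by (auto simp: ennreal_top_mult ennreal_mult_top)
  next
    case fin
    obtain X where X: "?X = ennreal X" "0 < X" using fin by (cases ?X) (auto simp: less_le)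
    obtain Y where Y: "?Y = ennreal Y" "0 < Y" using fin by (cases ?Y) (auto simp: less_le)
    \<comment> \<open>The two norms. Young's inequality for f/A and g/B integrates to 1/p + 1/q = 1,
      and the factor A * B undoes the normalisation. Zero and infinite norms were split off, so both
      numbers are positive and finite.\<close>
    define A B where "A = X powr (1/p)" and "B = Y powr (1/q)"
    have AB: "0 < A" "0 < B" using X Y by (auto simp: A_def B_def)
    have inv_mult: "ennreal (inverse (X * p)) = ennreal (1 / X) * ennreal (1 / p)"
      "ennreal (inverse (Y * q)) = ennreal (1 / Y) * ennreal (1 / q)"
      using X Y pq by (simp_all add: ennreal_mult[symmetric] inverse_eq_divide)
    have ApBq: "(1 / A) powr p = 1 / X" "(1 / B) powr q = 1 / Y"
      using X Y pq by (auto simp: A_def B_def powr_powr powr_divide)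
    have "f x * g x \<le> ennreal (A * B) * (ennreal (inverse (X * p)) * ennreal_powr (f x) p
        + ennreal (inverse (Y * q)) * ennreal_powr (g x) q)" for x
    proof -
      have 1: "ennreal A * ennreal (inverse A) = 1" "ennreal B * ennreal (inverse B) = 1"
        using AB by (simp_all add: ennreal_mult[symmetric])
      have "f x * g x = (ennreal A * ennreal (inverse A)) * (ennreal B * ennreal (inverse B)) * (f x * g x)"
        by (simp only: 1 mult_1)
      also have "\<dots> = ennreal (A * B) * ((f x * ennreal (inverse A)) * (g x * ennreal (inverse B)))"
        using AB by (simp add: ennreal_mult mult_ac)
      also have "\<dots> \<le> ennreal (A * B) * (ennreal_powr (f x * ennreal (inverse A)) p * ennreal (1/p)
          + ennreal_powr (g x * ennreal (inverse B)) q * ennreal (1/q))"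
        by (intro mult_left_mono Youngs_inequality_ennreal pq) auto
      also have "ennreal_powr (f x * ennreal (inverse A)) p * ennreal (1/p) = ennreal (inverse (X * p)) * ennreal_powr (f x) p"
        unfolding inv_mult using AB by (simp add: ennreal_powr_mult ApBq inverse_eq_divide mult_ac)
      also have "ennreal_powr (g x * ennreal (inverse B)) q * ennreal (1/q) = ennreal (inverse (Y * q)) * ennreal_powr (g x) q"
        unfolding inv_mult using AB by (simp add: ennreal_powr_mult ApBq inverse_eq_divide mult_ac)
      finally show ?thesis .
    qed
    then have "(\<integral>\<^sup>+x. f x * g x \<partial>M) \<le> (\<integral>\<^sup>+x. ennreal (A * B) * (ennreal (inverse (X * p)) * ennreal_powr (f x) p
        + ennreal (inverse (Y * q)) * ennreal_powr (g x) q) \<partial>M)" by (intro nn_integral_mono)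
    also have "\<dots> = ennreal (A * B) * (ennreal (inverse (X * p)) * ?X + ennreal (inverse (Y * q)) * ?Y)"
      by (simp add: nn_integral_cmult nn_integral_add)
    also have "\<dots> = ennreal (A * B) * ennreal (inverse p + inverse q)"
    proof -
      have "inverse (X * p) * X = inverse p" "inverse (Y * q) * Y = inverse q"
        using X Y pq by (simp_all add: field_simps)
      then have "ennreal (inverse (X * p)) * ?X = ennreal (inverse p)" "ennreal (inverse (Y * q)) * ?Y = ennreal (inverse q)"
        using X Y pq by (simp_all add: ennreal_mult[symmetric] del: inverse_mult_distrib)
      then show ?thesis using pq by (simp add: ennreal_plus[symmetric] del: ennreal_plus)
    qed
    also have "\<dots> = ennreal A * ennreal B"
      using pq AB by (simp add: ennreal_mult inverse_eq_divide)
    finally show ?thesis unfolding X Y A_def B_def using X Y by simp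
  qed
qed

subsection \<open>Embedding of averages over scale-sparse families\<close>

text \<open>Hoelder's inequality against the indicator of B; the exponent of the measure is P/P' = P
  - 1 with P' conjugate to P.\<close>

lemma nn_integral_powr_le:
  assumes "1 < P" and [measurable]: "B \<in> sets M" "g \<in> borel_measurable M" and b: "emeasure M B = ennreal b" "0 < b"
  shows "ennreal_powr (\<integral>\<^sup>+x\<in>B. g x \<partial>M) P \<le> ennreal (b powr (P - 1)) * (\<integral>\<^sup>+x\<in>B. ennreal_powr (g x) P \<partial>M)"
proof -
  define P' where "P' = P / (P - 1)"
  have P': "1 < P'" "1/P + 1/P' = 1" and P1: "P / P' = P - 1"
    using assms(1) by (auto simp: P'_def field_simps)
  have "(\<integral>\<^sup>+x\<in>B. g x \<partial>M) = (\<integral>\<^sup>+x. (g x * indicator B x) * indicator B x \<partial>M)"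
    by (intro nn_integral_cong) (auto simp: indicator_def)
  also have "\<dots> \<le> ennreal_powr (\<integral>\<^sup>+x. ennreal_powr (g x * indicator B x) P \<partial>M) (1/P)
      * ennreal_powr (\<integral>\<^sup>+x. ennreal_powr (indicator B x) P' \<partial>M) (1/P')"
    using assms(1) P' by (intro nn_integral_Holder) auto
  also have "(\<integral>\<^sup>+x. ennreal_powr (indicator B x) P' \<partial>M) = (\<integral>\<^sup>+x. indicator B x \<partial>M)"
    by (intro nn_integral_cong) (auto simp: indicator_def)
  also have "(\<integral>\<^sup>+x. indicator B x \<partial>M) = ennreal b" using b by simp
  also have "(\<integral>\<^sup>+x. ennreal_powr (g x * indicator B x) P \<partial>M) = (\<integral>\<^sup>+x\<in>B. ennreal_powr (g x) P \<partial>M)"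
    by (intro nn_integral_cong) (auto simp: indicator_def)
  finally have "ennreal_powr (\<integral>\<^sup>+x\<in>B. g x \<partial>M) P \<le>
      ennreal_powr (ennreal_powr (\<integral>\<^sup>+x\<in>B. ennreal_powr (g x) P \<partial>M) (1/P) * ennreal_powr (ennreal b) (1/P')) P"
    using assms(1) by (intro ennreal_powr_mono) auto
  also have "\<dots> = ennreal (b powr (P - 1)) * (\<integral>\<^sup>+x\<in>B. ennreal_powr (g x) P \<partial>M)"
    using assms(1) b(2) by (simp add: ennreal_powr_mult ennreal_powr_powr P1 powr_powr mult.commute)
  finally show ?thesis .
qed

text \<open>The proof splits $G$ at the height $b_i^{-1/P}$, separately for every $i$. This is real
  interpolation between the two overlap conditions and avoids maximal functions.\<close>

lemma sum_averages_le_normalized: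
  fixes B :: "'i::countable \<Rightarrow> 'a set" and b :: "'i \<Rightarrow> real" and G :: "'a \<Rightarrow> real"
  assumes B [measurable]: "\<And>i. B i \<in> sets M" and b: "\<And>i. emeasure M (B i) = ennreal (b i)" "\<And>i. 0 < b i"
    and P: "1 < P" "P < P1" and K: "0 \<le> K"
    and low: "\<And>x t. 0 < t \<Longrightarrow> (\<integral>\<^sup>+i. indicator (B i) x * indicator {i. b i \<le> t} i * ennreal (b i powr (P1/P - 1))
        \<partial>count_space UNIV) \<le> ennreal (K * t powr (P1/P - 1))"
    and high: "\<And>x t. 0 < t \<Longrightarrow> (\<integral>\<^sup>+i. indicator (B i) x * indicator {i. t < b i} i * ennreal (b i powr (1/P - 1))
        \<partial>count_space UNIV) \<le> ennreal (K * t powr (1/P - 1))"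
    and G [measurable]: "G \<in> borel_measurable M" and G0: "\<And>x. 0 \<le> G x"
    and norm: "(\<integral>\<^sup>+x. ennreal (G x powr P) \<partial>M) \<le> 1"
  shows "(\<integral>\<^sup>+i. ennreal (b i powr (P1/P - P1)) * ennreal_powr (\<integral>\<^sup>+x\<in>B i. ennreal (G x) \<partial>M) P1 \<partial>count_space UNIV)
    \<le> ennreal (2 powr P1 * (2 * K))"
proof -
  define lo hi where "lo i x = (if G x \<le> b i powr (-1/P) then G x else 0)"
    and "hi i x = (if G x \<le> b i powr (-1/P) then 0 else G x)" for i x
  have [measurable]: "lo i \<in> borel_measurable M" "hi i \<in> borel_measurable M" for i
    unfolding lo_def hi_def by measurable
  have nonneg: "0 \<le> lo i x" "0 \<le> hi i x" for i x by (auto simp: lo_def hi_def G0)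
  have split: "ennreal (G x) = ennreal (lo i x) + ennreal (hi i x)" for i x
    by (auto simp: lo_def hi_def)
  \<comment> \<open>Below the height, Hoelder with the larger exponent \<open>P1\<close> brings the
    power inside the integral. Together with the weight, b_i is left with exponent P1/P - 1, the one
    in \<open>low\<close>.\<close>
  have lo_i: "ennreal (b i powr (P1/P - P1)) * ennreal_powr (\<integral>\<^sup>+x\<in>B i. ennreal (lo i x) \<partial>M) P1
      \<le> (\<integral>\<^sup>+x. indicator (B i) x * ennreal (b i powr (P1/P - 1)) * ennreal (lo i x powr P1) \<partial>M)" for i
  proof -
    have "ennreal_powr (\<integral>\<^sup>+x\<in>B i. ennreal (lo i x) \<partial>M) P1
        \<le> ennreal (b i powr (P1 - 1)) * (\<integral>\<^sup>+x\<in>B i. ennreal_powr (ennreal (lo i x)) P1 \<partial>M)"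
      using P by (intro nn_integral_powr_le b) auto
    then have "ennreal (b i powr (P1/P - P1)) * ennreal_powr (\<integral>\<^sup>+x\<in>B i. ennreal (lo i x) \<partial>M) P1
      \<le> ennreal (b i powr (P1/P - P1)) * (ennreal (b i powr (P1 - 1)) * (\<integral>\<^sup>+x\<in>B i. ennreal_powr (ennreal (lo i x)) P1 \<partial>M))"
      by (intro mult_left_mono) auto
    also have "\<dots> = ennreal (b i powr (P1/P - 1)) * (\<integral>\<^sup>+x\<in>B i. ennreal (lo i x powr P1) \<partial>M)"
      using nonneg by (simp add: mult.assoc[symmetric] ennreal_mult[symmetric] powr_add[symmetric])
    also have "\<dots> = (\<integral>\<^sup>+x. indicator (B i) x * ennreal (b i powr (P1/P - 1)) * ennreal (lo i x powr P1) \<partial>M)"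
      by (subst nn_integral_cmult[symmetric]) (auto simp: mult_ac)
    finally show ?thesis .
  qed
  \<comment> \<open>Above the height only one of the \<open>P1\<close> factors of the integral is
    kept. The other P1 - 1 are bounded through \<open>?Y\<close> \<le> b_i powr (1 - 1/P), which
    Hoelder and the normalised P-norm give. The exponent left is 1/P - 1, the one in
    \<open>high\<close>.\<close>
  have hi_i: "ennreal (b i powr (P1/P - P1)) * ennreal_powr (\<integral>\<^sup>+x\<in>B i. ennreal (hi i x) \<partial>M) P1
      \<le> (\<integral>\<^sup>+x. indicator (B i) x * ennreal (b i powr (1/P - 1)) * ennreal (hi i x) \<partial>M)" for i
  proof -
    let ?Y = "\<integral>\<^sup>+x\<in>B i. ennreal (hi i x) \<partial>M"
    have "ennreal_powr ?Y P \<le> ennreal (b i powr (P - 1)) * (\<integral>\<^sup>+x\<in>B i. ennreal_powr (ennreal (hi i x)) P \<partial>M)"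
      using P by (intro nn_integral_powr_le b) auto
    also have "(\<integral>\<^sup>+x\<in>B i. ennreal_powr (ennreal (hi i x)) P \<partial>M) \<le> (\<integral>\<^sup>+x. ennreal (G x powr P) \<partial>M)"
      by (intro nn_integral_mono) (auto simp: indicator_def hi_def G0)
    also note norm
    finally have "ennreal_powr ?Y P \<le> ennreal (b i powr (P - 1))" by (simp add: mult_left_mono)
    then have "?Y \<le> ennreal (b i powr (1 - 1/P))"
      using P by (simp add: ennreal_powr_le_iff powr_powr diff_divide_distrib)
    then have "ennreal_powr ?Y (P1 - 1) \<le> ennreal_powr (ennreal (b i powr (1 - 1/P))) (P1 - 1)"
      using P by (intro ennreal_powr_mono) auto
    then have "ennreal_powr ?Y (P1 - 1) \<le> ennreal (b i powr ((1 - 1/P) * (P1 - 1)))"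
      by (simp add: powr_powr)
    then have "ennreal (b i powr (P1/P - P1)) * ennreal_powr ?Y (1 + (P1 - 1))
        \<le> ennreal (b i powr (P1/P - P1)) * (?Y * ennreal (b i powr ((1 - 1/P) * (P1 - 1))))"
      unfolding ennreal_powr_add ennreal_powr_one by (intro mult_left_mono) auto
    also have "\<dots> = ennreal (b i powr (P1/P - P1) * b i powr ((1 - 1/P) * (P1 - 1))) * ?Y"
      by (simp add: ennreal_mult mult_ac)
    also have "b i powr (P1/P - P1) * b i powr ((1 - 1/P) * (P1 - 1)) = b i powr (1/P - 1)"
      using P unfolding powr_add[symmetric] by (simp add: field_simps)
    also have "ennreal (b i powr (1/P - 1)) * ?Y = (\<integral>\<^sup>+x. indicator (B i) x * ennreal (b i powr (1/P - 1)) * ennreal (hi i x) \<partial>M)"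
      by (subst nn_integral_cmult[symmetric]) (auto simp: mult_ac)
    finally show ?thesis by simp
  qed
  \<comment> \<open>Seen from a fixed point x, the cut separates the indices by comparing b_i with t
    = G(x) powr (-P). At this t both overlap conditions turn the respective power of G(x) into K *
    G(x) powr P.\<close>
  have cut: "G x \<le> b i powr (-1/P) \<longleftrightarrow> b i \<le> G x powr (-P)" if "0 < G x" for i x
  proof
    assume "G x \<le> b i powr (-1/P)"
    then have "(b i powr (-1/P)) powr (-P) \<le> G x powr (-P)"
      using that P by (intro powr_mono2') auto
    then show "b i \<le> G x powr (-P)" using P b(2)[of i] by (simp add: powr_powr)
  next
    assume "b i \<le> G x powr (-P)"
    then have "(G x powr (-P)) powr (-1/P) \<le> b i powr (-1/P)"
      using b(2)[of i] P by (intro powr_mono2') auto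
    then show "G x \<le> b i powr (-1/P)" using P that by (simp add: powr_powr)
  qed
  have lo_x: "(\<integral>\<^sup>+i. indicator (B i) x * ennreal (b i powr (P1/P - 1)) * ennreal (lo i x powr P1) \<partial>count_space UNIV)
      \<le> ennreal K * ennreal (G x powr P)" for x
  proof (cases "G x = 0")
    case False
    then have G1: "0 < G x" using G0[of x] by simp
    have "(\<integral>\<^sup>+i. indicator (B i) x * ennreal (b i powr (P1/P - 1)) * ennreal (lo i x powr P1) \<partial>count_space UNIV)
      = (\<integral>\<^sup>+i. ennreal (G x powr P1) * (indicator (B i) x * indicator {i. b i \<le> G x powr (-P)} i * ennreal (b i powr (P1/P - 1))) \<partial>count_space UNIV)"
      unfolding lo_def cut[OF G1] by (intro nn_integral_cong) (auto simp: indicator_def mult_ac)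
    also have "\<dots> = ennreal (G x powr P1) * (\<integral>\<^sup>+i. indicator (B i) x * indicator {i. b i \<le> G x powr (-P)} i * ennreal (b i powr (P1/P - 1)) \<partial>count_space UNIV)"
      by (rule nn_integral_cmult) simp
    also have "\<dots> \<le> ennreal (G x powr P1) * ennreal (K * (G x powr (-P)) powr (P1/P - 1))"
      using G1 by (intro mult_left_mono low) auto
    also have "\<dots> = ennreal K * ennreal (G x powr P1 * G x powr (-P * (P1/P - 1)))"
      using K by (simp add: powr_powr ennreal_mult mult_ac)
    also have "G x powr P1 * G x powr (-P * (P1/P - 1)) = G x powr P"
      using P unfolding powr_add[symmetric] by (simp add: field_simps)
    finally show ?thesis .
  qed (use P in \<open>simp add: lo_def\<close>)
  have hi_x: "(\<integral>\<^sup>+i. indicator (B i) x * ennreal (b i powr (1/P - 1)) * ennreal (hi i x) \<partial>count_space UNIV)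
      \<le> ennreal K * ennreal (G x powr P)" for x
  proof (cases "G x = 0")
    case False
    then have G1: "0 < G x" using G0[of x] by simp
    have "(\<integral>\<^sup>+i. indicator (B i) x * ennreal (b i powr (1/P - 1)) * ennreal (hi i x) \<partial>count_space UNIV)
      = (\<integral>\<^sup>+i. ennreal (G x) * (indicator (B i) x * indicator {i. G x powr (-P) < b i} i * ennreal (b i powr (1/P - 1))) \<partial>count_space UNIV)"
      unfolding hi_def cut[OF G1] by (intro nn_integral_cong) (auto simp: indicator_def mult_ac)
    also have "\<dots> = ennreal (G x) * (\<integral>\<^sup>+i. indicator (B i) x * indicator {i. G x powr (-P) < b i} i * ennreal (b i powr (1/P - 1)) \<partial>count_space UNIV)"
      by (rule nn_integral_cmult) simp
    also have "\<dots> \<le> ennreal (G x) * ennreal (K * (G x powr (-P)) powr (1/P - 1))"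
      using G1 by (intro mult_left_mono high) auto
    also have "\<dots> = ennreal K * ennreal (G x powr 1 * G x powr (-P * (1/P - 1)))"
      using K G0 by (simp add: powr_powr ennreal_mult mult_ac)
    also have "G x powr 1 * G x powr (-P * (1/P - 1)) = G x powr P"
      using P unfolding powr_add[symmetric] by (simp add: field_simps)
    finally show ?thesis .
  qed (use P in \<open>simp add: hi_def\<close>)
  have GP: "(\<integral>\<^sup>+x. ennreal K * ennreal (G x powr P) \<partial>M) \<le> ennreal K"
    using mult_left_mono[OF norm, of "ennreal K"] by (simp add: nn_integral_cmult)
  have "ennreal (b i powr (P1/P - P1)) * ennreal_powr (\<integral>\<^sup>+x\<in>B i. ennreal (G x) \<partial>M) P1
     \<le> ennreal (2 powr P1) * ((\<integral>\<^sup>+x. indicator (B i) x * ennreal (b i powr (P1/P - 1)) * ennreal (lo i x powr P1) \<partial>M)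
       + (\<integral>\<^sup>+x. indicator (B i) x * ennreal (b i powr (1/P - 1)) * ennreal (hi i x) \<partial>M))" for i
  proof -
    let ?X = "\<integral>\<^sup>+x\<in>B i. ennreal (lo i x) \<partial>M" and ?Y = "\<integral>\<^sup>+x\<in>B i. ennreal (hi i x) \<partial>M"
    have "(\<integral>\<^sup>+x\<in>B i. ennreal (G x) \<partial>M) = ?X + ?Y"
      by (subst nn_integral_add[symmetric]) (auto simp: split[of _ i] distrib_right)
    then have "ennreal (b i powr (P1/P - P1)) * ennreal_powr (\<integral>\<^sup>+x\<in>B i. ennreal (G x) \<partial>M) P1
       \<le> ennreal (b i powr (P1/P - P1)) * (ennreal (2 powr P1) * (ennreal_powr ?X P1 + ennreal_powr ?Y P1))"
      using P by (auto intro!: mult_left_mono ennreal_powr_plus_le)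
    also have "\<dots> = ennreal (2 powr P1) * (ennreal (b i powr (P1/P - P1)) * ennreal_powr ?X P1 + ennreal (b i powr (P1/P - P1)) * ennreal_powr ?Y P1)"
      by (simp add: algebra_simps)
    also have "\<dots> \<le> ennreal (2 powr P1) * ((\<integral>\<^sup>+x. indicator (B i) x * ennreal (b i powr (P1/P - 1)) * ennreal (lo i x powr P1) \<partial>M)
       + (\<integral>\<^sup>+x. indicator (B i) x * ennreal (b i powr (1/P - 1)) * ennreal (hi i x) \<partial>M))"
      by (intro mult_left_mono add_mono lo_i hi_i) auto
    finally show ?thesis .
  qed
  then have "(\<integral>\<^sup>+i. ennreal (b i powr (P1/P - P1)) * ennreal_powr (\<integral>\<^sup>+x\<in>B i. ennreal (G x) \<partial>M) P1 \<partial>count_space UNIV)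
    \<le> (\<integral>\<^sup>+i. ennreal (2 powr P1) * ((\<integral>\<^sup>+x. indicator (B i) x * ennreal (b i powr (P1/P - 1)) * ennreal (lo i x powr P1) \<partial>M)
       + (\<integral>\<^sup>+x. indicator (B i) x * ennreal (b i powr (1/P - 1)) * ennreal (hi i x) \<partial>M)) \<partial>count_space UNIV)"
    by (intro nn_integral_mono)
  also have "\<dots> = ennreal (2 powr P1) *
      ((\<integral>\<^sup>+i. \<integral>\<^sup>+x. indicator (B i) x * ennreal (b i powr (P1/P - 1)) * ennreal (lo i x powr P1) \<partial>M \<partial>count_space UNIV)
       + (\<integral>\<^sup>+i. \<integral>\<^sup>+x. indicator (B i) x * ennreal (b i powr (1/P - 1)) * ennreal (hi i x) \<partial>M \<partial>count_space UNIV))"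
    by (simp add: nn_integral_cmult nn_integral_add)
  also have "(\<integral>\<^sup>+i. \<integral>\<^sup>+x. indicator (B i) x * ennreal (b i powr (P1/P - 1)) * ennreal (lo i x powr P1) \<partial>M \<partial>count_space UNIV)
     = (\<integral>\<^sup>+x. \<integral>\<^sup>+i. indicator (B i) x * ennreal (b i powr (P1/P - 1)) * ennreal (lo i x powr P1) \<partial>count_space UNIV \<partial>M)"
    by (rule nn_integral_count_space_nn_integral[symmetric]) auto
  also have "\<dots> \<le> (\<integral>\<^sup>+x. ennreal K * ennreal (G x powr P) \<partial>M)" by (intro nn_integral_mono lo_x)
  also note GP
  also have "(\<integral>\<^sup>+i. \<integral>\<^sup>+x. indicator (B i) x * ennreal (b i powr (1/P - 1)) * ennreal (hi i x) \<partial>M \<partial>count_space UNIV)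
     = (\<integral>\<^sup>+x. \<integral>\<^sup>+i. indicator (B i) x * ennreal (b i powr (1/P - 1)) * ennreal (hi i x) \<partial>count_space UNIV \<partial>M)"
    by (rule nn_integral_count_space_nn_integral[symmetric]) auto
  also have "\<dots> \<le> (\<integral>\<^sup>+x. ennreal K * ennreal (G x powr P) \<partial>M)" by (intro nn_integral_mono hi_x)
  also note GP
  also have "ennreal (2 powr P1) * (ennreal K + ennreal K) = ennreal (2 powr P1 * (2 * K))"
    using K by (simp add: ennreal_mult ennreal_plus[symmetric] del: ennreal_plus)
  finally show ?thesis by (simp add: mult_left_mono add_mono)
qed

text \<open>For the sets through a fixed point, the power sums behave like geometric series
  dominated by their extreme term, uniformly in x and t. All e > 0 are demanded because each
  embedding needs two values, e = P1/P - 1 in the first sum and e = 1 - 1/P in the second.\<close>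

definition scale_sparse :: "('i \<Rightarrow> 'a set) \<Rightarrow> ('i \<Rightarrow> real) \<Rightarrow> bool" where
  "scale_sparse B b \<longleftrightarrow> (\<forall>e>0.
     (\<exists>K>0. \<forall>x. \<forall>t>0. (\<integral>\<^sup>+i. indicator (B i) x * indicator {i. b i \<le> t} i * ennreal (b i powr e)
        \<partial>count_space UNIV) \<le> ennreal (K * t powr e)) \<and>
     (\<exists>K>0. \<forall>x. \<forall>t>0. (\<integral>\<^sup>+i. indicator (B i) x * indicator {i. t < b i} i * ennreal (b i powr (- e))
        \<partial>count_space UNIV) \<le> ennreal (K * t powr (- e))))"

text \<open>Both sides are homogeneous of degree \<open>P1\<close> in G, so the normalised case
  suffices; a zero norm forces G = 0 almost everywhere and an infinite one leaves nothing to prove.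
  In terms of averages of G over B_i the weight is b_i powr (P1/P).\<close>

lemma sum_averages_le:
  fixes B :: "'i::countable \<Rightarrow> 'a set" and b :: "'i \<Rightarrow> real"
  assumes B [measurable]: "\<And>i. B i \<in> sets M" and b: "\<And>i. emeasure M (B i) = ennreal (b i)" "\<And>i. 0 < b i"
    and P: "1 < P" "P < P1" and sparse: "scale_sparse B b"
  shows "\<exists>C>0. \<forall>G :: 'a \<Rightarrow> real. G \<in> borel_measurable M \<longrightarrow> (\<forall>x. 0 \<le> G x) \<longrightarrow>
    (\<integral>\<^sup>+i. ennreal (b i powr (P1/P - P1)) * ennreal_powr (\<integral>\<^sup>+x\<in>B i. ennreal (G x) \<partial>M) P1 \<partial>count_space UNIV)
      \<le> ennreal C * ennreal_powr (\<integral>\<^sup>+x. ennreal (G x powr P) \<partial>M) (P1/P)"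
proof -
  have "0 < P1/P - 1" "0 < 1 - 1/P" using P by (auto simp: field_simps)
  obtain K1 where K1: "0 < K1" "\<And>x t. 0 < t \<Longrightarrow> (\<integral>\<^sup>+i. indicator (B i) x * indicator {i. b i \<le> t} i * ennreal (b i powr (P1/P - 1))
        \<partial>count_space UNIV) \<le> ennreal (K1 * t powr (P1/P - 1))"
    using sparse \<open>0 < P1/P - 1\<close> unfolding scale_sparse_def by meson
  obtain K2 where K2: "0 < K2" "\<And>x t. 0 < t \<Longrightarrow> (\<integral>\<^sup>+i. indicator (B i) x * indicator {i. t < b i} i * ennreal (b i powr (- (1 - 1/P)))
        \<partial>count_space UNIV) \<le> ennreal (K2 * t powr (- (1 - 1/P)))"
    using sparse \<open>0 < 1 - 1/P\<close> unfolding scale_sparse_def by meson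
  define K where "K = max K1 K2"
  have K: "0 < K" using K1 by (simp add: K_def)
  have low: "(\<integral>\<^sup>+i. indicator (B i) x * indicator {i. b i \<le> t} i * ennreal (b i powr (P1/P - 1))
        \<partial>count_space UNIV) \<le> ennreal (K * t powr (P1/P - 1))" if "0 < t" for x t
    using K1(2)[OF that, of x] by (rule order_trans) (auto simp: K_def intro!: ennreal_leI mult_right_mono)
  have high: "(\<integral>\<^sup>+i. indicator (B i) x * indicator {i. t < b i} i * ennreal (b i powr (1/P - 1))
        \<partial>count_space UNIV) \<le> ennreal (K * t powr (1/P - 1))" if "0 < t" for x t
    using K2(2)[OF that, of x] unfolding minus_diff_eq
    by (rule order_trans) (auto simp: K_def intro!: ennreal_leI mult_right_mono)
  define C where "C = 2 powr P1 * (2 * K)"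
  have C: "0 < C" using K by (simp add: C_def)
  show ?thesis
  proof (intro exI[of _ C] conjI C allI impI)
    fix G :: "'a \<Rightarrow> real" assume [measurable]: "G \<in> borel_measurable M" and "\<forall>x. 0 \<le> G x"
    then have G0: "0 \<le> G x" for x by simp
    let ?N = "\<integral>\<^sup>+x. ennreal (G x powr P) \<partial>M"
    let ?L = "\<lambda>G. (\<integral>\<^sup>+i. ennreal (b i powr (P1/P - P1)) * ennreal_powr (\<integral>\<^sup>+x\<in>B i. ennreal (G x) \<partial>M) P1 \<partial>count_space UNIV)"
    show "?L G \<le> ennreal C * ennreal_powr ?N (P1/P)"
    proof (cases ?N)
      case top
      then show ?thesis using C by (simp add: ennreal_mult_top)
    next
      case (real r)
      show ?thesis
      proof (cases "r = 0")
        case True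
        then have "AE x in M. G x = 0"
          using real by (simp add: nn_integral_0_iff_AE powr_eq_0_iff)
        then have "(\<integral>\<^sup>+x\<in>B i. ennreal (G x) \<partial>M) = 0" for i
          by (subst nn_integral_0_iff_AE) auto
        then show ?thesis by simp
      next
        case False
        then have r: "0 < r" using real by simp
        define c where "c = r powr (1/P)"
        have c: "0 < c" "c powr P = r" "c powr P1 = r powr (P1/P)" using r P by (auto simp: c_def powr_powr)
        have "?L (\<lambda>x. G x / c) \<le> ennreal C"
          unfolding C_def
        proof (rule sum_averages_le_normalized[OF B b P _ low high])
          have "(\<integral>\<^sup>+x. ennreal ((G x / c) powr P) \<partial>M) = (\<integral>\<^sup>+x. ennreal (1/r) * ennreal (G x powr P) \<partial>M)"
            using c r G0 by (simp add: powr_divide ennreal_mult[symmetric])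
          also have "\<dots> = ennreal (1/r) * ennreal r" using real by (simp add: nn_integral_cmult)
          also have "\<dots> = 1" using r by (simp add: ennreal_mult[symmetric])
          finally show "(\<integral>\<^sup>+x. ennreal ((G x / c) powr P) \<partial>M) \<le> 1" by simp
        qed (use c G0 K in auto)
        then have "ennreal (c powr P1) * ?L (\<lambda>x. G x / c) \<le> ennreal (c powr P1) * ennreal C"
          by (intro mult_left_mono) auto
        also have "ennreal (c powr P1) * ?L (\<lambda>x. G x / c) = ?L G"
        proof -
          have "ennreal (c powr P1) * ennreal_powr (\<integral>\<^sup>+x\<in>B i. ennreal (G x / c) \<partial>M) P1
             = ennreal_powr (\<integral>\<^sup>+x\<in>B i. ennreal (G x) \<partial>M) P1" for i
          proof -
            have "ennreal (c powr P1) * ennreal_powr (\<integral>\<^sup>+x\<in>B i. ennreal (G x / c) \<partial>M) P1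
              = ennreal_powr (ennreal c * (\<integral>\<^sup>+x\<in>B i. ennreal (G x / c) \<partial>M)) P1"
              using c by (simp add: ennreal_powr_mult)
            also have "ennreal c * (\<integral>\<^sup>+x\<in>B i. ennreal (G x / c) \<partial>M) = (\<integral>\<^sup>+x\<in>B i. ennreal (G x) \<partial>M)"
              using c G0 by (subst nn_integral_cmult[symmetric])
                (auto intro!: nn_integral_cong simp: ennreal_mult[symmetric] mult.assoc[symmetric])
            finally show ?thesis .
          qed
          then show ?thesis
            by (subst nn_integral_cmult[symmetric]) (auto intro!: nn_integral_cong simp: mult.left_commute[of "ennreal (c powr P1)"])
        qed
        finally show ?thesis using real c C by (simp add: mult.commute)
      qed
    qed
  qed
qed

subsection \<open>Doubling measures and lattice balls\<close>

text \<open>Growth by the factor 1/\<theta> makes the terms decay geometrically downwards from the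
  largest index with \<tau> j \<le> t, so the sum is at most \<open>t powr e\<close> times the
  geometric series of ratio \<open>\<theta> powr e\<close>.\<close>

lemma geometric_sum_below:
  fixes \<tau> :: "int \<Rightarrow> real"
  assumes pos: "\<And>j. 0 < \<tau> j" and th: "0 < \<theta>" "\<theta> < 1" and growth: "\<And>j. \<tau> j \<le> \<theta> * \<tau> (j + 1)"
    and e: "0 < e" and t: "0 < t"
  shows "(\<integral>\<^sup>+j. indicator {j. \<tau> j \<le> t} j * ennreal (\<tau> j powr e) \<partial>count_space UNIV)
    \<le> ennreal (t powr e / (1 - \<theta> powr e))"
proof (cases "{j. \<tau> j \<le> t} = {}")
  case True
  then show ?thesis by simp
next
  case False
  then obtain j0 where j0: "\<tau> j0 \<le> t" by auto
  have iter: "\<tau> (j - int i) \<le> \<theta> ^ i * \<tau> j" for i j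
  proof (induction i)
    case (Suc i)
    have "\<tau> (j - int (Suc i)) \<le> \<theta> * \<tau> (j - int i)"
      using growth[of "j - int (Suc i)"] by (simp add: algebra_simps)
    also have "\<dots> \<le> \<theta> * (\<theta> ^ i * \<tau> j)" using Suc th by (intro mult_left_mono) auto
    finally show ?case by (simp add: mult_ac)
  qed simp
  have mono: "\<tau> i \<le> \<tau> j" if "i \<le> j" for i j
  proof -
    have "\<tau> (j - int (nat (j - i))) \<le> \<theta> ^ nat (j - i) * \<tau> j" by (rule iter)
    also have "\<dots> \<le> 1 * \<tau> j" using th pos[of j] by (intro mult_right_mono power_le_one) auto
    finally show ?thesis using that by simp
  qed
  \<comment> \<open>After m steps of growth \<open>\<tau> j0\<close> has passed t, which bounds the
    admissible indices by j0 + m.\<close>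
  obtain m where m: "\<theta> ^ m < \<tau> j0 / t"
    using real_arch_pow_inv[of "\<tau> j0 / t" \<theta>] th pos t by auto
  have bdd: "j < j0 + int m" if "\<tau> j \<le> t" for j
  proof (rule ccontr)
    assume "\<not> j < j0 + int m"
    then have "\<tau> (j0 + int m) \<le> t" using mono[of "j0 + int m" j] that by simp
    then have "\<tau> j0 \<le> \<theta> ^ m * t"
      using iter[of "j0 + int m" m] th by (smt (verit) add_diff_cancel_right' mult_left_mono zero_le_power)
    with m t show False by (simp add: field_simps)
  qed
  \<comment> \<open>\<open>Max\<close> needs a finite set. Cutting below at \<open>j0\<close> keeps
    \<open>j0\<close> itself and therefore does not change the maximum.\<close>
  define S where "S = {j. \<tau> j \<le> t} \<inter> {j0..j0 + int m}"
  have "finite S" "j0 \<in> S" using j0 by (auto simp: S_def)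
  define J where "J = Max S"
  have "J \<in> S" unfolding J_def using \<open>finite S\<close> \<open>j0 \<in> S\<close> by (intro Max_in) auto
  then have J: "\<tau> J \<le> t" by (simp add: S_def)
  have le_J: "j \<le> J" if "\<tau> j \<le> t" for j
  proof (cases "j0 \<le> j")
    case True
    then have "j \<in> S" using that bdd[of j] by (auto simp: S_def)
    then show ?thesis using \<open>finite S\<close> by (simp add: J_def)
  next
    case False
    have "j0 \<le> J" using \<open>finite S\<close> \<open>j0 \<in> S\<close> by (simp add: J_def)
    with False show ?thesis by simp
  qed
  have bij: "bij_betw (\<lambda>i. J - int i) UNIV {..J}"
    by (rule bij_betwI[where g="\<lambda>j. nat (J - j)"]) auto
  have the: "\<theta> powr e < 1" using powr_less_mono2[of e \<theta> 1] th e by simp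
  have "(\<integral>\<^sup>+j. indicator {j. \<tau> j \<le> t} j * ennreal (\<tau> j powr e) \<partial>count_space UNIV)
    \<le> (\<integral>\<^sup>+j. ennreal (\<tau> j powr e) * indicator {..J} j \<partial>count_space UNIV)"
    by (intro nn_integral_mono) (auto simp: indicator_def le_J)
  also have "\<dots> = (\<integral>\<^sup>+j. ennreal (\<tau> j powr e) \<partial>count_space {..J})"
    by (simp add: nn_integral_count_space_indicator)
  also have "\<dots> = (\<integral>\<^sup>+i. ennreal (\<tau> (J - int i) powr e) \<partial>count_space UNIV)"
    by (rule nn_integral_bij_count_space[OF bij, symmetric])
  also have "\<dots> \<le> (\<integral>\<^sup>+i. ennreal (t powr e * (\<theta> powr e) ^ i) \<partial>count_space UNIV)"
  proof (intro nn_integral_mono ennreal_leI)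
    fix i
    have "\<tau> (J - int i) powr e \<le> (\<theta> ^ i * t) powr e"
      using iter[of J i] J e pos[of "J - int i"] th
      by (intro powr_mono2) (auto intro: order_trans mult_left_mono)
    also have "\<dots> = t powr e * (\<theta> powr e) ^ i"
      using th by (simp add: powr_mult powr_power powr_realpow[symmetric] powr_powr mult.commute)
    finally show "\<tau> (J - int i) powr e \<le> t powr e * (\<theta> powr e) ^ i" .
  qed
  also have "\<dots> = (\<Sum>i. ennreal (t powr e * (\<theta> powr e) ^ i))"
    by (rule nn_integral_count_space_nat)
  also have "\<dots> = ennreal (\<Sum>i. t powr e * (\<theta> powr e) ^ i)"
    using the by (intro suminf_ennreal2) (auto intro!: summable_mult summable_geometric)
  also have "(\<Sum>i. t powr e * (\<theta> powr e) ^ i) = t powr e / (1 - \<theta> powr e)"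
    using the by (simp add: suminf_mult suminf_geometric summable_geometric)
  finally show ?thesis .
qed

text \<open>The sequence 1/\<tau>(-j) grows at the same rate, so index reflection and inversion
  reduce the sum over large terms to the one over small terms.\<close>

lemma geometric_sum_above:
  fixes \<tau> :: "int \<Rightarrow> real"
  assumes pos: "\<And>j. 0 < \<tau> j" and th: "0 < \<theta>" "\<theta> < 1" and growth: "\<And>j. \<tau> j \<le> \<theta> * \<tau> (j + 1)"
    and e: "0 < e" and t: "0 < t"
  shows "(\<integral>\<^sup>+j. indicator {j. t \<le> \<tau> j} j * ennreal (\<tau> j powr (- e)) \<partial>count_space UNIV)
    \<le> ennreal (t powr (- e) / (1 - \<theta> powr e))"
proof -
  have "(\<integral>\<^sup>+j. indicator {j. t \<le> \<tau> j} j * ennreal (\<tau> j powr (- e)) \<partial>count_space UNIV)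
    = (\<integral>\<^sup>+j. indicator {j. t \<le> \<tau> j} (- j) * ennreal (\<tau> (- j) powr (- e)) \<partial>count_space UNIV)"
    by (rule nn_integral_bij_count_space[symmetric]) (rule bij_betwI[where g=uminus]; auto)
  also have "\<dots> = (\<integral>\<^sup>+j. indicator {j. inverse (\<tau> (- j)) \<le> inverse t} j * ennreal (inverse (\<tau> (- j)) powr e) \<partial>count_space UNIV)"
    using pos t by (intro nn_integral_cong) (auto simp: indicator_def powr_minus inverse_powr intro: le_imp_inverse_le)
  also have "\<dots> \<le> ennreal (inverse t powr e / (1 - \<theta> powr e))"
  proof (rule geometric_sum_below)
    fix j
    show "inverse (\<tau> (- j)) \<le> \<theta> * inverse (\<tau> (- (j + 1)))"
      using divide_right_mono[OF growth[of "- j - 1"], of "\<tau> (- j) * \<tau> (- j - 1)"] pos[of "- j"] pos[of "- j - 1"]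
      by (simp add: inverse_eq_divide)
  qed (use pos th e t in auto)
  finally show ?thesis by (simp add: powr_minus inverse_powr)
qed

text \<open>The pair (j, k) stands for a ball centred at a point of 2^j Z^n. Rounding every
  coordinate moves a point by at most n 2^j, by the l1 bound; one more 2^j in the radius
  accommodates a whole ball of radius 2^j. These balls do the work of dyadic cubes.\<close>

definition lattice_ball :: "int \<times> ('n::finite \<Rightarrow> int) \<Rightarrow> (real^'n) set" where
  "lattice_ball = (\<lambda>(j, k). ball (\<chi> i. 2 powr j * of_int (k i)) ((CARD('n) + 1) * 2 powr j))"

lemma ball_subset_lattice_ball:
  fixes x :: "real^'n"
  shows "\<exists>k. ball x (2 powr of_int j) \<subseteq> lattice_ball (j, k)"
proof -
  define k where "k i = \<lfloor>x $ i / 2 powr j\<rfloor>" for i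
  define c :: "real^'n" where "c = (\<chi> i. 2 powr j * of_int (k i))"
  have p: "(0::real) < 2 powr j" by simp
  have "\<bar>(x - c) $ i\<bar> \<le> 2 powr j" for i
  proof -
    have "of_int (k i) \<le> x $ i / 2 powr j" "x $ i / 2 powr j \<le> of_int (k i) + 1"
      unfolding k_def by linarith+
    then have "2 powr j * of_int (k i) \<le> x $ i" "x $ i \<le> 2 powr j * of_int (k i) + 2 powr j"
      using p by (simp_all add: field_simps)
    then show ?thesis by (simp add: c_def)
  qed
  then have "norm (x - c) \<le> (\<Sum>i\<in>(UNIV::'n set). 2 powr j)"
    by (intro order_trans[OF norm_le_l1_cart] sum_mono)
  then have "dist c x \<le> CARD('n) * 2 powr j" by (simp add: dist_norm norm_minus_commute)
  then have "ball x (2 powr j) \<subseteq> ball c ((CARD('n) + 1) * 2 powr j)"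
    by (intro ball_subset_ball_iff[THEN iffD2]) (auto simp: dist_commute algebra_simps)
  then show ?thesis unfolding lattice_ball_def c_def by auto
qed

text \<open>Each coordinate of k lies within n + 1 of the floor of x_i / 2^j, which leaves 2(n + 1)
  + 1 integers. What counts is that the bound is independent of x and j.\<close>

lemma card_lattice_ball_le:
  fixes x :: "real^'n"
  shows "finite {k. x \<in> lattice_ball (j, k)}"
    and "card {k. x \<in> lattice_ball (j, k)} \<le> (2 * CARD('n) + 3) ^ CARD('n)"
proof -
  let ?u = "\<lambda>i. \<lfloor>x $ i / 2 powr j\<rfloor>" and ?D = "int CARD('n) + 1"
  let ?S = "PiE UNIV (\<lambda>i::'n. {?u i - ?D .. ?u i + ?D})"
  have sub: "{k. x \<in> lattice_ball (j, k)} \<subseteq> ?S"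
  proof (intro subsetI PiE_I)
    fix k i assume "k \<in> {k. x \<in> lattice_ball (j, k)}"
    then have "norm ((\<chi> i. 2 powr j * of_int (k i)) - x) < (CARD('n) + 1) * 2 powr j"
      by (simp add: lattice_ball_def dist_norm)
    then have "\<bar>2 powr j * of_int (k i) - x $ i\<bar> < (CARD('n) + 1) * 2 powr j"
      using component_le_norm_cart[of "(\<chi> i. 2 powr j * of_int (k i)) - x" i] by simp
    moreover have "2 powr j * of_int (k i) - x $ i = (of_int (k i) - x $ i / 2 powr j) * 2 powr j"
      by (simp add: field_simps)
    ultimately have "\<bar>of_int (k i) - x $ i / 2 powr j\<bar> < CARD('n) + 1"
      by (simp add: abs_mult)
    then show "k i \<in> {?u i - ?D .. ?u i + ?D}"
      by simp linarith
  qed auto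
  have fin: "finite ?S" by (intro finite_PiE) auto
  show "finite {k. x \<in> lattice_ball (j, k)}" by (rule finite_subset[OF sub fin])
  have "card {k. x \<in> lattice_ball (j, k)} \<le> card ?S" by (rule card_mono[OF fin sub])
  also have "\<dots> = (2 * CARD('n) + 3) ^ CARD('n)" by (simp add: card_PiE nat_add_distrib nat_mult_distrib add.commute)
  finally show "card {k. x \<in> lattice_ball (j, k)} \<le> (2 * CARD('n) + 3) ^ CARD('n)" .
qed

text \<open>Doubling compares balls with nearby centres and comparable radii; reverse doubling, with
  \<theta> < 1, gives geometric growth in the radius. The inequalities use the real-valued
  \<open>measure\<close>, which is 0 on sets of infinite measure; \<open>finite_ball\<close>
  excludes that case.\<close>

locale growth_measure =
  fixes M :: "(real^'n) measure" and D \<theta> :: real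
  assumes sets_M [measurable_cong]: "sets M = sets lebesgue"
    and finite_ball: "\<And>x r. emeasure M (ball x r) \<noteq> top"
    and positive_ball: "\<And>x r. 0 < r \<Longrightarrow> emeasure M (ball x r) \<noteq> 0"
    and doubling: "\<And>x r. 0 < r \<Longrightarrow> measure M (ball x (2 * r)) \<le> D * measure M (ball x r)"
    and \<theta>: "0 < \<theta>" "\<theta> < 1"
    and reverse_doubling: "\<And>x r. 0 < r \<Longrightarrow> measure M (ball x r) \<le> \<theta> * measure M (ball x (2 * r))"
begin

lemma sets_ball [measurable, simp]: "ball x r \<in> sets M" by (simp add: sets_M)

lemma emeasure_ball_eq: "emeasure M (ball x r) = ennreal (measure M (ball x r))"
  using finite_ball by (simp add: emeasure_eq_ennreal_measure)

lemma measure_ball_pos: "0 < r \<Longrightarrow> 0 < measure M (ball x r)"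
  using positive_ball[of r x] finite_ball[of x r] by (simp add: measure_def enn2real_positive_iff less_top zero_less_iff_neq_zero)

lemma measure_ball_mono: "ball x r \<subseteq> ball y s \<Longrightarrow> measure M (ball x r) \<le> measure M (ball y s)"
  unfolding measure_def using finite_ball[of y s] by (intro enn2real_mono emeasure_mono) (auto simp: less_top)

lemma D_ge_1: "1 \<le> D"
proof -
  have "1 * measure M (ball 0 1) \<le> D * measure M (ball 0 1)"
    using doubling[of 1 0] measure_ball_mono[of 0 1 0 2] by (simp add: subset_ball)
  then show ?thesis using measure_ball_pos[of 1 0] by simp
qed

lemma doubling_iterate: "0 < r \<Longrightarrow> measure M (ball x (2 ^ m * r)) \<le> D ^ m * measure M (ball x r)"
proof (induction m)
  case (Suc m)
  have "measure M (ball x (2 ^ Suc m * r)) \<le> D * measure M (ball x (2 ^ m * r))"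
    using doubling[of "2 ^ m * r" x] Suc by (simp add: mult_ac)
  also have "\<dots> \<le> D * (D ^ m * measure M (ball x r))"
    using Suc D_ge_1 by (intro mult_left_mono) auto
  finally show ?case by (simp add: mult_ac)
qed simp

lemma dyadic_growth:
  "measure M (ball x (2 powr of_int j)) \<le> \<theta> * measure M (ball x (2 powr of_int (j + 1)))"
  using reverse_doubling[of "2 powr j" x] by (simp add: powr_add mult.commute)

text \<open>All lattice balls of scale j through x have measure comparable to that of B(x, 2^j), and
  their number is bounded. The sum over (j, k) therefore collapses to a sum over j, which is
  geometric by reverse doubling.\<close>

lemma scale_sparse_lattice_ball: "scale_sparse lattice_ball (\<lambda>i. measure M (lattice_ball i))"
proof -
  let ?b = "\<lambda>i. measure M (lattice_ball i)" and ?\<tau> = "\<lambda>x j. measure M (ball x (2 powr of_int j))"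
  \<comment> \<open>A lattice ball through x lies in the ball about x of twice its radius, 2(n + 1)
    2^j; m doublings of B(x, 2^j) cover it.\<close>
  obtain m :: nat where m: "2 * (real CARD('n) + 1) \<le> 2 ^ m"
    using real_arch_pow[of 2 "2 * (real CARD('n) + 1)"] by (auto intro: less_imp_le)
  have upper: "?b (j, k) \<le> D ^ m * ?\<tau> x j" if "x \<in> lattice_ball (j, k)" for x j k
  proof -
    have "lattice_ball (j, k) \<subseteq> ball x (2 ^ m * 2 powr j)"
    proof -
      have "ball c r \<subseteq> ball x (2 * r)" if "x \<in> ball c r" for c and r :: real
      proof
        fix y assume "y \<in> ball c r"
        with that dist_triangle[of x y c] show "y \<in> ball x (2 * r)" by (simp add: dist_commute)
      qed
      then have "lattice_ball (j, k) \<subseteq> ball x (2 * ((CARD('n) + 1) * 2 powr j))"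
        using that unfolding lattice_ball_def by auto
      also have "\<dots> \<subseteq> ball x (2 ^ m * 2 powr j)"
        using mult_right_mono[OF m, of "2 powr j"] by (intro subset_ball) (simp add: mult.assoc)
      finally show ?thesis .
    qed
    then have "?b (j, k) \<le> measure M (ball x (2 ^ m * 2 powr j))"
      unfolding lattice_ball_def by (auto intro: measure_ball_mono)
    also have "\<dots> \<le> D ^ m * ?\<tau> x j" by (rule doubling_iterate) simp
    finally show ?thesis .
  qed
  have lower: "?\<tau> x j \<le> D * ?b (j, k)" if "x \<in> lattice_ball (j, k)" for x j k
  proof -
    define c :: "real^'n" where "c = (\<chi> i. 2 powr j * of_int (k i))"
    have lb: "lattice_ball (j, k) = ball c ((CARD('n) + 1) * 2 powr j)" by (simp add: lattice_ball_def c_def)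
    have "1 * 2 powr j \<le> real (CARD('n) + 1) * 2 powr real_of_int j" by (intro mult_right_mono) auto
    moreover have "dist c x < (CARD('n) + 1) * 2 powr j" using that unfolding lb by simp
    ultimately have "dist x c + 2 powr j \<le> 2 * ((CARD('n) + 1) * 2 powr j)"
      by (subst dist_commute) linarith
    then have "ball x (2 powr j) \<subseteq> ball c (2 * ((CARD('n) + 1) * 2 powr j))"
      by (intro ball_subset_ball_iff[THEN iffD2] disjI1)
    then have "?\<tau> x j \<le> measure M (ball c (2 * ((CARD('n) + 1) * 2 powr j)))"
      by (rule measure_ball_mono)
    also have "\<dots> \<le> D * measure M (ball c ((CARD('n) + 1) * 2 powr j))" by (rule doubling) simp
    finally show ?thesis unfolding lb .
  qed
  define N where "N = (2 * CARD('n) + 3) ^ CARD('n)"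
  have N: "0 < N" by (simp add: N_def)
  \<comment> \<open>Summation over k costs the factor N, the multiplicity bound for one
    scale.\<close>
  have collapse: "(\<integral>\<^sup>+i. f i \<partial>count_space UNIV) \<le> ennreal N * (\<integral>\<^sup>+j. g j \<partial>count_space UNIV)"
    if le: "\<And>j k. f (j, k) \<le> g j * indicator {k. x \<in> lattice_ball (j, k)} k"
    for f :: "int \<times> ('n \<Rightarrow> int) \<Rightarrow> ennreal" and g :: "int \<Rightarrow> ennreal" and x :: "real^'n"
  proof -
    have "(\<integral>\<^sup>+i. f i \<partial>count_space UNIV) = (\<integral>\<^sup>+j. \<integral>\<^sup>+k. f (j, k) \<partial>count_space UNIV \<partial>count_space UNIV)"
      by (rule nn_integral_fst_count_space[symmetric])
    also have "\<dots> \<le> (\<integral>\<^sup>+j. \<integral>\<^sup>+k. g j * indicator {k. x \<in> lattice_ball (j, k)} k \<partial>count_space UNIV \<partial>count_space UNIV)"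
      by (intro nn_integral_mono le)
    also have "\<dots> \<le> (\<integral>\<^sup>+j. ennreal N * g j \<partial>count_space UNIV)"
    proof (intro nn_integral_mono)
      fix j
      have "(\<integral>\<^sup>+k. g j * indicator {k. x \<in> lattice_ball (j, k)} k \<partial>count_space UNIV)
          = g j * of_nat (card {k. x \<in> lattice_ball (j, k)})"
        using card_lattice_ball_le(1)[of x j] by (simp add: nn_integral_cmult_indicator)
      also have "\<dots> \<le> g j * ennreal N"
        using card_lattice_ball_le(2)[of x j, folded N_def]
        by (intro mult_left_mono) (auto simp: ennreal_of_nat_eq_real_of_nat intro!: ennreal_leI)
      finally show "(\<integral>\<^sup>+k. g j * indicator {k. x \<in> lattice_ball (j, k)} k \<partial>count_space UNIV) \<le> ennreal N * g j"
        by (simp add: mult.commute)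
    qed
    also have "\<dots> = ennreal N * (\<integral>\<^sup>+j. g j \<partial>count_space UNIV)" by (rule nn_integral_cmult) simp
    finally show ?thesis .
  qed
  have bpos: "0 < ?b i" for i by (cases i) (auto simp: lattice_ball_def measure_ball_pos)
  have \<tau>pos: "0 < ?\<tau> x j" for x j by (simp add: measure_ball_pos)
  show ?thesis
    unfolding scale_sparse_def
  proof (intro allI impI conjI)
    fix e :: real assume e: "0 < e"
    have the: "\<theta> powr e < 1" using powr_less_mono2[of e \<theta> 1] \<theta> e by simp
    \<comment> \<open>The restriction on b becomes one on \<tau> through \<open>lower\<close>, at
      the cost of \<open>D powr e\<close>; the summand itself is compared through
      \<open>upper\<close>, at the cost of \<open>(D ^ m) powr e\<close>. For the sum over large
      balls below, the two roles are exchanged.\<close>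
    let ?K = "N * ((D ^ m) powr e * (D powr e / (1 - \<theta> powr e)))"
    show "\<exists>K>0. \<forall>x. \<forall>t>0. (\<integral>\<^sup>+i. indicator (lattice_ball i) x * indicator {i. ?b i \<le> t} i * ennreal (?b i powr e)
        \<partial>count_space UNIV) \<le> ennreal (K * t powr e)"
    proof (intro exI[of _ ?K] conjI allI impI)
      show "0 < ?K" using N D_ge_1 the by simp
      fix x :: "real^'n" and t :: real assume t: "0 < t"
      have "(\<integral>\<^sup>+i. indicator (lattice_ball i) x * indicator {i. ?b i \<le> t} i * ennreal (?b i powr e) \<partial>count_space UNIV)
         \<le> ennreal N * (\<integral>\<^sup>+j. ennreal ((D ^ m) powr e) * (indicator {j. ?\<tau> x j \<le> D * t} j * ennreal (?\<tau> x j powr e)) \<partial>count_space UNIV)"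
      proof (rule collapse[where x=x])
        fix j k
        show "indicator (lattice_ball (j, k)) x * indicator {i. ?b i \<le> t} (j, k) * ennreal (?b (j, k) powr e)
          \<le> ennreal ((D ^ m) powr e) * (indicator {j. ?\<tau> x j \<le> D * t} j * ennreal (?\<tau> x j powr e)) * indicator {k. x \<in> lattice_ball (j, k)} k"
        proof (cases "x \<in> lattice_ball (j, k) \<and> ?b (j, k) \<le> t")
          case True
          then have "?\<tau> x j \<le> D * t"
            using lower[of x j k] D_ge_1 by (smt (verit) mult_left_mono)
          moreover have "?b (j, k) powr e \<le> (D ^ m * ?\<tau> x j) powr e"
            using True upper[of x j k] bpos e by (intro powr_mono2) auto
          ultimately show ?thesis using True D_ge_1
            by (simp add: ennreal_mult[symmetric] powr_mult ennreal_leI)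
        qed auto
      qed
      also have "\<dots> = ennreal N * (ennreal ((D ^ m) powr e) * (\<integral>\<^sup>+j. indicator {j. ?\<tau> x j \<le> D * t} j * ennreal (?\<tau> x j powr e) \<partial>count_space UNIV))"
        by (simp add: nn_integral_cmult)
      also have "\<dots> \<le> ennreal N * (ennreal ((D ^ m) powr e) * ennreal ((D * t) powr e / (1 - \<theta> powr e)))"
        using t D_ge_1 by (intro mult_left_mono geometric_sum_below \<tau>pos \<theta> dyadic_growth e) auto
      also have "\<dots> = ennreal (?K * t powr e)"
        using the D_ge_1 t by (simp add: ennreal_mult[symmetric] powr_mult mult_ac)
      finally show "(\<integral>\<^sup>+i. indicator (lattice_ball i) x * indicator {i. ?b i \<le> t} i * ennreal (?b i powr e) \<partial>count_space UNIV)
        \<le> ennreal (?K * t powr e)" .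
    qed
    let ?K = "N * (D powr e * ((D ^ m) powr e / (1 - \<theta> powr e)))"
    show "\<exists>K>0. \<forall>x. \<forall>t>0. (\<integral>\<^sup>+i. indicator (lattice_ball i) x * indicator {i. t < ?b i} i * ennreal (?b i powr (- e))
        \<partial>count_space UNIV) \<le> ennreal (K * t powr (- e))"
    proof (intro exI[of _ ?K] conjI allI impI)
      show "0 < ?K" using N D_ge_1 the by simp
      fix x :: "real^'n" and t :: real assume t: "0 < t"
      have "(\<integral>\<^sup>+i. indicator (lattice_ball i) x * indicator {i. t < ?b i} i * ennreal (?b i powr (- e)) \<partial>count_space UNIV)
         \<le> ennreal N * (\<integral>\<^sup>+j. ennreal (D powr e) * (indicator {j. t / D ^ m \<le> ?\<tau> x j} j * ennreal (?\<tau> x j powr (- e))) \<partial>count_space UNIV)"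
      proof (rule collapse[where x=x])
        fix j k
        show "indicator (lattice_ball (j, k)) x * indicator {i. t < ?b i} (j, k) * ennreal (?b (j, k) powr (- e))
          \<le> ennreal (D powr e) * (indicator {j. t / D ^ m \<le> ?\<tau> x j} j * ennreal (?\<tau> x j powr (- e))) * indicator {k. x \<in> lattice_ball (j, k)} k"
        proof (cases "x \<in> lattice_ball (j, k) \<and> t < ?b (j, k)")
          case True
          then have "t < D ^ m * ?\<tau> x j" using upper[of x j k] by simp
          then have "t / D ^ m \<le> ?\<tau> x j" using D_ge_1 by (simp add: field_simps)
          moreover have "?b (j, k) powr (- e) \<le> (?\<tau> x j / D) powr (- e)"
            using True lower[of x j k] bpos[of "(j, k)"] \<tau>pos[of x j] e D_ge_1
            by (intro powr_mono2') (auto simp: field_simps)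
          moreover have "(?\<tau> x j / D) powr (- e) = D powr e * ?\<tau> x j powr (- e)"
            by (simp add: powr_divide powr_minus field_simps)
          ultimately show ?thesis using True D_ge_1
            by (simp add: ennreal_mult[symmetric] ennreal_leI)
        qed auto
      qed
      also have "\<dots> = ennreal N * (ennreal (D powr e) * (\<integral>\<^sup>+j. indicator {j. t / D ^ m \<le> ?\<tau> x j} j * ennreal (?\<tau> x j powr (- e)) \<partial>count_space UNIV))"
        by (simp add: nn_integral_cmult)
      also have "\<dots> \<le> ennreal N * (ennreal (D powr e) * ennreal ((t / D ^ m) powr (- e) / (1 - \<theta> powr e)))"
        using t D_ge_1 by (intro mult_left_mono geometric_sum_above \<tau>pos \<theta> dyadic_growth e) auto
      also have "\<dots> = ennreal (?K * t powr (- e))"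
        using the D_ge_1 t by (simp add: ennreal_mult[symmetric] powr_divide powr_minus field_simps)
      finally show "(\<integral>\<^sup>+i. indicator (lattice_ball i) x * indicator {i. t < ?b i} i * ennreal (?b i powr (- e)) \<partial>count_space UNIV)
        \<le> ennreal (?K * t powr (- e))" .
    qed
  qed
qed

end

subsection \<open>Weights and duality\<close>

lemma emeasure_lborel_ball_cart:
  fixes x :: "real^'n"
  shows "0 \<le> r \<Longrightarrow> emeasure lborel (ball x r) = ennreal (unit_ball_vol CARD('n) * r ^ CARD('n))"
  by (simp add: emeasure_ball)

lemma nn_integral_ball_pos:
  fixes u :: "real^'n \<Rightarrow> real"
  assumes [measurable]: "u \<in> borel_measurable lebesgue" and pos: "AE x in lebesgue. 0 < u x" and r: "0 < r"
  shows "(\<integral>\<^sup>+y\<in>ball x r. ennreal (u y) \<partial>lebesgue) \<noteq> 0"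
proof
  have [measurable]: "ball x r \<in> sets lebesgue" by simp
  assume "(\<integral>\<^sup>+y\<in>ball x r. ennreal (u y) \<partial>lebesgue) = 0"
  then have "AE y in lebesgue. ennreal (u y) * indicator (ball x r) y = 0"
    by (subst (asm) nn_integral_0_iff_AE) auto
  with pos have "AE y in lebesgue. y \<notin> ball x r"
    by eventually_elim (auto simp: indicator_def)
  then have "emeasure lebesgue (ball x r) = 0"
    by (subst (asm) AE_iff_measurable[OF _ refl]) (auto simp: ball_def)
  moreover have "emeasure lebesgue (ball x r) = ennreal (unit_ball_vol CARD('n) * r ^ CARD('n))"
    using r by (simp add: emeasure_lborel_ball_cart)
  moreover have "0 < unit_ball_vol CARD('n) * r ^ CARD('n)" using r by simp
  ultimately show False by (metis ennreal_eq_0_iff not_le)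
qed

text \<open>Both growth conditions follow from one estimate: a set E inside B(x, 2r) with at least
  the volume of B(x, r) carries the share 1/D of the measure of B(x, 2r). For E = B(x, r) this is
  doubling, for the annulus E = B(x, 2r) - B(x, r) it is reverse doubling. The estimate bounds the
  volume of E by the u- and v-measures of E, then v(E) by v(B(x, 2r)), to which \<open>A\<close>
  applies.\<close>

lemma growth_measure_density:
  fixes u v :: "real^'n \<Rightarrow> real" and a b K :: real
  assumes [measurable]: "u \<in> borel_measurable lebesgue" "v \<in> borel_measurable lebesgue"
    and ab: "0 < a" "0 < b" and K: "0 < K"
    and ae: "AE x in lebesgue. 0 < u x \<and> 0 < v x \<and> u x powr a * v x powr b = 1"
    and fin: "\<And>x r. (\<integral>\<^sup>+y\<in>ball x r. ennreal (u y) \<partial>lebesgue) \<noteq> top"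
    and A: "\<And>x r. 0 < r \<Longrightarrow> ennreal_powr (\<integral>\<^sup>+y\<in>ball x r. ennreal (u y) \<partial>lebesgue) a
       * ennreal_powr (\<integral>\<^sup>+y\<in>ball x r. ennreal (v y) \<partial>lebesgue) b \<le> ennreal (K * r powr (CARD('n) * (a + b)))"
  shows "\<exists>D \<theta>. growth_measure (density lebesgue (\<lambda>x. ennreal (u x))) D \<theta>"
proof -
  let ?M = "density lebesgue (\<lambda>x. ennreal (u x))"
  define t where "t = a + b"
  have t: "0 < t" "1 < t / a" "1 < t / b" "1 / (t/a) + 1 / (t/b) = 1"
  proof -
    show "0 < t" "1 < t / a" "1 < t / b" using ab by (auto simp: t_def field_simps)
    have "a / t + b / t = t / t" by (simp add: t_def add_divide_distrib[symmetric])
    then show "1 / (t/a) + 1 / (t/b) = 1" using ab by (simp add: t_def)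
  qed
  have em: "emeasure ?M E = (\<integral>\<^sup>+x\<in>E. ennreal (u x) \<partial>lebesgue)" if "E \<in> sets lebesgue" for E
    using that by (simp add: emeasure_density)
  have ae_uv: "AE x in lebesgue. 0 < u x" "AE x in lebesgue. 0 < v x" using ae by auto
  have fin': "emeasure ?M (ball x r) \<noteq> top" for x r using fin by (simp add: em)
  \<comment> \<open>Hoelder with exponents t/a and t/b applied to 1 = u powr (a/t) * v powr
    (b/t).\<close>
  have volume: "ennreal_powr (emeasure lebesgue E) t
      \<le> ennreal_powr (emeasure ?M E) a * ennreal_powr (\<integral>\<^sup>+x\<in>E. ennreal (v x) \<partial>lebesgue) b"
    if [measurable]: "E \<in> sets lebesgue" for E
  proof -
    have "emeasure lebesgue E = (\<integral>\<^sup>+x. indicator E x \<partial>lebesgue)" by simp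
    also have "\<dots> = (\<integral>\<^sup>+x. (ennreal (u x powr (a/t)) * indicator E x) * (ennreal (v x powr (b/t)) * indicator E x) \<partial>lebesgue)"
    proof (rule nn_integral_cong_AE)
      show "AE x in lebesgue. indicator E x = (ennreal (u x powr (a/t)) * indicator E x) * (ennreal (v x powr (b/t)) * indicator E x)"
        using ae
      proof eventually_elim
        case (elim x)
        have "u x powr (a/t) * v x powr (b/t) = (u x powr a * v x powr b) powr (1/t)"
          by (simp add: powr_mult powr_powr)
        also have "\<dots> = 1" using elim by simp
        finally show ?case by (simp add: indicator_def ennreal_mult[symmetric])
      qed
    qed
    also have "\<dots> \<le> ennreal_powr (\<integral>\<^sup>+x. ennreal_powr (ennreal (u x powr (a/t)) * indicator E x) (t/a) \<partial>lebesgue) (1/(t/a))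
        * ennreal_powr (\<integral>\<^sup>+x. ennreal_powr (ennreal (v x powr (b/t)) * indicator E x) (t/b) \<partial>lebesgue) (1/(t/b))"
      by (rule nn_integral_Holder[OF t(2-4)]) auto
    also have "(\<integral>\<^sup>+x. ennreal_powr (ennreal (u x powr (a/t)) * indicator E x) (t/a) \<partial>lebesgue) = emeasure ?M E"
      unfolding em[OF that] using ae_uv(1) t ab by (intro nn_integral_cong_AE) (auto simp: indicator_def powr_powr elim!: eventually_mono)
    also have "(\<integral>\<^sup>+x. ennreal_powr (ennreal (v x powr (b/t)) * indicator E x) (t/b) \<partial>lebesgue) = (\<integral>\<^sup>+x\<in>E. ennreal (v x) \<partial>lebesgue)"
      using ae_uv(2) t ab by (intro nn_integral_cong_AE) (auto simp: indicator_def powr_powr elim!: eventually_mono)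
    finally have "ennreal_powr (emeasure lebesgue E) t \<le> ennreal_powr (ennreal_powr (emeasure ?M E) (1/(t/a))
        * ennreal_powr (\<integral>\<^sup>+x\<in>E. ennreal (v x) \<partial>lebesgue) (1/(t/b))) t"
      using t by (intro ennreal_powr_mono) auto
    then show ?thesis using t by (simp add: ennreal_powr_mult ennreal_powr_powr)
  qed
  have [measurable]: "ball x r \<in> sets lebesgue" for x :: "real^'n" and r by simp
  define vol where "vol = unit_ball_vol CARD('n)"
  have vol: "0 < vol" by (simp add: vol_def)
  \<comment> \<open>The constant arising in \<open>main\<close>: the bound \<open>A\<close> at
    radius 2r against the volume of B(x, r), where the powers of r cancel. The maximum with 2 keeps
    1 - 1/D inside (0, 1).\<close>
  define D where "D = max 2 ((K * 2 powr (CARD('n) * t) / vol powr t) powr (1/a))"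
  have D: "2 \<le> D" by (simp add: D_def)
  have main: "emeasure ?M (ball x (2 * r)) \<le> ennreal D * emeasure ?M E"
    if E: "E \<in> sets lebesgue" "E \<subseteq> ball x (2 * r)" and r: "0 < r" and big: "ennreal (vol * r ^ CARD('n)) \<le> emeasure lebesgue E" for x r E
  proof -
    let ?c = "ennreal ((vol * r ^ CARD('n)) powr t)"
    let ?W = "ennreal_powr (\<integral>\<^sup>+y\<in>ball x (2 * r). ennreal (v y) \<partial>lebesgue) b"
    have "?c \<le> ennreal_powr (emeasure lebesgue E) t"
      using ennreal_powr_mono[OF big, of t] t vol r by simp
    also note volume[OF E(1)]
    also have "ennreal_powr (\<integral>\<^sup>+x\<in>E. ennreal (v x) \<partial>lebesgue) b \<le> ?W"
      using E ab by (intro ennreal_powr_mono nn_integral_mono) (auto simp: indicator_def)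
    finally have "?c \<le> ennreal_powr (emeasure ?M E) a * ?W" by (simp add: mult_left_mono)
    then have "?c * ennreal_powr (emeasure ?M (ball x (2 * r))) a
       \<le> ennreal_powr (emeasure ?M E) a * ?W * ennreal_powr (emeasure ?M (ball x (2 * r))) a"
      by (rule mult_right_mono) simp
    also have "\<dots> = ennreal_powr (emeasure ?M E) a * (ennreal_powr (emeasure ?M (ball x (2 * r))) a * ?W)"
      by (simp add: mult_ac)
    also have "\<dots> \<le> ennreal_powr (emeasure ?M E) a * ennreal (K * (2 * r) powr (CARD('n) * t))"
      using A[of "2 * r" x] r by (intro mult_left_mono) (auto simp: em t_def)
    finally have "ennreal (1 / (vol * r ^ CARD('n)) powr t) * (?c * ennreal_powr (emeasure ?M (ball x (2 * r))) a)
       \<le> ennreal (1 / (vol * r ^ CARD('n)) powr t) * (ennreal_powr (emeasure ?M E) a * ennreal (K * (2 * r) powr (CARD('n) * t)))"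
      by (rule mult_left_mono) simp
    also have "ennreal (1 / (vol * r ^ CARD('n)) powr t) * (?c * ennreal_powr (emeasure ?M (ball x (2 * r))) a)
        = ennreal_powr (emeasure ?M (ball x (2 * r))) a"
      using vol r by (simp add: mult.assoc[symmetric] ennreal_mult[symmetric])
    also have "ennreal (1 / (vol * r ^ CARD('n)) powr t) * (ennreal_powr (emeasure ?M E) a * ennreal (K * (2 * r) powr (CARD('n) * t)))
        = ennreal (1 / (vol * r ^ CARD('n)) powr t * (K * (2 * r) powr (CARD('n) * t))) * ennreal_powr (emeasure ?M E) a"
    proof -
      have "ennreal c * (X * ennreal d) = ennreal (c * d) * X" if "0 \<le> c" "0 \<le> d" for c d X
        using that by (simp add: ennreal_mult mult_ac)
      then show ?thesis using K by auto
    qed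
    also have "1 / (vol * r ^ CARD('n)) powr t * (K * (2 * r) powr (CARD('n) * t)) = K * 2 powr (CARD('n) * t) / vol powr t"
      using vol r by (simp add: powr_mult powr_realpow[symmetric] powr_powr)
    finally have "emeasure ?M (ball x (2 * r)) \<le> ennreal_powr (ennreal (K * 2 powr (CARD('n) * t) / vol powr t) * ennreal_powr (emeasure ?M E) a) (1/a)"
      using ab by (simp add: ennreal_powr_le_iff)
    also have "\<dots> = ennreal ((K * 2 powr (CARD('n) * t) / vol powr t) powr (1/a)) * emeasure ?M E"
      using K vol ab by (simp add: ennreal_powr_mult ennreal_powr_powr)
    also have "\<dots> \<le> ennreal D * emeasure ?M E"
      by (intro mult_right_mono ennreal_leI) (auto simp: D_def)
    finally show ?thesis .
  qed
  have sub: "ball x r \<subseteq> ball x (2 * r)" if "0 < r" for x :: "real^'n" and r :: real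
    using that by (intro subset_ball) simp
  have "growth_measure ?M D (1 - 1/D)"
  proof
    show "sets ?M = sets lebesgue" by simp
    show "emeasure ?M (ball x r) \<noteq> top" for x r by (rule fin')
    show "0 < 1 - 1/D" "1 - 1/D < 1" using D by auto
  next
    fix x :: "real^'n" and r :: real assume r: "0 < r"
    show "emeasure ?M (ball x r) \<noteq> 0"
      using nn_integral_ball_pos[OF _ ae_uv(1) r, of x] by (simp add: em)
    show "measure ?M (ball x (2 * r)) \<le> D * measure ?M (ball x r)"
    proof -
      have "emeasure ?M (ball x (2 * r)) \<le> ennreal D * emeasure ?M (ball x r)"
        using r by (intro main) (auto simp: emeasure_lborel_ball_cart vol_def)
      then show ?thesis
        using fin'[of x "2 * r"] fin'[of x r] D
        by (simp add: emeasure_eq_ennreal_measure ennreal_mult[symmetric])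
    qed
    show "measure ?M (ball x r) \<le> (1 - 1/D) * measure ?M (ball x (2 * r))"
    proof -
      \<comment> \<open>As 2^n - 1 \<ge> 1, the annulus has at least the volume of B(x, r). The
        share 1/D that it carries is missing from B(x, r).\<close>
      let ?E = "ball x (2 * r) - ball x r"
      have "emeasure lebesgue ?E = emeasure lebesgue (ball x (2 * r)) - emeasure lebesgue (ball x r)"
        using r sub by (intro emeasure_Diff) (auto simp: emeasure_lborel_ball_cart)
      also have "\<dots> = ennreal (vol * (2 * r) ^ CARD('n) - vol * r ^ CARD('n))"
        using r vol by (simp add: emeasure_lborel_ball_cart vol_def ennreal_minus)
      also have "\<dots> \<ge> ennreal (vol * r ^ CARD('n))"
      proof (rule ennreal_leI)
        have "(2::real) ^ 1 \<le> 2 ^ CARD('n)" by (rule power_increasing) auto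
        then have "2 * (vol * r ^ CARD('n)) \<le> 2 ^ CARD('n) * (vol * r ^ CARD('n))"
          using vol r by (intro mult_right_mono) auto
        then show "vol * r ^ CARD('n) \<le> vol * (2 * r) ^ CARD('n) - vol * r ^ CARD('n)"
          by (simp add: power_mult_distrib algebra_simps)
      qed
      finally have "emeasure ?M (ball x (2 * r)) \<le> ennreal D * emeasure ?M ?E"
        using r by (intro main) auto
      also have "emeasure ?M ?E = emeasure ?M (ball x (2 * r)) - emeasure ?M (ball x r)"
        using fin' sub[OF r] by (intro emeasure_Diff) auto
      finally have "measure ?M (ball x (2 * r)) \<le> D * (measure ?M (ball x (2 * r)) - measure ?M (ball x r))"
        using fin'[of x "2 * r"] fin'[of x r] D emeasure_mono[OF sub[OF r, of x], of ?M]
        by (simp add: emeasure_eq_ennreal_measure ennreal_minus ennreal_mult'[symmetric] ennreal_le_iff2)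
           (smt (verit) mult_nonneg_nonneg measure_nonneg)
      then show ?thesis using D by (simp add: field_simps)
    qed
  qed
  then show ?thesis by blast
qed

section \<open>Norms by duality\<close>

lemma borel_measurable_nn_integral_count_space:
  fixes f :: "'i::countable \<Rightarrow> 'a \<Rightarrow> ennreal"
  assumes [measurable]: "\<And>i. f i \<in> borel_measurable M"
  shows "(\<lambda>x. \<integral>\<^sup>+i. f i x \<partial>count_space UNIV) \<in> borel_measurable M"
proof -
  have "(\<integral>\<^sup>+i. f i x \<partial>count_space UNIV) = (\<Sum>n. if n \<in> range (to_nat :: 'i \<Rightarrow> nat) then f (from_nat n) x else 0)" for x
  proof -
    have "(\<integral>\<^sup>+i. f i x \<partial>count_space UNIV) = (\<integral>\<^sup>+n. f (from_nat n) x \<partial>count_space (range (to_nat :: 'i \<Rightarrow> nat)))"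
      by (subst nn_integral_bij_count_space[OF inj_on_imp_bij_betw[OF inj_to_nat], symmetric]) simp
    also have "\<dots> = (\<integral>\<^sup>+n. (if n \<in> range (to_nat :: 'i \<Rightarrow> nat) then f (from_nat n) x else 0) \<partial>count_space UNIV)"
      by (subst nn_integral_count_space_indicator) (auto intro!: nn_integral_cong)
    finally show ?thesis by (simp add: nn_integral_count_space_nat)
  qed
  then show ?thesis by simp
qed

text \<open>The extremal test function is F powr (q - 1), but dividing by the norm requires a finite
  norm. So F is cut off at height N and to \<open>A N\<close>, the cut-off function provides the
  test function, and monotone convergence removes the cut-off.\<close>

lemma nn_integral_powr_le_by_duality:
  assumes [measurable]: "F \<in> borel_measurable M" "\<And>N. A N \<in> sets M"
    and A: "incseq A" "(\<Union>N. A N) = space M" "\<And>N :: nat. emeasure M (A N) \<noteq> top"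
    and q: "1 < q"
    and dual: "\<And>h :: 'a \<Rightarrow> real. h \<in> borel_measurable M \<Longrightarrow> (\<And>x. 0 \<le> h x) \<Longrightarrow>
      (\<integral>\<^sup>+x. F x * ennreal (h x) \<partial>M) \<le> X * ennreal_powr (\<integral>\<^sup>+x. ennreal (h x powr (q / (q - 1))) \<partial>M) (1 - 1/q)"
  shows "(\<integral>\<^sup>+x. ennreal_powr (F x) q \<partial>M) \<le> ennreal_powr X q"
proof -
  define f where "f N x = (if x \<in> A N then enn2real (min (F x) (of_nat N)) else 0)" for N x
  have [measurable]: "f N \<in> borel_measurable M" for N unfolding f_def by measurable
  have f0: "0 \<le> f N x" for N x by (simp add: f_def)
  have minr: "ennreal (enn2real (min (F x) (of_nat N))) = min (F x) (of_nat N)" for N x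
    by (intro ennreal_enn2real) (simp add: min_less_iff_disj of_nat_less_top)
  have f_le: "ennreal (f N x) \<le> F x" for N x by (auto simp: f_def minr)
  have f_le_N: "f N x \<le> N * indicator (A N) x" for N x
    using enn2real_mono[of "min (F x) (of_nat N)" "of_nat N"] by (auto simp: f_def of_nat_less_top)
  have bound: "(\<integral>\<^sup>+x. ennreal (f N x powr q) \<partial>M) \<le> ennreal_powr X q" for N
  proof (cases "X = top")
    case False
    let ?Y = "\<integral>\<^sup>+x. ennreal (f N x powr q) \<partial>M"
    have "?Y \<le> (\<integral>\<^sup>+x. ennreal (N powr q) * indicator (A N) x \<partial>M)"
    proof (intro nn_integral_mono)
      fix x show "ennreal (f N x powr q) \<le> ennreal (N powr q) * indicator (A N) x"
        using powr_mono2[of q "f N x" N] f_le_N[of N x] f0[of N x] q by (auto simp: f_def intro!: ennreal_leI split: if_splits)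
    qed
    also have "\<dots> < top" using A(3)[of N] by (simp add: nn_integral_cmult_indicator ennreal_mult_less_top less_top)
    finally have "?Y \<noteq> top" by simp
    then obtain y where y: "?Y = ennreal y" "0 \<le> y" by (cases ?Y) auto
    have "?Y = (\<integral>\<^sup>+x. ennreal (f N x) * ennreal (f N x powr (q - 1)) \<partial>M)"
    proof (intro nn_integral_cong)
      fix x
      have "f N x powr q = f N x powr 1 * f N x powr (q - 1)" unfolding powr_add[symmetric] by simp
      then show "ennreal (f N x powr q) = ennreal (f N x) * ennreal (f N x powr (q - 1))"
        using f0[of N x] by (simp add: ennreal_mult)
    qed
    also have "\<dots> \<le> (\<integral>\<^sup>+x. F x * ennreal (f N x powr (q - 1)) \<partial>M)"
      by (intro nn_integral_mono mult_right_mono f_le) auto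
    also have "\<dots> \<le> X * ennreal_powr (\<integral>\<^sup>+x. ennreal ((f N x powr (q - 1)) powr (q / (q - 1))) \<partial>M) (1 - 1/q)"
      by (rule dual) auto
    also have "(\<integral>\<^sup>+x. ennreal ((f N x powr (q - 1)) powr (q / (q - 1))) \<partial>M) = ?Y"
      using q by (simp add: powr_powr)
    \<comment> \<open>The same integral y stands on both sides. It is finite, so the factor y powr
      (1 - 1/q) can be cancelled unless y = 0.\<close>
    finally have le: "ennreal y \<le> X * ennreal (y powr (1 - 1/q))" using y by simp
    show ?thesis
    proof (cases "y = 0")
      case False
      then have "0 < y" using y by simp
      have "ennreal (y powr (1/q - 1)) * ennreal y \<le> ennreal (y powr (1/q - 1)) * (X * ennreal (y powr (1 - 1/q)))"
        using le by (intro mult_left_mono) auto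
      also have "\<dots> = X * ennreal (y powr (1/q - 1) * y powr (1 - 1/q))"
        by (simp add: ennreal_mult mult_ac)
      also have "y powr (1/q - 1) * y powr (1 - 1/q) = 1"
        using \<open>0 < y\<close> unfolding powr_add[symmetric] by simp
      also have "ennreal (y powr (1/q - 1)) * ennreal y = ennreal (y powr (1/q))"
      proof -
        have "y powr (1/q - 1) * y powr 1 = y powr (1/q)" unfolding powr_add[symmetric] by simp
        then show ?thesis using \<open>0 < y\<close> by (simp add: ennreal_mult[symmetric])
      qed
      finally have "ennreal_powr (ennreal (y powr (1/q))) q \<le> ennreal_powr X q"
        using q by (intro ennreal_powr_mono) auto
      then show ?thesis using y q \<open>0 < y\<close> by (simp add: powr_powr)
    qed (use y in simp)
  qed simp
  have "incseq (\<lambda>N x. ennreal (f N x powr q))"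
  proof (intro incseq_SucI le_funI ennreal_leI powr_mono2)
    fix N x show "f N x \<le> f (Suc N) x"
    proof (cases "x \<in> A N")
      case True
      then have "x \<in> A (Suc N)" using A(1) by (auto simp: incseq_Suc_iff)
      have "ennreal (f N x) \<le> ennreal (f (Suc N) x)"
        using True \<open>x \<in> A (Suc N)\<close> by (simp only: f_def if_True minr) (intro min.mono order_refl, simp)
      then show ?thesis using f0 by simp
    qed (use f0 in \<open>simp add: f_def\<close>)
  qed (use q f0 in auto)
  then have mc: "(\<integral>\<^sup>+x. (SUP N. ennreal (f N x powr q)) \<partial>M) = (SUP N. \<integral>\<^sup>+x. ennreal (f N x powr q) \<partial>M)"
    by (intro nn_integral_monotone_convergence_SUP) auto
  have sup: "ennreal_powr (F x) q \<le> (SUP N. ennreal (f N x powr q))" if x: "x \<in> space M" for x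
  proof -
    obtain N0 where N0: "x \<in> A N0" using A(2) x by auto
    have xA: "x \<in> A N" if "N0 \<le> N" for N using N0 A(1) that by (auto simp: incseq_def)
    have eq: "ennreal (f N x powr q) = ennreal_powr (min (F x) (of_nat N)) q" if "N0 \<le> N" for N
      using xA[OF that] minr[of x N] ennreal_powr_ennreal[OF f0, of N x q] by (simp add: f_def)
    show ?thesis
    proof (cases "F x")
      case (real r)
      obtain N where N: "r \<le> real N" using real_arch_simple by blast
      define N1 where "N1 = max N N0"
      have "min (F x) (of_nat N1) = F x"
        using real N by (intro min_absorb1) (auto simp: N1_def ennreal_of_nat_eq_real_of_nat intro!: ennreal_leI)
      then have "ennreal_powr (F x) q = ennreal (f N1 x powr q)" by (subst eq) (auto simp: N1_def)
      then show ?thesis by (metis SUP_upper UNIV_I)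
    next
      \<comment> \<open>Where F is infinite the cut-off function equals N as soon as x is in
        \<open>A N\<close>, and N powr q exceeds every real.\<close>
      case top
      have "ennreal r \<le> (SUP N. ennreal (f N x powr q))" if "0 \<le> r" for r
      proof -
        obtain N where N: "r powr (1/q) \<le> real N" using real_arch_simple by blast
        define N1 where "N1 = max N N0"
        have "ennreal r = ennreal ((r powr (1/q)) powr q)" using that q by (simp add: powr_powr)
        also have "\<dots> \<le> ennreal (real N1 powr q)"
          using N q by (intro ennreal_leI powr_mono2) (auto simp: N1_def)
        also have "\<dots> = ennreal_powr (min (F x) (of_nat N1)) q"
          using top ennreal_powr_ennreal[of "real N1" q] by (simp add: ennreal_of_nat_eq_real_of_nat)
        also have "\<dots> = ennreal (f N1 x powr q)" by (subst eq) (auto simp: N1_def)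
        also have "\<dots> \<le> (SUP N. ennreal (f N x powr q))" by (rule SUP_upper) simp
        finally show ?thesis .
      qed
      from this[of "enn2real (SUP N. ennreal (f N x powr q)) + 1"]
      have "(SUP N. ennreal (f N x powr q)) = top"
        by (cases "SUP N. ennreal (f N x powr q)") auto
      then show ?thesis by (metis top_greatest)
    qed
  qed
  have "(\<integral>\<^sup>+x. ennreal_powr (F x) q \<partial>M) \<le> (\<integral>\<^sup>+x. (SUP N. ennreal (f N x powr q)) \<partial>M)"
    by (intro nn_integral_mono sup)
  also have "\<dots> \<le> ennreal_powr X q" unfolding mc by (intro SUP_least bound)
  finally show ?thesis .
qed

subsection \<open>The weighted strong type bound\<close>

text \<open>Models u = w^Q and v = w powr (-P/(P - 1)) with w in A(P,Q); the volumes in the averages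
  are absorbed into K and the power of r. In this form the conditions on the weights are invariant
  under exchanging (u, 1/Q) with (v, 1 - 1/P), so \<open>growth_measure_density\<close> applies to
  both measures.\<close>

locale weight_pair =
  fixes u v :: "real^'n \<Rightarrow> real" and P Q K :: real
  assumes u [measurable]: "u \<in> borel_measurable lebesgue" and v [measurable]: "v \<in> borel_measurable lebesgue"
    and nonneg: "\<And>x. 0 \<le> u x" "\<And>x. 0 \<le> v x"
    and PQ: "1 < P" "P < Q" and K: "0 < K"
    and ae: "AE x in lebesgue. 0 < u x \<and> 0 < v x \<and> u x powr (1/Q) * v x powr (1 - 1/P) = 1"
    and finite_u: "\<And>x r. (\<integral>\<^sup>+y\<in>ball x r. ennreal (u y) \<partial>lebesgue) \<noteq> top"
    and finite_v: "\<And>x r. (\<integral>\<^sup>+y\<in>ball x r. ennreal (v y) \<partial>lebesgue) \<noteq> top"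
    and A_condition: "\<And>x r. 0 < r \<Longrightarrow> ennreal_powr (\<integral>\<^sup>+y\<in>ball x r. ennreal (u y) \<partial>lebesgue) (1/Q)
       * ennreal_powr (\<integral>\<^sup>+y\<in>ball x r. ennreal (v y) \<partial>lebesgue) (1 - 1/P)
       \<le> ennreal (K * r powr (CARD('n) * (1/Q + (1 - 1/P))))"
begin

definition "Mu = density lebesgue (\<lambda>x. ennreal (u x))"
definition "Mv = density lebesgue (\<lambda>x. ennreal (v x))"

text \<open>The homogeneity \<open>\<nu> = n - \<alpha>\<close> of the fractional integral with \<open>1/Q = 1/P - \<alpha>/n\<close>.\<close>

definition "\<nu> = CARD('n) * (1/Q + (1 - 1/P))"

lemma sets_Mu [measurable_cong]: "sets Mu = sets lebesgue" and sets_Mv [measurable_cong]: "sets Mv = sets lebesgue"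
  by (simp_all add: Mu_def Mv_def)

lemma space_Mu: "space Mu = UNIV"
  by (simp add: Mu_def)

lemma exponents_pos: "0 < 1/Q" "0 < 1 - 1/P"
  using PQ by (auto simp: field_simps)

lemma growth_u: "\<exists>D \<theta>. growth_measure Mu D \<theta>"
  unfolding Mu_def by (rule growth_measure_density[OF u v exponents_pos K ae finite_u A_condition])

lemma growth_v: "\<exists>D \<theta>. growth_measure Mv D \<theta>"
  unfolding Mv_def
proof (rule growth_measure_density[OF v u exponents_pos(2,1) K _ finite_v])
  show "AE x in lebesgue. 0 < v x \<and> 0 < u x \<and> v x powr (1 - 1/P) * u x powr (1/Q) = 1"
    using ae by (auto simp: mult.commute elim!: eventually_mono)
qed (use A_condition in \<open>simp add: mult.commute add.commute\<close>)

lemma A_condition_measure: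
  assumes "0 < r"
  shows "measure Mu (ball x r) powr (1/Q) * measure Mv (ball x r) powr (1 - 1/P) \<le> K * r powr \<nu>"
proof -
  have *: "(\<integral>\<^sup>+y\<in>ball x r. ennreal (u y) \<partial>lebesgue) = ennreal (measure Mu (ball x r))"
    "(\<integral>\<^sup>+y\<in>ball x r. ennreal (v y) \<partial>lebesgue) = ennreal (measure Mv (ball x r))"
    using finite_u[of x r] finite_v[of x r]
    by (simp_all add: Mu_def Mv_def measure_def emeasure_density less_top)
  show ?thesis
    using A_condition[OF assms, of x] K unfolding * \<nu>_def by (simp add: ennreal_mult[symmetric])
qed

text \<open>Dividing by v moves a Lebesgue integral to the dual measure \<open>Mv\<close>; the
  embedding of averages is then applied to g/v.\<close>

lemma nn_integral_divide_v:
  fixes g :: "real^'n \<Rightarrow> real"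
  assumes [measurable]: "g \<in> borel_measurable lebesgue" "E \<in> sets lebesgue" and g0: "\<And>x. 0 \<le> g x"
  shows "(\<integral>\<^sup>+y\<in>E. ennreal (g y / v y) \<partial>Mv) = (\<integral>\<^sup>+y\<in>E. ennreal (g y) \<partial>lebesgue)"
proof -
  have aev: "AE x in lebesgue. 0 < v x" using ae by auto
  have "(\<integral>\<^sup>+y\<in>E. ennreal (g y / v y) \<partial>Mv) = (\<integral>\<^sup>+y. ennreal (v y) * (ennreal (g y / v y) * indicator E y) \<partial>lebesgue)"
    unfolding Mv_def by (rule nn_integral_density) auto
  also have "\<dots> = (\<integral>\<^sup>+y\<in>E. ennreal (g y) \<partial>lebesgue)"
    using aev by (intro nn_integral_cong_AE)
      (auto simp: g0 mult.assoc[symmetric] ennreal_mult[symmetric] elim!: eventually_mono)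
  finally show ?thesis .
qed

text \<open>In the model case v powr (1 - P) = w^P, so this is the P-norm of g with weight w^P,
  expressed through g/v in \<open>Mv\<close>.\<close>

lemma nn_integral_divide_v_powr:
  fixes g :: "real^'n \<Rightarrow> real"
  assumes [measurable]: "g \<in> borel_measurable lebesgue" "E \<in> sets lebesgue" and g0: "\<And>x. 0 \<le> g x"
  shows "(\<integral>\<^sup>+x\<in>E. ennreal ((g x / v x) powr P) \<partial>Mv) = (\<integral>\<^sup>+x\<in>E. ennreal (g x powr P * v x powr (1 - P)) \<partial>lebesgue)"
proof -
  have aev: "AE x in lebesgue. 0 < v x" using ae by auto
  have "(\<integral>\<^sup>+x\<in>E. ennreal ((g x / v x) powr P) \<partial>Mv) = (\<integral>\<^sup>+x. ennreal (v x) * (ennreal ((g x / v x) powr P) * indicator E x) \<partial>lebesgue)"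
    unfolding Mv_def by (rule nn_integral_density) auto
  also have "\<dots> = (\<integral>\<^sup>+x\<in>E. ennreal (g x powr P * v x powr (1 - P)) \<partial>lebesgue)"
    using aev
  proof (intro nn_integral_cong_AE, eventually_elim)
    case (elim x)
    have "v x powr 1 * (g x powr P / v x powr P) = g x powr P * v x powr (1 - P)"
      by (simp only: powr_diff) simp
    then show ?case using elim by (simp add: powr_divide mult.assoc[symmetric] ennreal_mult[symmetric])
  qed
  finally show ?thesis .
qed

text \<open>The outer exponent is Q * s because powers 1/s of averages are summed. With lattice
  balls in place of centred balls the operator is a sum of indicators with constant coefficients
  c_i, so that pairing it with h yields the sum of c_i times the integral of h over the i-th
  ball.\<close>

lemma strong_type:
  assumes s: "1 < s"
  shows "\<exists>C>0. \<forall>g :: real^'n \<Rightarrow> real. g \<in> borel_measurable lebesgue \<longrightarrow> (\<forall>x. 0 \<le> g x) \<longrightarrow>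
    (\<integral>\<^sup>+x. ennreal_powr (\<integral>\<^sup>+i. indicator (lattice_ball i) x *
        ennreal_powr (ennreal (2 powr (- real_of_int (fst i) * \<nu>)) * (\<integral>\<^sup>+y\<in>lattice_ball i. ennreal (g y) \<partial>lebesgue)) (1/s)
        \<partial>count_space UNIV) (Q * s) \<partial>Mu)
     \<le> ennreal C * ennreal_powr (\<integral>\<^sup>+x. ennreal (g x powr P * v x powr (1 - P)) \<partial>lebesgue) (Q/P)"
proof -
  obtain Du \<theta>u where "growth_measure Mu Du \<theta>u" using growth_u by blast
  then interpret U: growth_measure Mu Du \<theta>u .
  obtain Dv \<theta>v where "growth_measure Mv Dv \<theta>v" using growth_v by blast
  then interpret V: growth_measure Mv Dv \<theta>v .
  define p q where "p = P * s" and "q = Q * s"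
  \<comment> \<open>Any exponent strictly between p and q would do: r1 > p gives P < r1/s for the
    embedding in \<open>Mv\<close>, and r1 < q gives q' < r2 for the one in
    \<open>Mu\<close>.\<close>
  define r1 where "r1 = (p + q) / 2"
  define r2 where "r2 = r1 / (r1 - 1)"
  define q' where "q' = q / (q - 1)"
  have "P < Q" "1 < P" by (rule PQ)+
  have "P < p" using PQ s by (simp add: p_def)
  have "p < q" using PQ s by (simp add: p_def q_def)
  have r1: "1 < r1" "p < r1" "r1 < q" using \<open>p < q\<close> \<open>P < p\<close> PQ by (auto simp: r1_def)
  have r2: "1 < r2" "1/r1 + 1/r2 = 1" using r1 by (auto simp: r2_def field_simps)
  have q': "1 < q'" "q' < r2" "1/q' = 1 - 1/q" using r1 by (auto simp: q'_def r2_def field_simps)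
  have PP: "P < r1 / s" using r1 s by (simp add: p_def field_simps)
  let ?L = "lattice_ball :: int \<times> ('n \<Rightarrow> int) \<Rightarrow> (real^'n) set"
  have Lb: "\<exists>x r. ?L i = ball x r \<and> 0 < r" for i
  proof (cases i)
    case (Pair j k)
    show ?thesis unfolding Pair lattice_ball_def prod.case
      by (intro exI conjI refl mult_pos_pos) auto
  qed
  have L [measurable]: "?L i \<in> sets lebesgue" for i using Lb[of i] by auto
  define a b where "a i = measure Mu (?L i)" and "b i = measure Mv (?L i)" for i
  have a: "emeasure Mu (?L i) = ennreal (a i)" "0 < a i" for i
    using Lb[of i] by (auto simp: a_def U.emeasure_ball_eq U.measure_ball_pos)
  have b: "emeasure Mv (?L i) = ennreal (b i)" "0 < b i" for i
    using Lb[of i] by (auto simp: b_def V.emeasure_ball_eq V.measure_ball_pos)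
  define K' where "K' = K * real (CARD('n) + 1) powr \<nu>"
  have K': "0 < K'" using K unfolding K'_def by (intro mult_pos_pos) (auto simp: add_eq_0_iff)
  \<comment> \<open>The A(P,Q) condition for the ball of radius (n + 1) 2^j, solved for the
    fractional factor, which thereby splits into one power of each measure.\<close>
  have AK: "2 powr (- real_of_int (fst i) * \<nu>) \<le> K' * (a i powr (- (1/Q)) * b i powr (- (1 - 1/P)))" for i
  proof (cases i)
    case (Pair j k)
    have "a i powr (1/Q) * b i powr (1 - 1/P) \<le> K * (real (CARD('n) + 1) * 2 powr j) powr \<nu>"
      unfolding a_def b_def Pair lattice_ball_def prod.case by (intro A_condition_measure mult_pos_pos) auto
    also have "\<dots> = K' * 2 powr (j * \<nu>)" by (simp add: K'_def powr_mult powr_powr)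
    finally have "a i powr (1/Q) * b i powr (1 - 1/P) \<le> K' * 2 powr (j * \<nu>)" .
    moreover have "0 < a i powr (1/Q) * b i powr (1 - 1/P)" using a(2)[of i] b(2)[of i] by simp
    ultimately have "1 / 2 powr (j * \<nu>) \<le> K' / (a i powr (1/Q) * b i powr (1 - 1/P))"
      by (simp add: field_simps)
    then show ?thesis
      unfolding Pair fst_conv mult_minus_left powr_minus by (simp add: divide_inverse)
  qed
  have "scale_sparse ?L b" using V.scale_sparse_lattice_ball by (simp add: b_def[abs_def])
  then have "\<exists>C>0. \<forall>G :: real^'n \<Rightarrow> real. G \<in> borel_measurable Mv \<longrightarrow> (\<forall>x. 0 \<le> G x) \<longrightarrow>
    (\<integral>\<^sup>+i. ennreal (b i powr ((r1/s)/P - (r1/s))) * ennreal_powr (\<integral>\<^sup>+x\<in>?L i. ennreal (G x) \<partial>Mv) (r1/s) \<partial>count_space UNIV)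
      \<le> ennreal C * ennreal_powr (\<integral>\<^sup>+x. ennreal (G x powr P) \<partial>Mv) ((r1/s)/P)"
    by (intro sum_averages_le b \<open>1 < P\<close> PP) auto
  then obtain C1 where "0 < C1" and C1: "\<forall>G :: real^'n \<Rightarrow> real. G \<in> borel_measurable Mv \<longrightarrow> (\<forall>x. 0 \<le> G x) \<longrightarrow>
    (\<integral>\<^sup>+i. ennreal (b i powr ((r1/s)/P - (r1/s))) * ennreal_powr (\<integral>\<^sup>+x\<in>?L i. ennreal (G x) \<partial>Mv) (r1/s) \<partial>count_space UNIV)
      \<le> ennreal C1 * ennreal_powr (\<integral>\<^sup>+x. ennreal (G x powr P) \<partial>Mv) ((r1/s)/P)"
    by blast
  have "scale_sparse ?L a" using U.scale_sparse_lattice_ball by (simp add: a_def[abs_def])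
  then have "\<exists>C>0. \<forall>G :: real^'n \<Rightarrow> real. G \<in> borel_measurable Mu \<longrightarrow> (\<forall>x. 0 \<le> G x) \<longrightarrow>
    (\<integral>\<^sup>+i. ennreal (a i powr (r2/q' - r2)) * ennreal_powr (\<integral>\<^sup>+x\<in>?L i. ennreal (G x) \<partial>Mu) r2 \<partial>count_space UNIV)
      \<le> ennreal C * ennreal_powr (\<integral>\<^sup>+x. ennreal (G x powr q') \<partial>Mu) (r2/q')"
    by (intro sum_averages_le a q') auto
  then obtain C2 where "0 < C2" and C2: "\<forall>G :: real^'n \<Rightarrow> real. G \<in> borel_measurable Mu \<longrightarrow> (\<forall>x. 0 \<le> G x) \<longrightarrow>
    (\<integral>\<^sup>+i. ennreal (a i powr (r2/q' - r2)) * ennreal_powr (\<integral>\<^sup>+x\<in>?L i. ennreal (G x) \<partial>Mu) r2 \<partial>count_space UNIV)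
      \<le> ennreal C2 * ennreal_powr (\<integral>\<^sup>+x. ennreal (G x powr q') \<partial>Mu) (r2/q')"
    by blast
  define C where "C = K' powr (1/s) * C1 powr (1/r1) * C2 powr (1/r2)"
  have C: "0 < C" using K' \<open>0 < C1\<close> \<open>0 < C2\<close> by (simp add: C_def)
  show ?thesis
  proof (intro exI[of _ "C powr q"] conjI allI impI)
    show "0 < C powr q" using C by simp
    fix g :: "real^'n \<Rightarrow> real" assume g [measurable]: "g \<in> borel_measurable lebesgue" and "\<forall>x. 0 \<le> g x"
    then have g0: "0 \<le> g x" for x by simp
    define G where "G x = g x / v x" for x
    have [measurable]: "G \<in> borel_measurable lebesgue" unfolding G_def by measurable
    have G0: "0 \<le> G x" for x using g0 nonneg by (simp add: G_def)
    have intG: "(\<integral>\<^sup>+y\<in>?L i. ennreal (g y) \<partial>lebesgue) = (\<integral>\<^sup>+y\<in>?L i. ennreal (G y) \<partial>Mv)" for i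
      unfolding G_def by (rule nn_integral_divide_v[symmetric]) (auto simp: g0)
    let ?Z = "\<integral>\<^sup>+x. ennreal (g x powr P * v x powr (1 - P)) \<partial>lebesgue"
    have Z: "(\<integral>\<^sup>+x. ennreal (G x powr P) \<partial>Mv) = ?Z"
      using nn_integral_divide_v_powr[OF g _ g0, of UNIV] by (simp add: G_def)
    define c where "c i = ennreal_powr (ennreal (2 powr (- real_of_int (fst i) * \<nu>)) * (\<integral>\<^sup>+y\<in>?L i. ennreal (g y) \<partial>lebesgue)) (1/s)" for i :: "int \<times> ('n \<Rightarrow> int)"
    define F where "F x = (\<integral>\<^sup>+i. indicator (?L i) x * c i \<partial>count_space UNIV)" for x
    have F [measurable]: "F \<in> borel_measurable lebesgue"
      unfolding F_def by (rule borel_measurable_nn_integral_count_space) auto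
    have key: "(\<integral>\<^sup>+x. F x * ennreal (h x) \<partial>Mu) \<le> (ennreal C * ennreal_powr ?Z (1/p)) *
        ennreal_powr (\<integral>\<^sup>+x. ennreal (h x powr (q / (q - 1))) \<partial>Mu) (1 - 1/q)"
      if h [measurable]: "h \<in> borel_measurable Mu" and h0: "\<And>x. 0 \<le> h x" for h :: "real^'n \<Rightarrow> real"
    proof -
      let ?I = "\<lambda>i. \<integral>\<^sup>+x\<in>?L i. ennreal (G x) \<partial>Mv" and ?J = "\<lambda>i. \<integral>\<^sup>+x\<in>?L i. ennreal (h x) \<partial>Mu"
      let ?H = "\<integral>\<^sup>+x. ennreal (h x powr (q / (q - 1))) \<partial>Mu"
      have "(\<integral>\<^sup>+x. F x * ennreal (h x) \<partial>Mu) = (\<integral>\<^sup>+x. \<integral>\<^sup>+i. c i * (ennreal (h x) * indicator (?L i) x) \<partial>count_space UNIV \<partial>Mu)"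
        unfolding F_def by (subst nn_integral_multc[symmetric]) (auto intro!: nn_integral_cong simp: mult_ac)
      also have "\<dots> = (\<integral>\<^sup>+i. \<integral>\<^sup>+x. c i * (ennreal (h x) * indicator (?L i) x) \<partial>Mu \<partial>count_space UNIV)"
        by (rule nn_integral_count_space_nn_integral) auto
      also have "\<dots> = (\<integral>\<^sup>+i. c i * ?J i \<partial>count_space UNIV)"
        by (intro nn_integral_cong nn_integral_cmult) auto
      also have "\<dots> \<le> (\<integral>\<^sup>+i. ennreal (K' powr (1/s)) * ((ennreal (b i powr (- (1 - 1/P) / s)) * ennreal_powr (?I i) (1/s)) *
          (ennreal (a i powr (- (1/q))) * ?J i)) \<partial>count_space UNIV)"
      proof (intro nn_integral_mono)
        fix i :: "int \<times> ('n \<Rightarrow> int)"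
        have "c i \<le> ennreal_powr (ennreal (K' * (a i powr (- (1/Q)) * b i powr (- (1 - 1/P)))) * ?I i) (1/s)"
          unfolding c_def intG using s AK[of i] by (intro ennreal_powr_mono mult_right_mono ennreal_leI) auto
        also have "\<dots> = ennreal ((K' * (a i powr (- (1/Q)) * b i powr (- (1 - 1/P)))) powr (1/s)) * ennreal_powr (?I i) (1/s)"
          unfolding ennreal_powr_mult using K' by (subst ennreal_powr_ennreal) auto
        also have "(K' * (a i powr (- (1/Q)) * b i powr (- (1 - 1/P)))) powr (1/s) = K' powr (1/s) * (a i powr (- (1/q)) * b i powr (- (1 - 1/P) / s))"
          by (simp add: powr_mult powr_powr q_def)
        finally have "c i * ?J i \<le> ennreal (K' powr (1/s) * (a i powr (- (1/q)) * b i powr (- (1 - 1/P) / s))) * ennreal_powr (?I i) (1/s) * ?J i"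
          by (rule mult_right_mono) simp
        then show "c i * ?J i \<le> ennreal (K' powr (1/s)) * ((ennreal (b i powr (- (1 - 1/P) / s)) * ennreal_powr (?I i) (1/s)) * (ennreal (a i powr (- (1/q))) * ?J i))"
          by (simp only: ennreal_mult powr_ge_zero mult_nonneg_nonneg mult_ac)
      qed
      also have "\<dots> = ennreal (K' powr (1/s)) * (\<integral>\<^sup>+i. (ennreal (b i powr (- (1 - 1/P) / s)) * ennreal_powr (?I i) (1/s)) *
          (ennreal (a i powr (- (1/q))) * ?J i) \<partial>count_space UNIV)"
        by (rule nn_integral_cmult) simp
      also have "\<dots> \<le> ennreal (K' powr (1/s)) *
          (ennreal_powr (\<integral>\<^sup>+i. ennreal_powr (ennreal (b i powr (- (1 - 1/P) / s)) * ennreal_powr (?I i) (1/s)) r1 \<partial>count_space UNIV) (1/r1)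
           * ennreal_powr (\<integral>\<^sup>+i. ennreal_powr (ennreal (a i powr (- (1/q))) * ?J i) r2 \<partial>count_space UNIV) (1/r2))"
        by (intro mult_left_mono nn_integral_Holder r1 r2) auto
      also have "(\<integral>\<^sup>+i. ennreal_powr (ennreal (b i powr (- (1 - 1/P) / s)) * ennreal_powr (?I i) (1/s)) r1 \<partial>count_space UNIV)
          = (\<integral>\<^sup>+i. ennreal (b i powr ((r1/s)/P - r1/s)) * ennreal_powr (?I i) (r1/s) \<partial>count_space UNIV)"
      proof (intro nn_integral_cong)
        fix i
        \<comment> \<open>With P1 = r1/s this is the exponent P1/P - P1 that the embedding
          requires.\<close>
        have "- (1 - 1/P) / s * r1 = (r1/s)/P - r1/s" using PQ s by (simp add: field_simps)
        then show "ennreal_powr (ennreal (b i powr (- (1 - 1/P) / s)) * ennreal_powr (?I i) (1/s)) r1 = ennreal (b i powr ((r1/s)/P - r1/s)) * ennreal_powr (?I i) (r1/s)"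
          by (simp add: ennreal_powr_mult ennreal_powr_powr powr_powr)
      qed
      also have "(\<integral>\<^sup>+i. ennreal_powr (ennreal (a i powr (- (1/q))) * ?J i) r2 \<partial>count_space UNIV)
          = (\<integral>\<^sup>+i. ennreal (a i powr (r2/q' - r2)) * ennreal_powr (?J i) r2 \<partial>count_space UNIV)"
      proof (intro nn_integral_cong)
        fix i
        have "r2 / q' = r2 * (1 - 1/q)" using q'(3) by (metis times_divide_eq_right mult.right_neutral)
        then have "- (1/q) * r2 = r2/q' - r2" by (simp add: algebra_simps)
        then show "ennreal_powr (ennreal (a i powr (- (1/q))) * ?J i) r2 = ennreal (a i powr (r2/q' - r2)) * ennreal_powr (?J i) r2"
          by (simp add: ennreal_powr_mult ennreal_powr_powr powr_powr)
      qed
      also have "ennreal_powr (\<integral>\<^sup>+i. ennreal (b i powr ((r1/s)/P - r1/s)) * ennreal_powr (?I i) (r1/s) \<partial>count_space UNIV) (1/r1)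
          \<le> ennreal_powr (ennreal C1 * ennreal_powr (\<integral>\<^sup>+x. ennreal (G x powr P) \<partial>Mv) ((r1/s)/P)) (1/r1)"
        using r1 G0 by (intro ennreal_powr_mono C1[rule_format]) auto
      also have "\<dots> = ennreal (C1 powr (1/r1)) * ennreal_powr ?Z (1/p)"
        using \<open>0 < C1\<close> r1 unfolding Z by (simp add: ennreal_powr_mult ennreal_powr_powr p_def mult.commute)
      also have "ennreal_powr (\<integral>\<^sup>+i. ennreal (a i powr (r2/q' - r2)) * ennreal_powr (?J i) r2 \<partial>count_space UNIV) (1/r2)
          \<le> ennreal_powr (ennreal C2 * ennreal_powr (\<integral>\<^sup>+x. ennreal (h x powr q') \<partial>Mu) (r2/q')) (1/r2)"
        using r2 h0 by (intro ennreal_powr_mono C2[rule_format]) auto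
      also have "\<dots> = ennreal (C2 powr (1/r2)) * ennreal_powr ?H (1 - 1/q)"
        using \<open>0 < C2\<close> r2 q'(3) by (simp add: ennreal_powr_mult ennreal_powr_powr q'_def)
      also have "ennreal (K' powr (1/s)) * (ennreal (C1 powr (1/r1)) * ennreal_powr ?Z (1/p) * (ennreal (C2 powr (1/r2)) * ennreal_powr ?H (1 - 1/q)))
          = (ennreal C * ennreal_powr ?Z (1/p)) * ennreal_powr ?H (1 - 1/q)"
        unfolding C_def by (simp add: ennreal_mult mult_ac)
      finally show ?thesis by (simp add: mult_left_mono mult_right_mono)
    qed
    have "(\<integral>\<^sup>+x. ennreal_powr (F x) q \<partial>Mu) \<le> ennreal_powr (ennreal C * ennreal_powr ?Z (1/p)) q"
    proof (rule nn_integral_powr_le_by_duality[where A="\<lambda>N. ball 0 (real N)"])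
      show "(\<Union>N. ball (0::real^'n) (real N)) = space Mu"
        by (auto simp: space_Mu reals_Archimedean2)
      show "incseq (\<lambda>N. ball (0::real^'n) (real N))" by (auto simp: incseq_def)
      show "emeasure Mu (ball 0 (real N)) \<noteq> top" for N by (rule U.finite_ball)
      show "1 < q" using r1 by simp
    qed (use key in auto)
    also have "\<dots> = ennreal (C powr q) * ennreal_powr ?Z (Q/P)"
      using C s by (simp add: ennreal_powr_mult ennreal_powr_powr p_def q_def)
    finally show "(\<integral>\<^sup>+x. ennreal_powr (\<integral>\<^sup>+i. indicator (lattice_ball i) x *
        ennreal_powr (ennreal (2 powr (- real_of_int (fst i) * \<nu>)) * (\<integral>\<^sup>+y\<in>lattice_ball i. ennreal (g y) \<partial>lebesgue)) (1/s)
        \<partial>count_space UNIV) (Q * s) \<partial>Mu) \<le> ennreal (C powr q) * ennreal_powr ?Z (Q/P)"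
      unfolding F_def c_def q_def .
  qed
qed

end

subsection \<open>The Morrey bound for dyadic sums\<close>

context weight_pair
begin

text \<open>Used with s equal to the conjugate exponent \<open>s'\<close> and g = |f| powr
  \<open>s'\<close>. The balls are centred at x itself, unlike in \<open>strong_type\<close>;
  measurability in x is not established, and later uses get by with monotonicity and
  scaling.\<close>

definition dyadic_sum :: "real \<Rightarrow> (real^'n \<Rightarrow> real) \<Rightarrow> real^'n \<Rightarrow> ennreal" where
  "dyadic_sum s g x = (\<integral>\<^sup>+j. ennreal_powr (ennreal (2 powr (- real_of_int j * \<nu>))
     * (\<integral>\<^sup>+y\<in>ball x (2 powr real_of_int j). ennreal (g y) \<partial>lebesgue)) (1/s) \<partial>count_space UNIV)"

text \<open>The Morrey condition on a ball \<open>B\<close> with measure \<open>U\<close> controls the fractional average over \<open>B\<close> by a power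
  \<open>U\<^bsup>\<kappa>/P - 1/Q\<^esup>\<close>, which decays geometrically along dilates of \<open>B\<close> since \<open>\<kappa> < P/Q\<close>.\<close>

lemma fractional_average_le:
  fixes g :: "real^'n \<Rightarrow> real"
  assumes g [measurable]: "g \<in> borel_measurable lebesgue" and g0: "\<And>x. 0 \<le> g x" and N: "0 \<le> N" and r: "0 < r"
    and morrey: "(\<integral>\<^sup>+y\<in>ball x r. ennreal (g y powr P * v y powr (1 - P)) \<partial>lebesgue) \<le> ennreal (N * measure Mu (ball x r) powr \<kappa>)"
  shows "ennreal (r powr (- \<nu>)) * (\<integral>\<^sup>+y\<in>ball x r. ennreal (g y) \<partial>lebesgue)
    \<le> ennreal (K * N powr (1/P) * measure Mu (ball x r) powr (\<kappa>/P - 1/Q))"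
proof -
  obtain Du \<theta>u where "growth_measure Mu Du \<theta>u" using growth_u by blast
  then interpret U: growth_measure Mu Du \<theta>u .
  obtain Dv \<theta>v where "growth_measure Mv Dv \<theta>v" using growth_v by blast
  then interpret V: growth_measure Mv Dv \<theta>v .
  let ?U = "measure Mu (ball x r)" and ?V = "measure Mv (ball x r)"
  have pos: "0 < ?U" "0 < ?V" using r by (auto intro: U.measure_ball_pos V.measure_ball_pos)
  have [measurable]: "ball x r \<in> sets lebesgue" by simp
  have "ennreal_powr (\<integral>\<^sup>+y\<in>ball x r. ennreal (g y / v y) \<partial>Mv) P
    \<le> ennreal (?V powr (P - 1)) * (\<integral>\<^sup>+y\<in>ball x r. ennreal_powr (ennreal (g y / v y)) P \<partial>Mv)"
    using PQ pos by (intro nn_integral_powr_le) (auto simp: V.emeasure_ball_eq)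
  also have "(\<integral>\<^sup>+y\<in>ball x r. ennreal_powr (ennreal (g y / v y)) P \<partial>Mv) = (\<integral>\<^sup>+y\<in>ball x r. ennreal ((g y / v y) powr P) \<partial>Mv)"
    by (simp add: g0 nonneg)
  also have "\<dots> \<le> ennreal (N * ?U powr \<kappa>)"
    using morrey by (simp add: nn_integral_divide_v_powr g0)
  finally have "ennreal_powr (\<integral>\<^sup>+y\<in>ball x r. ennreal (g y) \<partial>lebesgue) P \<le> ennreal (?V powr (P - 1)) * ennreal (N * ?U powr \<kappa>)"
    by (simp add: nn_integral_divide_v g0 mult_left_mono)
  then have "(\<integral>\<^sup>+y\<in>ball x r. ennreal (g y) \<partial>lebesgue) \<le> ennreal_powr (ennreal (?V powr (P - 1)) * ennreal (N * ?U powr \<kappa>)) (1/P)"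
    using PQ by (simp add: ennreal_powr_le_iff)
  also have "\<dots> = ennreal (?V powr (1 - 1/P) * (N powr (1/P) * ?U powr (\<kappa>/P)))"
    using PQ N by (simp add: ennreal_mult[symmetric] powr_mult powr_powr diff_divide_distrib)
  finally have 1: "ennreal (r powr (- \<nu>)) * (\<integral>\<^sup>+y\<in>ball x r. ennreal (g y) \<partial>lebesgue)
     \<le> ennreal (r powr (- \<nu>)) * ennreal (?V powr (1 - 1/P) * (N powr (1/P) * ?U powr (\<kappa>/P)))"
    by (rule mult_left_mono) simp
  \<comment> \<open>Writing the power of U as U^(1/Q) times U^(\<kappa>/P - 1/Q) exposes the product
    that the A(P,Q) condition bounds; the powers of r cancel.\<close>
  have "r powr (- \<nu>) * (?V powr (1 - 1/P) * (N powr (1/P) * ?U powr (\<kappa>/P)))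
     = (r powr (- \<nu>) * (?U powr (1/Q) * ?V powr (1 - 1/P))) * (N powr (1/P) * ?U powr (\<kappa>/P - 1/Q))"
    using pos by (simp add: powr_diff)
  also have "\<dots> \<le> (r powr (- \<nu>) * (K * r powr \<nu>)) * (N powr (1/P) * ?U powr (\<kappa>/P - 1/Q))"
    by (intro mult_right_mono mult_left_mono A_condition_measure r) auto
  also have "r powr (- \<nu>) * (K * r powr \<nu>) = K" using r by (simp add: powr_minus)
  finally show ?thesis
    using 1 by (simp add: ennreal_mult[symmetric] N mult.assoc) (meson ennreal_leI order_trans)
qed

text \<open>Both parts of the sum end with the same power of the measure U of the ball. The tail
  over large scales is bounded by a constant of size U^(-\<delta>), whose q-th power integrates to
  U^(1 - \<delta> q), and 1 - \<delta> q = \<kappa> Q/P. The local part reaches that power because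
  the dilated ball has measure at most a constant times U.\<close>

lemma dyadic_sum_morrey:
  assumes s: "1 < s" and \<kappa>: "0 < \<kappa>" "\<kappa> < P/Q"
  shows "\<exists>C>0. \<forall>g :: real^'n \<Rightarrow> real. \<forall>N\<ge>0. g \<in> borel_measurable lebesgue \<longrightarrow> (\<forall>x. 0 \<le> g x) \<longrightarrow>
    (\<forall>x. \<forall>r>0. (\<integral>\<^sup>+y\<in>ball x r. ennreal (g y powr P * v y powr (1 - P)) \<partial>lebesgue) \<le> ennreal (N * measure Mu (ball x r) powr \<kappa>)) \<longrightarrow>
    (\<forall>x. \<forall>r>0. (\<integral>\<^sup>+y\<in>ball x r. ennreal_powr (dyadic_sum s g y) (Q * s) \<partial>Mu)
       \<le> ennreal (C * N powr (Q/P) * measure Mu (ball x r) powr (\<kappa> * Q/P)))"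
proof -
  obtain Du \<theta>u where "growth_measure Mu Du \<theta>u" using growth_u by blast
  then interpret U: growth_measure Mu Du \<theta>u .
  \<comment> \<open>\<delta> is the rate at which the large-scale terms decay as powers of the
    measure; \<kappa> < P/Q makes it positive.\<close>
  define q \<delta> where "q = Q * s" and "\<delta> = (1/Q - \<kappa>/P) / s"
  have q: "1 < q" using s PQ by (simp add: q_def less_1_mult)
  have \<delta>: "0 < \<delta>" using s \<kappa> PQ by (simp add: \<delta>_def field_simps)
  have \<delta>q: "1 - \<delta> * q = \<kappa> * Q/P" using s PQ by (simp add: \<delta>_def q_def field_simps)
  have th: "\<theta>u powr \<delta> < 1" using powr_less_mono2[of \<delta> \<theta>u 1] U.\<theta> \<delta> by simp
  define F where "F g x = (\<integral>\<^sup>+i. indicator (lattice_ball i) x *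
        ennreal_powr (ennreal (2 powr (- real_of_int (fst i) * \<nu>)) * (\<integral>\<^sup>+y\<in>lattice_ball i. ennreal (g y) \<partial>lebesgue)) (1/s)
        \<partial>count_space UNIV)" for g and x :: "real^'n"
  obtain C1 where C1: "0 < C1" and strong: "\<forall>g :: real^'n \<Rightarrow> real. g \<in> borel_measurable lebesgue \<longrightarrow> (\<forall>x. 0 \<le> g x) \<longrightarrow>
    (\<integral>\<^sup>+x. ennreal_powr (F g x) q \<partial>Mu)
     \<le> ennreal C1 * ennreal_powr (\<integral>\<^sup>+x. ennreal (g x powr P * v x powr (1 - P)) \<partial>lebesgue) (Q/P)"
    using strong_type[OF s] unfolding F_def q_def by blast
  define c where "c = (2 powr \<nu> * K) powr (1/s) / (1 - \<theta>u powr \<delta>)"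
  have c: "0 < c" using K th by (simp add: c_def)
  define C where "C = 2 powr q * (C1 * ((Du ^ 2) powr \<kappa>) powr (Q/P) + c powr q)"
  show ?thesis
  proof (intro exI[of _ C] conjI allI impI)
    show "0 < C" using C1 c U.D_ge_1 by (simp add: C_def add_pos_pos)
    fix g :: "real^'n \<Rightarrow> real" and N r :: real and x0 :: "real^'n"
    assume N: "0 \<le> N" and g [measurable]: "g \<in> borel_measurable lebesgue" and "\<forall>x. 0 \<le> g x" and r: "0 < r"
      and morrey: "\<forall>x. \<forall>r>0. (\<integral>\<^sup>+y\<in>ball x r. ennreal (g y powr P * v y powr (1 - P)) \<partial>lebesgue) \<le> ennreal (N * measure Mu (ball x r) powr \<kappa>)"
    then have g0: "0 \<le> g x" for x by simp
    \<comment> \<open>r \<le> 2^J < 2r, so B(x0, 2^(J+1)) is covered by two doublings of B(x0, r);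
      hence the factor Du^2.\<close>
    define J where "J = \<lceil>log 2 r\<rceil>"
    have J1: "r \<le> 2 powr J"
    proof -
      have "r = 2 powr (log 2 r)" using r by simp
      also have "\<dots> \<le> 2 powr J" unfolding J_def by (rule powr_mono) auto
      finally show ?thesis .
    qed
    have J2: "2 powr real_of_int (J + 1) \<le> 2 ^ 2 * r"
    proof -
      have "real_of_int J \<le> log 2 r + 1" unfolding J_def by linarith
      then have "2 powr real_of_int (J + 1) \<le> 2 powr (log 2 r + 2)" by (intro powr_mono) auto
      also have "\<dots> = 2 ^ 2 * r" using r by (simp add: powr_add)
      finally show ?thesis .
    qed
    define U where "U = measure Mu (ball x0 r)"
    have U: "0 < U" using r by (simp add: U_def U.measure_ball_pos)
    define B where "B j = ball x0 (2 powr real_of_int (j + 1))" for j :: int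
    have [measurable]: "B j \<in> sets lebesgue" "ball x r \<in> sets lebesgue" for j x r by (auto simp: B_def)
    define g1 where "g1 x = g x * indicator (B J) x" for x
    have g1 [measurable]: "g1 \<in> borel_measurable lebesgue" unfolding g1_def by measurable
    have g10: "0 \<le> g1 x" for x by (simp add: g1_def g0)
    define T where "T = ennreal (c * N powr (1/(P * s)) * U powr (- \<delta>))"
    have dom: "dyadic_sum s g x \<le> F g1 x + T" if x: "x \<in> ball x0 r" for x
    proof -
      let ?t = "\<lambda>j. ennreal_powr (ennreal (2 powr (- real_of_int j * \<nu>))
          * (\<integral>\<^sup>+y\<in>ball x (2 powr real_of_int j). ennreal (g y) \<partial>lebesgue)) (1/s)"
      let ?f = "\<lambda>j k. indicator (lattice_ball (j, k)) x *
        ennreal_powr (ennreal (2 powr (- real_of_int j * \<nu>)) * (\<integral>\<^sup>+y\<in>lattice_ball (j, k). ennreal (g1 y) \<partial>lebesgue)) (1/s)"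
      let ?G = "\<lambda>j. ennreal ((2 powr \<nu> * K) powr (1/s) * N powr (1/(P * s))) *
         (indicator {j. U \<le> measure Mu (B j)} j * ennreal (measure Mu (B j) powr (- \<delta>)))"
      \<comment> \<open>Moving the centre from x to x0 doubles the radius at scales above J, which
        costs the factor 2 powr \<nu> in \<open>c\<close>; at scales up to J everything lies in the
        fixed ball \<open>B J\<close>.\<close>
      have sub: "ball x (2 powr real_of_int j) \<subseteq> ball x0 (2 powr real_of_int (max J j + 1))" for j
      proof
        fix y assume y: "y \<in> ball x (2 powr real_of_int j)"
        have "dist x0 y \<le> dist x0 x + dist x y" by (rule dist_triangle)
        also have "\<dots> < 2 powr J + 2 powr j" using x y J1 by auto
        also have "\<dots> \<le> 2 powr real_of_int (max J j) + 2 powr real_of_int (max J j)"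
          by (intro add_mono powr_mono) auto
        finally show "y \<in> ball x0 (2 powr real_of_int (max J j + 1))" by (simp add: powr_add)
      qed
      \<comment> \<open>One lattice ball contains the centred ball and in particular x, so a single
        term of the lattice sum dominates.\<close>
      have small: "?t j \<le> (\<integral>\<^sup>+k. ?f j k \<partial>count_space UNIV)" if "j \<le> J" for j
      proof -
        obtain k where k: "ball x (2 powr real_of_int j) \<subseteq> lattice_ball (j, k)"
          using ball_subset_lattice_ball by blast
        have "x \<in> lattice_ball (j, k)" using k by auto
        have "(\<integral>\<^sup>+y\<in>ball x (2 powr real_of_int j). ennreal (g y) \<partial>lebesgue) \<le> (\<integral>\<^sup>+y\<in>lattice_ball (j, k). ennreal (g1 y) \<partial>lebesgue)"
          using sub[of j] k that by (intro nn_integral_mono) (auto simp: indicator_def g1_def B_def max_def)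
        then have "?t j \<le> ?f j k"
          using \<open>x \<in> lattice_ball (j, k)\<close> s by (auto intro!: ennreal_powr_mono mult_left_mono)
        also have "\<dots> \<le> (\<integral>\<^sup>+k. ?f j k \<partial>count_space UNIV)" by (rule nn_integral_ge_point) simp
        finally show ?thesis .
      qed
      have large: "?t j \<le> ?G j" if "J < j" for j
      proof -
        have mono: "U \<le> measure Mu (B j)"
          unfolding U_def B_def
        proof (rule U.measure_ball_mono, rule subset_ball)
          have "(2::real) powr J \<le> 2 powr real_of_int (j + 1)" using that by (intro powr_mono) auto
          with J1 show "r \<le> 2 powr real_of_int (j + 1)" by linarith
        qed
        have "ball x (2 powr real_of_int j) \<subseteq> B j" using sub[of j] that by (simp add: B_def max_def)
        then have "(\<integral>\<^sup>+y\<in>ball x (2 powr real_of_int j). ennreal (g y) \<partial>lebesgue) \<le> (\<integral>\<^sup>+y\<in>B j. ennreal (g y) \<partial>lebesgue)"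
          by (intro nn_integral_mono) (auto simp: indicator_def)
        then have "ennreal (2 powr (- real_of_int j * \<nu>)) * (\<integral>\<^sup>+y\<in>ball x (2 powr real_of_int j). ennreal (g y) \<partial>lebesgue)
           \<le> ennreal (2 powr \<nu> * (2 powr real_of_int (j + 1)) powr (- \<nu>)) * (\<integral>\<^sup>+y\<in>B j. ennreal (g y) \<partial>lebesgue)"
          unfolding powr_powr powr_add[symmetric] by (intro mult_mono) (auto simp: algebra_simps)
        also have "\<dots> = ennreal (2 powr \<nu>) * (ennreal ((2 powr real_of_int (j + 1)) powr (- \<nu>)) * (\<integral>\<^sup>+y\<in>B j. ennreal (g y) \<partial>lebesgue))"
          by (simp add: ennreal_mult mult.assoc)
        also have "\<dots> \<le> ennreal (2 powr \<nu>) * ennreal (K * N powr (1/P) * measure Mu (B j) powr (\<kappa>/P - 1/Q))"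
          unfolding B_def by (intro mult_left_mono fractional_average_le g g0 N morrey[rule_format]) auto
        also have "\<dots> = ennreal ((2 powr \<nu> * K) * N powr (1/P) * measure Mu (B j) powr (\<kappa>/P - 1/Q))"
          using K by (simp add: ennreal_mult[symmetric] mult.assoc)
        finally have "?t j \<le> ennreal_powr (ennreal ((2 powr \<nu> * K) * N powr (1/P) * measure Mu (B j) powr (\<kappa>/P - 1/Q))) (1/s)"
          using s by (intro ennreal_powr_mono) auto
        also have "\<dots> = ennreal ((2 powr \<nu> * K) powr (1/s) * N powr (1/(P * s)) * measure Mu (B j) powr (- \<delta>))"
          using K by (simp add: powr_mult powr_powr \<delta>_def diff_divide_distrib)
        finally show ?thesis using mono by (simp add: ennreal_mult)
      qed
      have G: "(\<integral>\<^sup>+j. ?G j \<partial>count_space UNIV) \<le> T"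
      proof -
        have "(\<integral>\<^sup>+j. ?G j \<partial>count_space UNIV) = ennreal ((2 powr \<nu> * K) powr (1/s) * N powr (1/(P * s))) *
          (\<integral>\<^sup>+j. indicator {j. U \<le> measure Mu (B j)} j * ennreal (measure Mu (B j) powr (- \<delta>)) \<partial>count_space UNIV)"
          by (rule nn_integral_cmult) simp
        also have "\<dots> \<le> ennreal ((2 powr \<nu> * K) powr (1/s) * N powr (1/(P * s))) * ennreal (U powr (- \<delta>) / (1 - \<theta>u powr \<delta>))"
          unfolding B_def by (intro mult_left_mono geometric_sum_above U.dyadic_growth U.\<theta> \<delta> U U.measure_ball_pos) auto
        also have "\<dots> = T" using K th by (simp add: T_def c_def ennreal_mult[symmetric])
        finally show ?thesis .
      qed
      have "dyadic_sum s g x \<le> (\<integral>\<^sup>+j. (\<integral>\<^sup>+k. ?f j k \<partial>count_space UNIV) + ?G j \<partial>count_space UNIV)"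
        unfolding dyadic_sum_def
      proof (intro nn_integral_mono)
        fix j show "?t j \<le> (\<integral>\<^sup>+k. ?f j k \<partial>count_space UNIV) + ?G j"
        proof (cases "j \<le> J")
          case True
          from small[OF this] show ?thesis by (rule add_increasing2[rotated]) simp
        next
          case False
          then have "?t j \<le> ?G j" by (intro large) simp
          then show ?thesis by (rule add_increasing[rotated]) simp
        qed
      qed
      also have "\<dots> = (\<integral>\<^sup>+j. (\<integral>\<^sup>+k. ?f j k \<partial>count_space UNIV) \<partial>count_space UNIV) + (\<integral>\<^sup>+j. ?G j \<partial>count_space UNIV)"
        by (rule nn_integral_add) auto
      also have "(\<integral>\<^sup>+j. (\<integral>\<^sup>+k. ?f j k \<partial>count_space UNIV) \<partial>count_space UNIV) = F g1 x"
        unfolding F_def by (subst nn_integral_fst_count_space[symmetric]) simp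
      finally show ?thesis using G by (meson add_left_mono order_trans)
    qed
    have int_g1: "(\<integral>\<^sup>+x. ennreal_powr (F g1 x) q \<partial>Mu) \<le> ennreal (C1 * ((Du ^ 2) powr \<kappa>) powr (Q/P) * N powr (Q/P) * U powr (\<kappa> * Q/P))"
    proof -
      have "(\<integral>\<^sup>+x. ennreal (g1 x powr P * v x powr (1 - P)) \<partial>lebesgue) = (\<integral>\<^sup>+y\<in>B J. ennreal (g y powr P * v y powr (1 - P)) \<partial>lebesgue)"
        using PQ by (intro nn_integral_cong) (auto simp: g1_def indicator_def)
      also have "\<dots> \<le> ennreal (N * measure Mu (B J) powr \<kappa>)"
        unfolding B_def by (rule morrey[rule_format]) simp
      also have "\<dots> \<le> ennreal (N * (Du ^ 2 * U) powr \<kappa>)"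
      proof (intro ennreal_leI mult_left_mono powr_mono2 N)
        have "measure Mu (B J) \<le> measure Mu (ball x0 (2 ^ 2 * r))"
          unfolding B_def by (rule U.measure_ball_mono) (rule subset_ball[OF J2])
        also have "\<dots> \<le> Du ^ 2 * U" unfolding U_def by (rule U.doubling_iterate[OF r])
        finally show "measure Mu (B J) \<le> Du ^ 2 * U" .
      qed (use \<kappa> in auto)
      finally have Z: "(\<integral>\<^sup>+x. ennreal (g1 x powr P * v x powr (1 - P)) \<partial>lebesgue) \<le> ennreal (N * (Du ^ 2 * U) powr \<kappa>)" .
      have "(\<integral>\<^sup>+x. ennreal_powr (F g1 x) q \<partial>Mu) \<le> ennreal C1 * ennreal_powr (\<integral>\<^sup>+x. ennreal (g1 x powr P * v x powr (1 - P)) \<partial>lebesgue) (Q/P)"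
        using strong g10 by auto
      also have "\<dots> \<le> ennreal C1 * ennreal_powr (ennreal (N * (Du ^ 2 * U) powr \<kappa>)) (Q/P)"
        using PQ by (intro mult_left_mono ennreal_powr_mono Z) auto
      also have "\<dots> = ennreal (C1 * ((Du ^ 2) powr \<kappa>) powr (Q/P) * N powr (Q/P) * U powr (\<kappa> * Q/P))"
        using C1 N by (simp add: ennreal_mult[symmetric] powr_mult powr_powr mult_ac)
      finally show ?thesis .
    qed
    have Tq: "ennreal_powr T q * emeasure Mu (ball x0 r) = ennreal (c powr q * N powr (Q/P) * U powr (\<kappa> * Q/P))"
    proof -
      have "ennreal_powr T q * emeasure Mu (ball x0 r) = ennreal (c powr q * N powr (Q/P) * (U powr (- \<delta> * q) * U powr 1))"
        using U c s unfolding T_def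
        by (simp add: U.emeasure_ball_eq U_def[symmetric] powr_mult powr_powr ennreal_mult[symmetric] q_def mult_ac)
      also have "U powr (- \<delta> * q) * U powr 1 = U powr (\<kappa> * Q/P)"
        unfolding powr_add[symmetric] \<delta>q[symmetric] by simp
      finally show ?thesis .
    qed
    have "(\<integral>\<^sup>+y\<in>ball x0 r. ennreal_powr (dyadic_sum s g y) (Q * s) \<partial>Mu)
       \<le> (\<integral>\<^sup>+y. ennreal (2 powr q) * (ennreal_powr (F g1 y) q + ennreal_powr T q * indicator (ball x0 r) y) \<partial>Mu)"
    proof (intro nn_integral_mono)
      fix y
      show "ennreal_powr (dyadic_sum s g y) (Q * s) * indicator (ball x0 r) y
        \<le> ennreal (2 powr q) * (ennreal_powr (F g1 y) q + ennreal_powr T q * indicator (ball x0 r) y)"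
      proof (cases "y \<in> ball x0 r")
        case True
        have "ennreal_powr (dyadic_sum s g y) q \<le> ennreal_powr (F g1 y + T) q"
          using q by (intro ennreal_powr_mono dom True) auto
        also have "\<dots> \<le> ennreal (2 powr q) * (ennreal_powr (F g1 y) q + ennreal_powr T q)"
          using q by (intro ennreal_powr_plus_le) auto
        finally show ?thesis using True by (simp add: q_def)
      qed simp
    qed
    also have "\<dots> = ennreal (2 powr q) * ((\<integral>\<^sup>+y. ennreal_powr (F g1 y) q \<partial>Mu) + ennreal_powr T q * emeasure Mu (ball x0 r))"
    proof -
      have [measurable]: "F g1 \<in> borel_measurable Mu"
        unfolding F_def by (rule borel_measurable_nn_integral_count_space) (auto simp: lattice_ball_def split: prod.splits)
      show ?thesis by (simp add: nn_integral_cmult nn_integral_add nn_integral_cmult_indicator)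
    qed
    also have "\<dots> \<le> ennreal (2 powr q) * (ennreal (C1 * ((Du ^ 2) powr \<kappa>) powr (Q/P) * N powr (Q/P) * U powr (\<kappa> * Q/P))
        + ennreal (c powr q * N powr (Q/P) * U powr (\<kappa> * Q/P)))"
      unfolding Tq by (intro mult_left_mono add_mono int_g1) auto
    also have "\<dots> = ennreal (C * N powr (Q/P) * U powr (\<kappa> * Q/P))"
      using C1 by (simp add: C_def ennreal_plus[symmetric] ennreal_mult[symmetric] algebra_simps del: ennreal_plus)
    finally show "(\<integral>\<^sup>+y\<in>ball x0 r. ennreal_powr (dyadic_sum s g y) (Q * s) \<partial>Mu)
       \<le> ennreal (C * N powr (Q/P) * measure Mu (ball x0 r) powr (\<kappa> * Q/P))" unfolding U_def .
  qed
qed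

end

subsection \<open>Rough kernels\<close>

lemma nn_integral_lborel_affine:
  fixes f :: "real^'n \<Rightarrow> ennreal" and t :: "real^'n"
  assumes [measurable]: "f \<in> borel_measurable borel" and c: "c \<noteq> 0"
  shows "(\<integral>\<^sup>+x. f x \<partial>lborel) = ennreal (\<bar>c\<bar> ^ CARD('n)) * (\<integral>\<^sup>+x. f (t + c *\<^sub>R x) \<partial>lborel)"
proof -
  have "(\<integral>\<^sup>+x. f x \<partial>lborel) = (\<integral>\<^sup>+x. f x \<partial>density (distr lborel borel (\<lambda>x. t + c *\<^sub>R x)) (\<lambda>_. \<bar>c\<bar> ^ CARD('n)))"
    by (subst lborel_affine[OF c, of t]) simp
  also have "\<dots> = (\<integral>\<^sup>+x. ennreal (\<bar>c\<bar> ^ CARD('n)) * f (t + c *\<^sub>R x) \<partial>lborel)"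
    by (subst nn_integral_density) (auto simp: nn_integral_distr)
  also have "\<dots> = ennreal (\<bar>c\<bar> ^ CARD('n)) * (\<integral>\<^sup>+x. f (t + c *\<^sub>R x) \<partial>lborel)"
    by (rule nn_integral_cmult) simp
  finally show ?thesis .
qed

lemma nn_integral_lborel_reflect:
  fixes f :: "real^'n \<Rightarrow> ennreal"
  assumes "f \<in> borel_measurable borel"
  shows "(\<integral>\<^sup>+y. f (x - y) \<partial>lborel) = (\<integral>\<^sup>+z. f z \<partial>lborel)"
  using nn_integral_lborel_affine[OF assms, of "-1" x] by simp

lemma AE_lborel_reflect:
  fixes x :: "real^'n"
  assumes "AE z in lborel. P z"
  shows "AE y in lborel. P (x - y)"
proof -
  obtain N where N: "{z. \<not> P z} \<subseteq> N" "N \<in> sets borel" "emeasure lborel N = 0"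
    using assms by (auto elim!: AE_E)
  have "(\<integral>\<^sup>+y. indicator N (x - y) \<partial>lborel) = 0"
    using nn_integral_lborel_reflect[of "indicator N" x] N by simp
  then have "AE y in lborel. indicator N (x - y) = (0::ennreal)"
    using N(2) by (subst (asm) nn_integral_0_iff_AE) auto
  then show ?thesis by (rule eventually_mono) (use N(1) in \<open>auto simp: indicator_def split: if_splits\<close>)
qed

lemma completion_ex_borel_measurable_complex:
  fixes g :: "'a \<Rightarrow> complex"
  assumes [measurable]: "g \<in> borel_measurable (completion M)"
  shows "\<exists>g'\<in>borel_measurable M. AE x in M. g x = g' x"
proof -
  obtain a where a: "a \<in> borel_measurable M" "AE x in M. Re (g x) = a x"
    using completion_ex_borel_measurable_real[of "\<lambda>x. Re (g x)" M] by auto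
  obtain b where b: "b \<in> borel_measurable M" "AE x in M. Im (g x) = b x"
    using completion_ex_borel_measurable_real[of "\<lambda>x. Im (g x)" M] by auto
  show ?thesis
  proof (intro bexI[of _ "\<lambda>x. Complex (a x) (b x)"])
    show "AE x in M. g x = Complex (a x) (b x)"
      using a(2) b(2) by eventually_elim (simp add: complex_eq_iff)
    have "(\<lambda>x. Complex (a x) (b x)) = (\<lambda>x. of_real (a x) + \<i> * of_real (b x))"
      by (simp add: fun_eq_iff Complex_eq)
    then show "(\<lambda>x. Complex (a x) (b x)) \<in> borel_measurable M" using a b by simp
  qed
qed

text \<open>\<Omega> is only measurable for the completed surface measure, which is too weak for
  joint measurability of \<Omega>(x - y). A Borel version on the sphere is extended radially. The
  two functions differ only on the cone over a null set of the sphere, apart from the origin; such a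
  cone is null because \<open>sphere_measure\<close> is defined through volumes of cones. For the
  same reason the L^s norm on the sphere becomes an integral over the unit ball.\<close>

lemma borel_homogeneous_version:
  fixes \<Omega> :: "real^'n \<Rightarrow> complex"
  assumes \<Omega>: "\<Omega> \<in> sphere_Lp s" and hom: "homogeneous_zero \<Omega>"
  shows "\<exists>\<Omega>'. \<Omega>' \<in> borel_measurable borel \<and> homogeneous_zero \<Omega>' \<and> (AE z in lborel. \<Omega> z = \<Omega>' z) \<and>
    (\<integral>\<^sup>+z\<in>ball 0 1. ennreal (cmod (\<Omega>' z) powr s) \<partial>lborel) < top"
proof -
  let ?R = "restrict_space (lborel :: (real^'n) measure) (ball 0 1 - {0})"
  let ?S = "restrict_space (borel :: (real^'n) measure) (sphere 0 1)"
  define N where "N = scale_measure (of_nat CARD('n)) (distr ?R ?S sgn)"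
  have sph: "sphere_measure = completion N" by (simp add: sphere_measure_def N_def)
  have sgn_borel [measurable]: "(sgn :: real^'n \<Rightarrow> real^'n) \<in> borel_measurable borel"
    unfolding sgn_div_norm by measurable
  have sgn [measurable]: "sgn \<in> measurable ?R ?S"
    by (intro measurable_restrict_space3) (auto simp: norm_sgn)
  have sets_N [measurable_cong]: "sets N = sets ?S" by (simp add: N_def)
  have em_N: "emeasure N E = of_nat CARD('n) * emeasure lborel {z \<in> ball 0 1 - {0}. sgn z \<in> E}"
    if E: "E \<in> sets ?S" for E
  proof -
    have "emeasure N E = of_nat CARD('n) * emeasure ?R (sgn -` E \<inter> space ?R)"
      using E by (simp add: N_def emeasure_scale_measure emeasure_distr)
    also have "sgn -` E \<inter> space ?R = {z \<in> ball 0 1 - {0}. sgn z \<in> E}"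
      by (auto simp: space_restrict_space)
    also have "emeasure ?R {z \<in> ball 0 1 - {0}. sgn z \<in> E} = emeasure lborel {z \<in> ball 0 1 - {0}. sgn z \<in> E}"
      by (rule emeasure_restrict_space) auto
    finally show ?thesis .
  qed
  obtain \<Omega>0 where \<Omega>0 [measurable]: "\<Omega>0 \<in> borel_measurable N" and ae: "AE x in N. \<Omega> x = \<Omega>0 x"
    using completion_ex_borel_measurable_complex[of \<Omega> N] \<Omega> by (auto simp: sphere_Lp_def sph)
  \<comment> \<open>Zero off the sphere; as sgn 0 = 0, this also fixes the value of the extension at
    the origin.\<close>
  define \<Omega>1 where "\<Omega>1 x = indicator (sphere 0 1) x *\<^sub>R \<Omega>0 x" for x
  have "\<Omega>0 \<in> borel_measurable ?S" using \<Omega>0 by (simp cong: measurable_cong_sets add: sets_N)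
  then have [measurable]: "\<Omega>1 \<in> borel_measurable borel"
    unfolding \<Omega>1_def by (subst (asm) borel_measurable_restrict_space_iff) auto
  define \<Omega>' where "\<Omega>' z = \<Omega>1 (sgn z)" for z
  have \<Omega>' [measurable]: "\<Omega>' \<in> borel_measurable borel" unfolding \<Omega>'_def by measurable
  have hom': "homogeneous_zero \<Omega>'"
    by (auto simp: homogeneous_zero_def \<Omega>'_def sgn_scaleR)
  have \<Omega>'_eq: "\<Omega>' z = \<Omega>0 (sgn z)" if "z \<noteq> 0" for z
    using that by (simp add: \<Omega>'_def \<Omega>1_def norm_sgn)
  have \<Omega>_eq: "\<Omega> z = \<Omega> (sgn z)" if "z \<noteq> 0" for z
    using hom that unfolding homogeneous_zero_def sgn_div_norm
    by (metis inverse_positive_iff_positive zero_less_norm_iff)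
  obtain E where E: "{x \<in> space N. \<Omega> x \<noteq> \<Omega>0 x} \<subseteq> E" "E \<in> sets N" "emeasure N E = 0"
    using ae by (auto elim!: AE_E)
  have spN: "space N = sphere 0 1" by (simp add: N_def space_scale_measure space_restrict_space)
  have E_borel [measurable]: "E \<in> sets borel"
    using E(2) by (auto simp: sets_N sets_restrict_space)
  \<comment> \<open>Dilates of the part in the unit ball of the cone over E; they exhaust the cone,
    and dilation keeps them null.\<close>
  define A where "A k = {z \<in> ball 0 (real (Suc k)) - {0}. sgn z \<in> E}" for k
  have [measurable]: "A k \<in> sets borel" for k unfolding A_def by measurable
  have null: "emeasure lborel (A k) = 0" for k
  proof -
    have "(\<integral>\<^sup>+z. indicator (A k) z \<partial>lborel) = ennreal (\<bar>real (Suc k)\<bar> ^ CARD('n)) * (\<integral>\<^sup>+z. indicator (A k) (0 + real (Suc k) *\<^sub>R z) \<partial>lborel)"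
      by (rule nn_integral_lborel_affine) auto
    also have "(\<integral>\<^sup>+z. indicator (A k) (0 + real (Suc k) *\<^sub>R z) \<partial>lborel) = (\<integral>\<^sup>+z. indicator {z \<in> ball 0 1 - {0}. sgn z \<in> E} z \<partial>lborel)"
      by (intro nn_integral_cong) (auto simp: A_def indicator_def sgn_scaleR simp del: of_nat_Suc)
    also have "\<dots> = emeasure lborel {z \<in> ball 0 1 - {0}. sgn z \<in> E}" by simp
    also have "\<dots> = 0" using em_N[of E] E by (simp add: sets_N)
    finally show ?thesis by simp
  qed
  have "AE z in lborel. z \<notin> A k" for k
    by (rule AE_not_in) (auto simp: null_sets_def null)
  then have "AE z in lborel. \<forall>k. z \<notin> A k" by (simp add: AE_all_countable)
  moreover have "AE z in lborel. z \<noteq> (0 :: real^'n)" by (rule AE_lborel_singleton)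
  ultimately have ae': "AE z in lborel. \<Omega> z = \<Omega>' z"
  proof eventually_elim
    case (elim z)
    obtain k where "norm z < real k" using reals_Archimedean2 by blast
    then have "z \<notin> A k" "norm z < real (Suc k)" using elim by auto
    then have "sgn z \<notin> E" using elim by (auto simp: A_def)
    moreover have "sgn z \<in> space N" using elim by (simp add: spN norm_sgn)
    ultimately have "\<Omega> (sgn z) = \<Omega>0 (sgn z)" using E(1) by blast
    then show ?case using elim \<Omega>_eq[of z] \<Omega>'_eq[of z] by simp
  qed
  have "(\<integral>\<^sup>+x. ennreal (cmod (\<Omega>0 x) powr s) \<partial>N) = (\<integral>\<^sup>+x. ennreal (cmod (\<Omega>0 x) powr s) \<partial>completion N)"
    by (rule nn_integral_completion[symmetric])
  also have "\<dots> = (\<integral>\<^sup>+x. ennreal (cmod (\<Omega> x) powr s) \<partial>completion N)"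
    using AE_completion[OF ae] by (intro nn_integral_cong_AE) auto
  also have "\<dots> < top" using \<Omega> by (simp add: sphere_Lp_def sph)
  finally have fin: "(\<integral>\<^sup>+x. ennreal (cmod (\<Omega>0 x) powr s) \<partial>N) < top" .
  have "(\<integral>\<^sup>+x. ennreal (cmod (\<Omega>0 x) powr s) \<partial>N) = of_nat CARD('n) * (\<integral>\<^sup>+x. ennreal (cmod (\<Omega>0 x) powr s) \<partial>distr ?R ?S sgn)"
    unfolding N_def by (rule nn_integral_scale_measure) (use \<open>\<Omega>0 \<in> borel_measurable ?S\<close> in measurable)
  also have "(\<integral>\<^sup>+x. ennreal (cmod (\<Omega>0 x) powr s) \<partial>distr ?R ?S sgn) = (\<integral>\<^sup>+z. ennreal (cmod (\<Omega>0 (sgn z)) powr s) \<partial>?R)"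
    by (rule nn_integral_distr[OF sgn]) (use \<open>\<Omega>0 \<in> borel_measurable ?S\<close> in measurable)
  also have "\<dots> = (\<integral>\<^sup>+z\<in>ball 0 1 - {0}. ennreal (cmod (\<Omega>0 (sgn z)) powr s) \<partial>lborel)"
    by (rule nn_integral_restrict_space) auto
  also have "\<dots> = (\<integral>\<^sup>+z\<in>ball 0 1. ennreal (cmod (\<Omega>' z) powr s) \<partial>lborel)"
    using AE_lborel_singleton[of "0 :: real^'n"]
  proof (intro nn_integral_cong_AE, eventually_elim)
    case (elim z)
    then show ?case by (simp add: indicator_def \<Omega>'_eq)
  qed
  finally have "(\<integral>\<^sup>+z\<in>ball 0 1. ennreal (cmod (\<Omega>' z) powr s) \<partial>lborel) < top"
    using fin by (auto simp: ennreal_mult_less_top)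
  with hom' ae' \<Omega>' show ?thesis by blast
qed

text \<open>Reflection of y to x - y, then dilation by R. Homogeneity makes the integrand invariant
  except at the origin, a null set.\<close>

lemma homogeneous_zero_powr_integral_ball:
  fixes \<Omega> :: "real^'n \<Rightarrow> complex"
  assumes [measurable]: "\<Omega> \<in> borel_measurable borel" and hom: "homogeneous_zero \<Omega>" and R: "0 < R"
  shows "(\<integral>\<^sup>+y\<in>ball x R. ennreal (cmod (\<Omega> (x - y)) powr s) \<partial>lborel)
    = ennreal (R ^ CARD('n)) * (\<integral>\<^sup>+z\<in>ball 0 1. ennreal (cmod (\<Omega> z) powr s) \<partial>lborel)"
proof -
  have [measurable]: "ball (0 :: real^'n) R \<in> sets borel" by simp
  have "(\<integral>\<^sup>+y\<in>ball x R. ennreal (cmod (\<Omega> (x - y)) powr s) \<partial>lborel)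
     = (\<integral>\<^sup>+y. ennreal (cmod (\<Omega> (x - y)) powr s) * indicator (ball 0 R) (x - y) \<partial>lborel)"
    by (intro nn_integral_cong) (auto simp: indicator_def dist_norm norm_minus_commute)
  also have "\<dots> = (\<integral>\<^sup>+z. ennreal (cmod (\<Omega> z) powr s) * indicator (ball 0 R) z \<partial>lborel)"
    by (rule nn_integral_lborel_reflect[of "\<lambda>z. ennreal (cmod (\<Omega> z) powr s) * indicator (ball 0 R) z"]) measurable
  also have "\<dots> = ennreal (\<bar>R\<bar> ^ CARD('n)) * (\<integral>\<^sup>+z. ennreal (cmod (\<Omega> (0 + R *\<^sub>R z)) powr s) * indicator (ball 0 R) (0 + R *\<^sub>R z) \<partial>lborel)"
    by (rule nn_integral_lborel_affine) (use R in auto)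
  also have "(\<integral>\<^sup>+z. ennreal (cmod (\<Omega> (0 + R *\<^sub>R z)) powr s) * indicator (ball 0 R) (0 + R *\<^sub>R z) \<partial>lborel)
     = (\<integral>\<^sup>+z\<in>ball 0 1. ennreal (cmod (\<Omega> z) powr s) \<partial>lborel)"
    using AE_lborel_singleton[of "0 :: real^'n"]
  proof (intro nn_integral_cong_AE, eventually_elim)
    case (elim z)
    then show ?case using R hom by (auto simp: homogeneous_zero_def indicator_def)
  qed
  finally show ?thesis using R by simp
qed

definition rough_integral :: "real \<Rightarrow> (real^'n \<Rightarrow> complex) \<Rightarrow> (real^'n \<Rightarrow> complex) \<Rightarrow> real^'n \<Rightarrow> ennreal" where
  "rough_integral \<beta> \<Omega> f x = (\<integral>\<^sup>+y. ennreal (cmod (\<Omega> (x - y)) * norm (x - y) powr (\<beta> - CARD('n)) * cmod (f y)) \<partial>lebesgue)"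

text \<open>On the annulus of outer radius 2^j the power of |x - y| is at most 2^((j-1)(\<beta>-n)),
  and \<Omega> has L^s norm of order 2^(jn/s) on the ball. The exponents add up to -j(n - \<beta>
  s')/s' + (n - \<beta>): the first part gives the weights of the sum, the second the factor 2 powr
  (n - \<beta>) in C.\<close>

lemma rough_integral_le_dyadic_sum:
  fixes \<Omega> :: "real^'n \<Rightarrow> complex" and s s' \<beta> :: real
  assumes \<Omega> [measurable]: "\<Omega> \<in> borel_measurable borel" and hom: "homogeneous_zero \<Omega>"
    and fin: "(\<integral>\<^sup>+z\<in>ball 0 1. ennreal (cmod (\<Omega> z) powr s) \<partial>lborel) < top"
    and s: "1 < s" "1 < s'" "1 / s + 1 / s' = 1" and \<beta>: "\<beta> < CARD('n)"
  shows "\<exists>C>0. \<forall>f x. f \<in> borel_measurable lebesgue \<longrightarrow> rough_integral \<beta> \<Omega> f x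
    \<le> ennreal C * (\<integral>\<^sup>+j. ennreal_powr (ennreal (2 powr (- real_of_int j * (CARD('n) - \<beta> * s')))
     * (\<integral>\<^sup>+y\<in>ball x (2 powr real_of_int j). ennreal (cmod (f y) powr s') \<partial>lebesgue)) (1/s') \<partial>count_space UNIV)"
proof -
  let ?n = "real CARD('n)"
  obtain W where W: "(\<integral>\<^sup>+z\<in>ball 0 1. ennreal (cmod (\<Omega> z) powr s) \<partial>lborel) = ennreal W" "0 \<le> W"
    using fin by (cases "\<integral>\<^sup>+z\<in>ball 0 1. ennreal (cmod (\<Omega> z) powr s) \<partial>lborel") auto
  \<comment> \<open>Adding 1 keeps C positive when W = 0.\<close>
  define C where "C = 2 powr (?n - \<beta>) * (W powr (1/s) + 1)"
  show ?thesis
  proof (intro exI[of _ C] conjI allI impI)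
    show "0 < C" by (simp add: C_def add_nonneg_pos)
    fix f :: "real^'n \<Rightarrow> complex" and x assume f [measurable]: "f \<in> borel_measurable lebesgue"
    let ?a = "\<lambda>y. cmod (\<Omega> (x - y)) * norm (x - y) powr (\<beta> - ?n) * cmod (f y)"
    let ?A = "\<lambda>j. {y. 2 powr (real_of_int j - 1) \<le> norm (x - y) \<and> norm (x - y) < 2 powr real_of_int j}"
    have \<Omega>_leb [measurable]: "(\<lambda>y. \<Omega> (x - y)) \<in> borel_measurable lebesgue"
      by (intro measurable_completion) measurable
    have [measurable]: "ball x r \<in> sets lebesgue" for r by simp
    have [measurable]: "(\<lambda>y. norm (x - y)) \<in> borel_measurable lebesgue"
      by (intro measurable_completion) measurable
    have [measurable]: "?A j \<in> sets lebesgue" for j by (intro sets_completionI_sets) measurable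
    have "rough_integral \<beta> \<Omega> f x \<le> (\<integral>\<^sup>+y. \<integral>\<^sup>+j. ennreal (?a y) * indicator (?A j) y \<partial>count_space UNIV \<partial>lebesgue)"
      unfolding rough_integral_def
    proof (intro nn_integral_mono)
      fix y
      show "ennreal (?a y) \<le> (\<integral>\<^sup>+j. ennreal (?a y) * indicator (?A j) y \<partial>count_space UNIV)"
      \<comment> \<open>At y = x the kernel is 0, because \<open>0 powr a = 0\<close>. Otherwise the
        floor of the logarithm plus 1 is the index of the half-open annulus containing y.\<close>
      proof (cases "x = y")
        case False
        then have pos: "0 < norm (x - y)" by simp
        define j where "j = \<lfloor>log 2 (norm (x - y))\<rfloor> + 1"
        have eq: "2 powr (log 2 (norm (x - y))) = norm (x - y)" using pos by simp
        have "2 powr (real_of_int j - 1) \<le> 2 powr (log 2 (norm (x - y)))"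
          unfolding j_def by (intro powr_mono) auto
        moreover have "2 powr (log 2 (norm (x - y))) < 2 powr real_of_int j"
          unfolding j_def by (intro powr_less_mono) (linarith, simp)
        ultimately have "y \<in> ?A j" unfolding eq by blast
        then have "ennreal (?a y) = ennreal (?a y) * indicator (?A j) y" by simp
        also have "\<dots> \<le> (\<integral>\<^sup>+j. ennreal (?a y) * indicator (?A j) y \<partial>count_space UNIV)"
          by (rule nn_integral_ge_point) simp
        finally show ?thesis .
      qed simp
    qed
    also have "\<dots> = (\<integral>\<^sup>+j. \<integral>\<^sup>+y. ennreal (?a y) * indicator (?A j) y \<partial>lebesgue \<partial>count_space UNIV)"
      by (rule nn_integral_count_space_nn_integral) auto
    also have "\<dots> \<le> (\<integral>\<^sup>+j. ennreal C * ennreal_powr (ennreal (2 powr (- real_of_int j * (?n - \<beta> * s')))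
        * (\<integral>\<^sup>+y\<in>ball x (2 powr real_of_int j). ennreal (cmod (f y) powr s') \<partial>lebesgue)) (1/s') \<partial>count_space UNIV)"
    proof (intro nn_integral_mono)
      fix j :: int
      let ?B = "ball x (2 powr real_of_int j)"
      let ?I = "\<integral>\<^sup>+y\<in>?B. ennreal (cmod (f y) powr s') \<partial>lebesgue"
      have "(\<integral>\<^sup>+y. ennreal (?a y) * indicator (?A j) y \<partial>lebesgue)
        \<le> (\<integral>\<^sup>+y. ennreal (2 powr ((real_of_int j - 1) * (\<beta> - ?n))) *
            ((ennreal (cmod (\<Omega> (x - y))) * indicator ?B y) * (ennreal (cmod (f y)) * indicator ?B y)) \<partial>lebesgue)"
      proof (intro nn_integral_mono)
        fix y
        show "ennreal (?a y) * indicator (?A j) y \<le> ennreal (2 powr ((real_of_int j - 1) * (\<beta> - ?n))) *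
            ((ennreal (cmod (\<Omega> (x - y))) * indicator ?B y) * (ennreal (cmod (f y)) * indicator ?B y))"
        proof (cases "y \<in> ?A j")
          case True
          then have "norm (x - y) powr (\<beta> - ?n) \<le> (2 powr (real_of_int j - 1)) powr (\<beta> - ?n)"
            using \<beta> by (intro powr_mono2') auto
          then have "?a y \<le> cmod (\<Omega> (x - y)) * 2 powr ((real_of_int j - 1) * (\<beta> - ?n)) * cmod (f y)"
            by (intro mult_right_mono mult_left_mono) (auto simp: powr_powr)
          then show ?thesis using True
            by (auto simp: dist_norm ennreal_mult[symmetric] mult_ac intro!: ennreal_leI)
        qed simp
      qed
      also have "\<dots> = ennreal (2 powr ((real_of_int j - 1) * (\<beta> - ?n))) *
          (\<integral>\<^sup>+y. (ennreal (cmod (\<Omega> (x - y))) * indicator ?B y) * (ennreal (cmod (f y)) * indicator ?B y) \<partial>lebesgue)"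
        by (rule nn_integral_cmult) measurable
      also have "(\<integral>\<^sup>+y. (ennreal (cmod (\<Omega> (x - y))) * indicator ?B y) * (ennreal (cmod (f y)) * indicator ?B y) \<partial>lebesgue)
        \<le> ennreal_powr (\<integral>\<^sup>+y. ennreal_powr (ennreal (cmod (\<Omega> (x - y))) * indicator ?B y) s \<partial>lebesgue) (1/s)
          * ennreal_powr (\<integral>\<^sup>+y. ennreal_powr (ennreal (cmod (f y)) * indicator ?B y) s' \<partial>lebesgue) (1/s')"
        by (rule nn_integral_Holder[OF s]) measurable
      also have "(\<integral>\<^sup>+y. ennreal_powr (ennreal (cmod (f y)) * indicator ?B y) s' \<partial>lebesgue) = ?I"
        by (intro nn_integral_cong) (auto simp: indicator_def)
      also have "(\<integral>\<^sup>+y. ennreal_powr (ennreal (cmod (\<Omega> (x - y))) * indicator ?B y) s \<partial>lebesgue)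
         = (\<integral>\<^sup>+y\<in>?B. ennreal (cmod (\<Omega> (x - y)) powr s) \<partial>lebesgue)"
        by (intro nn_integral_cong) (auto simp: indicator_def)
      also have "\<dots> = (\<integral>\<^sup>+y\<in>?B. ennreal (cmod (\<Omega> (x - y)) powr s) \<partial>lborel)"
        by (rule nn_integral_completion)
      also have "\<dots> = ennreal ((2 powr real_of_int j) ^ CARD('n)) * ennreal W"
        unfolding W(1)[symmetric] by (rule homogeneous_zero_powr_integral_ball[OF \<Omega> hom]) simp
      also have "ennreal_powr (ennreal ((2 powr real_of_int j) ^ CARD('n)) * ennreal W) (1/s) = ennreal (2 powr (j * ?n / s) * W powr (1/s))"
        using W by (simp add: ennreal_mult[symmetric] powr_mult powr_realpow[symmetric] powr_powr)
      finally have 1: "(\<integral>\<^sup>+y. ennreal (?a y) * indicator (?A j) y \<partial>lebesgue)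
        \<le> ennreal (2 powr ((real_of_int j - 1) * (\<beta> - ?n))) * (ennreal (2 powr (j * ?n / s) * W powr (1/s)) * ennreal_powr ?I (1/s'))"
        by (simp add: mult_left_mono)
      have 2: "2 powr ((real_of_int j - 1) * (\<beta> - ?n)) * (2 powr (j * ?n / s) * W powr (1/s))
         \<le> C * (2 powr (- real_of_int j * (?n - \<beta> * s'))) powr (1/s')"
      proof -
        define t where "t = 1 / s'"
        have t: "s' * t = 1" "1 / s = 1 - t" using s by (simp_all add: t_def)
        have "(real_of_int j - 1) * (\<beta> - ?n) + j * ?n * (1 - t) = (?n - \<beta>) + (- real_of_int j * (?n - \<beta> * s')) * t"
          using t(1) by algebra
        then have e: "(real_of_int j - 1) * (\<beta> - ?n) + j * ?n / s = (?n - \<beta>) + (- real_of_int j * (?n - \<beta> * s')) * (1/s')"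
          unfolding t(2)[symmetric] t_def[symmetric] by simp
        have "2 powr ((real_of_int j - 1) * (\<beta> - ?n)) * (2 powr (j * ?n / s) * W powr (1/s))
           = 2 powr ((real_of_int j - 1) * (\<beta> - ?n) + j * ?n / s) * W powr (1/s)"
          by (simp add: powr_add)
        also have "\<dots> = 2 powr (?n - \<beta>) * (2 powr (- real_of_int j * (?n - \<beta> * s'))) powr (1/s') * W powr (1/s)"
          unfolding e powr_add powr_powr ..
        also have "\<dots> \<le> C * (2 powr (- real_of_int j * (?n - \<beta> * s'))) powr (1/s')"
          unfolding C_def by (simp add: algebra_simps)
        finally show ?thesis .
      qed
      note 1
      also have "ennreal (2 powr ((real_of_int j - 1) * (\<beta> - ?n))) * (ennreal (2 powr (j * ?n / s) * W powr (1/s)) * ennreal_powr ?I (1/s'))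
         = ennreal (2 powr ((real_of_int j - 1) * (\<beta> - ?n)) * (2 powr (j * ?n / s) * W powr (1/s))) * ennreal_powr ?I (1/s')"
        using W by (simp add: ennreal_mult mult.assoc)
      also have "\<dots> \<le> ennreal (C * (2 powr (- real_of_int j * (?n - \<beta> * s'))) powr (1/s')) * ennreal_powr ?I (1/s')"
        by (intro mult_right_mono ennreal_leI 2) simp
      also have "\<dots> = ennreal C * ennreal_powr (ennreal (2 powr (- real_of_int j * (?n - \<beta> * s'))) * ?I) (1/s')"
        by (simp add: ennreal_powr_mult ennreal_mult C_def mult.assoc)
      finally show "(\<integral>\<^sup>+y. ennreal (?a y) * indicator (?A j) y \<partial>lebesgue)
        \<le> ennreal C * ennreal_powr (ennreal (2 powr (- real_of_int j * (?n - \<beta> * s'))) * ?I) (1/s')" .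
    qed
    also have "\<dots> = ennreal C * (\<integral>\<^sup>+j. ennreal_powr (ennreal (2 powr (- real_of_int j * (?n - \<beta> * s')))
        * (\<integral>\<^sup>+y\<in>ball x (2 powr real_of_int j). ennreal (cmod (f y) powr s') \<partial>lebesgue)) (1/s') \<partial>count_space UNIV)"
      by (rule nn_integral_cmult) simp
    finally show "rough_integral \<beta> \<Omega> f x
      \<le> ennreal C * (\<integral>\<^sup>+j. ennreal_powr (ennreal (2 powr (- real_of_int j * (?n - \<beta> * s')))
        * (\<integral>\<^sup>+y\<in>ball x (2 powr real_of_int j). ennreal (cmod (f y) powr s') \<partial>lebesgue)) (1/s') \<partial>count_space UNIV)" .
  qed
qed

subsection \<open>Taylor remainders\<close>

lemma has_vector_derivative_partial_deriv:
  assumes "\<And>x. (\<lambda>t. f (x + t *\<^sub>R axis i 1)) differentiable (at 0)"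
  shows "((\<lambda>t. f (x + t *\<^sub>R axis i 1)) has_vector_derivative partial_deriv i f (x + t *\<^sub>R axis i 1)) (at t)"
proof -
  let ?g = "\<lambda>\<tau>. f ((x + t *\<^sub>R axis i 1) + \<tau> *\<^sub>R axis i 1)"
  have "(?g has_vector_derivative partial_deriv i f (x + t *\<^sub>R axis i 1)) (at (t - t))"
    using assms[of "x + t *\<^sub>R axis i 1"] unfolding partial_deriv_def by (simp add: vector_derivative_works)
  then have "((?g \<circ> (\<lambda>\<tau>. \<tau> - t)) has_vector_derivative 1 *\<^sub>R partial_deriv i f (x + t *\<^sub>R axis i 1)) (at t)"
    by (intro vector_diff_chain_at) (auto intro!: derivative_eq_intros)
  then show ?thesis by (simp add: o_def algebra_simps)
qed

section \<open>Symmetry of mixed partial derivatives\<close>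

lemma mixed_mean_value:
  fixes \<phi> :: "real \<Rightarrow> real \<Rightarrow> real"
  assumes "\<And>s t. ((\<lambda>s. \<phi> s t) has_real_derivative \<phi>1 s t) (at s)"
    and "\<And>s t. ((\<lambda>t. \<phi>1 s t) has_real_derivative \<phi>12 s t) (at t)" and h: "0 < h"
  shows "\<exists>\<xi> \<eta>. 0 < \<xi> \<and> \<xi> < h \<and> 0 < \<eta> \<and> \<eta> < h \<and> \<phi> h h - \<phi> h 0 - \<phi> 0 h + \<phi> 0 0 = h * (h * \<phi>12 \<xi> \<eta>)"
proof -
  have "\<exists>\<xi>. 0 < \<xi> \<and> \<xi> < h \<and> (\<phi> h h - \<phi> h 0) - (\<phi> 0 h - \<phi> 0 0) = (h - 0) * (\<phi>1 \<xi> h - \<phi>1 \<xi> 0)"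
    by (intro MVT2 DERIV_diff assms h)
  then obtain \<xi> where \<xi>: "0 < \<xi>" "\<xi> < h" "(\<phi> h h - \<phi> h 0) - (\<phi> 0 h - \<phi> 0 0) = h * (\<phi>1 \<xi> h - \<phi>1 \<xi> 0)" by auto
  have "\<exists>\<eta>. 0 < \<eta> \<and> \<eta> < h \<and> \<phi>1 \<xi> h - \<phi>1 \<xi> 0 = (h - 0) * \<phi>12 \<xi> \<eta>"
    by (intro MVT2 assms h)
  then obtain \<eta> where "0 < \<eta>" "\<eta> < h" "\<phi>1 \<xi> h - \<phi>1 \<xi> 0 = h * \<phi>12 \<xi> \<eta>" by auto
  with \<xi> show ?thesis by (intro exI[of _ \<xi>] exI[of _ \<eta>]) (simp add: algebra_simps)
qed

text \<open>The second difference over a square of side h, divided by h^2, is by two mean value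
  steps a value of the one mixed derivative inside the square, and in the other order a value of the
  other. Continuity at the corner then identifies the two limits as h tends to 0.\<close>

lemma mixed_partials_eq_real:
  fixes \<phi> :: "real \<Rightarrow> real \<Rightarrow> real"
  assumes 1: "\<And>s t. ((\<lambda>s. \<phi> s t) has_real_derivative \<phi>1 s t) (at s)"
    and 12: "\<And>s t. ((\<lambda>t. \<phi>1 s t) has_real_derivative \<phi>12 s t) (at t)"
    and 2: "\<And>s t. ((\<lambda>t. \<phi> s t) has_real_derivative \<phi>2 s t) (at t)"
    and 21: "\<And>s t. ((\<lambda>s. \<phi>2 s t) has_real_derivative \<phi>21 s t) (at s)"
    and cont: "isCont (\<lambda>z. \<phi>12 (fst z) (snd z)) (0, 0)" "isCont (\<lambda>z. \<phi>21 (fst z) (snd z)) (0, 0)"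
  shows "\<phi>12 0 0 = \<phi>21 0 0"
proof -
  define h where "h n = 1 / real (Suc n)" for n
  have h: "0 < h n" for n by (simp add: h_def)
  have h0: "h \<longlonglongrightarrow> 0" unfolding h_def by (rule LIMSEQ_Suc[OF lim_1_over_n])
  have "\<exists>\<xi> \<eta>. 0 < \<xi> \<and> \<xi> < h n \<and> 0 < \<eta> \<and> \<eta> < h n \<and>
      \<phi> (h n) (h n) - \<phi> (h n) 0 - \<phi> 0 (h n) + \<phi> 0 0 = h n * (h n * \<phi>12 \<xi> \<eta>)" for n
    by (rule mixed_mean_value[OF 1 12 h])
  then obtain \<xi> \<eta> where A: "\<And>n. 0 < \<xi> n \<and> \<xi> n < h n \<and> 0 < \<eta> n \<and> \<eta> n < h n \<and>
      \<phi> (h n) (h n) - \<phi> (h n) 0 - \<phi> 0 (h n) + \<phi> 0 0 = h n * (h n * \<phi>12 (\<xi> n) (\<eta> n))"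
    by metis
  have "\<exists>\<eta> \<xi>. 0 < \<eta> \<and> \<eta> < h n \<and> 0 < \<xi> \<and> \<xi> < h n \<and>
      \<phi> (h n) (h n) - \<phi> 0 (h n) - \<phi> (h n) 0 + \<phi> 0 0 = h n * (h n * \<phi>21 \<xi> \<eta>)" for n
    by (rule mixed_mean_value[of "\<lambda>t s. \<phi> s t" "\<lambda>t s. \<phi>2 s t" "\<lambda>t s. \<phi>21 s t", OF 2 21 h])
  then obtain \<eta>' \<xi>' where B: "\<And>n. 0 < \<eta>' n \<and> \<eta>' n < h n \<and> 0 < \<xi>' n \<and> \<xi>' n < h n \<and>
      \<phi> (h n) (h n) - \<phi> 0 (h n) - \<phi> (h n) 0 + \<phi> 0 0 = h n * (h n * \<phi>21 (\<xi>' n) (\<eta>' n))"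
    by metis
  have squeeze: "a \<longlonglongrightarrow> 0" if "\<And>n. 0 < a n \<and> a n < h n" for a
    using that by (intro tendsto_sandwich[OF _ _ tendsto_const h0]) (auto intro!: always_eventually less_imp_le)
  have "(\<lambda>n. (\<xi> n, \<eta> n)) \<longlonglongrightarrow> (0, 0)" "(\<lambda>n. (\<xi>' n, \<eta>' n)) \<longlonglongrightarrow> (0, 0)"
    using A B by (auto intro!: tendsto_Pair squeeze)
  then have "(\<lambda>n. \<phi>12 (\<xi> n) (\<eta> n)) \<longlonglongrightarrow> \<phi>12 0 0" "(\<lambda>n. \<phi>21 (\<xi>' n) (\<eta>' n)) \<longlonglongrightarrow> \<phi>21 0 0"
    using isCont_tendsto_compose[OF cont(1)] isCont_tendsto_compose[OF cont(2)] by fastforce+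
  moreover have "\<phi>12 (\<xi> n) (\<eta> n) = \<phi>21 (\<xi>' n) (\<eta>' n)" for n
  proof -
    have "h n * (h n * \<phi>12 (\<xi> n) (\<eta> n)) = h n * (h n * \<phi>21 (\<xi>' n) (\<eta>' n))"
      using A[of n] B[of n] by linarith
    then show ?thesis using h[of n] by simp
  qed
  ultimately show ?thesis by (simp add: LIMSEQ_unique)
qed

lemma Ck_mono: "Ck (Suc k) f \<Longrightarrow> Ck k f"
  by (induction k arbitrary: f) auto

lemma Ck_antimono: "j \<le> k \<Longrightarrow> Ck k f \<Longrightarrow> Ck j f"
proof (induction k rule: dec_induct)
  case (step n)
  then show ?case using Ck_mono by blast
qed simp

lemma Ck_continuous: "Ck k f \<Longrightarrow> continuous_on UNIV f"
  by (cases k) auto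

text \<open>Restriction to the translates x + s e_i + t e_j leaves two real variables. The mean
  value theorem needs real values, so real and imaginary part are treated separately, as bounded
  linear functionals L.\<close>

lemma partial_deriv_commute:
  fixes f :: "real^'n \<Rightarrow> complex"
  assumes f: "Ck (Suc (Suc 0)) f"
  shows "partial_deriv i (partial_deriv j f) = partial_deriv j (partial_deriv i f)"
proof
  fix x :: "real^'n"
  let ?z = "\<lambda>s t. x + s *\<^sub>R axis i 1 + t *\<^sub>R axis j 1"
  have D: "((\<lambda>t. g (x + t *\<^sub>R axis k 1)) has_vector_derivative partial_deriv k g (x + t *\<^sub>R axis k 1)) (at t)"
    if "Ck (Suc 0) g" for g x k t
    using that by (intro has_vector_derivative_partial_deriv) simp
  have f1: "Ck (Suc 0) f" "Ck (Suc 0) (partial_deriv k f)" for k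
    using f Ck_mono[OF f] by auto
  have Di: "((\<lambda>s. g (?z s t)) has_vector_derivative partial_deriv i g (?z s t)) (at s)" if "Ck (Suc 0) g" for g s t
    using D[OF that, of "x + t *\<^sub>R axis j 1" i s] by (simp add: add_ac)
  have Dj: "((\<lambda>t. g (?z s t)) has_vector_derivative partial_deriv j g (?z s t)) (at t)" if "Ck (Suc 0) g" for g s t
    using D[OF that, of "x + s *\<^sub>R axis i 1" j t] by simp
  have cont: "isCont (\<lambda>z. L (partial_deriv k (partial_deriv l f) (?z (fst z) (snd z)))) (0, 0)"
    if "bounded_linear L" for L :: "complex \<Rightarrow> real" and k l
  proof -
    have "continuous_on UNIV (partial_deriv k (partial_deriv l f))" using f by simp
    then have "continuous_on UNIV (\<lambda>z. partial_deriv k (partial_deriv l f) (?z (fst z) (snd z)))"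
      by (rule continuous_on_compose2) (auto intro!: continuous_intros)
    then have "continuous_on UNIV (\<lambda>z. L (partial_deriv k (partial_deriv l f) (?z (fst z) (snd z))))"
      by (rule bounded_linear.continuous_on[OF that])
    then show ?thesis by (simp add: continuous_on_eq_continuous_at)
  qed
  have eq: "L (partial_deriv j (partial_deriv i f) (?z 0 0)) = L (partial_deriv i (partial_deriv j f) (?z 0 0))"
    if L: "bounded_linear L" for L :: "complex \<Rightarrow> real"
  proof (rule mixed_partials_eq_real[where \<phi> = "\<lambda>s t. L (f (?z s t))"
      and ?\<phi>1.0 = "\<lambda>s t. L (partial_deriv i f (?z s t))" and ?\<phi>12.0 = "\<lambda>s t. L (partial_deriv j (partial_deriv i f) (?z s t))"
      and ?\<phi>2.0 = "\<lambda>s t. L (partial_deriv j f (?z s t))" and ?\<phi>21.0 = "\<lambda>s t. L (partial_deriv i (partial_deriv j f) (?z s t))"])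
    fix s t
    show "((\<lambda>s. L (f (?z s t))) has_real_derivative L (partial_deriv i f (?z s t))) (at s)"
      using bounded_linear.has_vector_derivative[OF L Di[OF f1(1)]] by (simp add: has_real_derivative_iff_has_vector_derivative)
    show "((\<lambda>t. L (partial_deriv i f (?z s t))) has_real_derivative L (partial_deriv j (partial_deriv i f) (?z s t))) (at t)"
      using bounded_linear.has_vector_derivative[OF L Dj[OF f1(2)]] by (simp add: has_real_derivative_iff_has_vector_derivative)
    show "((\<lambda>t. L (f (?z s t))) has_real_derivative L (partial_deriv j f (?z s t))) (at t)"
      using bounded_linear.has_vector_derivative[OF L Dj[OF f1(1)]] by (simp add: has_real_derivative_iff_has_vector_derivative)
    show "((\<lambda>s. L (partial_deriv j f (?z s t))) has_real_derivative L (partial_deriv i (partial_deriv j f) (?z s t))) (at s)"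
      using bounded_linear.has_vector_derivative[OF L Di[OF f1(2)]] by (simp add: has_real_derivative_iff_has_vector_derivative)
  qed (rule cont[OF L])+
  show "partial_deriv i (partial_deriv j f) x = partial_deriv j (partial_deriv i f) x"
    using eq[OF bounded_linear_Re] eq[OF bounded_linear_Im] by (simp add: complex_eq_iff)
qed

lemma Ck_fold_partial_deriv: "Ck (length L + k) f \<Longrightarrow> Ck k (fold partial_deriv L f)"
  by (induction L arbitrary: f) auto

text \<open>\<open>fold\<close> lets the head of the list act first, so the new derivative passes
  the entries one by one, and each exchange is made where two derivatives are still
  available.\<close>

lemma partial_deriv_fold_commute:
  "Ck (Suc (length L)) f \<Longrightarrow> partial_deriv a (fold partial_deriv L f) = fold partial_deriv L (partial_deriv a f)"
proof (induction L arbitrary: f)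
  case (Cons b L)
  have "partial_deriv a (fold partial_deriv (b # L) f) = fold partial_deriv L (partial_deriv a (partial_deriv b f))"
    using Cons by simp
  also have "partial_deriv a (partial_deriv b f) = partial_deriv b (partial_deriv a f)"
    by (rule partial_deriv_commute) (rule Ck_antimono[OF _ Cons.prems], simp)
  finally show ?case by simp
qed simp

text \<open>Frees \<open>multi_deriv\<close> from the list chosen in its definition. The head of the
  first list is located in the second and moved to its front by
  \<open>partial_deriv_fold_commute\<close>.\<close>

lemma fold_partial_deriv_perm:
  "Ck (length L) f \<Longrightarrow> mset L = mset L' \<Longrightarrow> fold partial_deriv L f = fold partial_deriv L' f"
proof (induction L arbitrary: L' f)
  case (Cons a L)
  have "a \<in> set L'" using Cons.prems(2) by (metis list.set_intros(1) set_mset_mset)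
  then obtain ys zs where L': "L' = ys @ a # zs" by (meson split_list)
  have m: "mset L = mset (ys @ zs)" using Cons.prems(2) by (simp add: L')
  then have len: "length L = length ys + length zs" by (metis length_append size_mset)
  have "fold partial_deriv (a # L) f = fold partial_deriv L (partial_deriv a f)" by simp
  also have "\<dots> = fold partial_deriv (ys @ zs) (partial_deriv a f)"
    using Cons.prems(1) by (intro Cons.IH m) simp
  also have "\<dots> = fold partial_deriv zs (partial_deriv a (fold partial_deriv ys f))"
  proof -
    have "Ck (Suc (length ys)) f" by (rule Ck_antimono[OF _ Cons.prems(1)]) (simp add: len)
    from partial_deriv_fold_commute[OF this] show ?thesis by simp
  qed
  finally show ?case by (simp add: L')
qed simp

section \<open>Derivatives along multi-indices\<close>

lemma length_eq_multi_size:
  fixes \<gamma> :: "'n::finite \<Rightarrow> nat"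
  assumes "\<forall>i. count_list L i = \<gamma> i"
  shows "length L = multi_size \<gamma>"
  using sum_count_set[of L UNIV] assms by (simp add: multi_size_def)

lemma multi_deriv_eq_fold:
  assumes f: "Ck (multi_size \<gamma>) f" and L: "\<forall>i. count_list L i = \<gamma> i"
  shows "multi_deriv \<gamma> f = fold partial_deriv L f"
proof -
  define L' where "L' = (SOME is. \<forall>i. count_list is i = \<gamma> i)"
  have L': "\<forall>i. count_list L' i = \<gamma> i" unfolding L'_def by (rule someI_ex[OF ex_count_list_eq])
  then have "mset L' = mset L" using L by (intro multiset_eqI) (simp add: count_mset)
  then show ?thesis
    unfolding multi_deriv_def L'_def[symmetric] using f length_eq_multi_size[OF L']
    by (intro fold_partial_deriv_perm) auto
qed

lemma Ck_multi_deriv: "Ck (multi_size \<gamma> + k) f \<Longrightarrow> Ck k (multi_deriv \<gamma> f)"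
proof -
  assume f: "Ck (multi_size \<gamma> + k) f"
  obtain L where L: "\<forall>i. count_list L i = \<gamma> i" using ex_count_list_eq[of \<gamma>] by blast
  have "multi_deriv \<gamma> f = fold partial_deriv L f"
    by (rule multi_deriv_eq_fold[OF _ L]) (rule Ck_antimono[OF _ f], simp)
  then show ?thesis using f Ck_fold_partial_deriv[of L k f] length_eq_multi_size[OF L] by simp
qed

lemma multi_size_fun_upd: "multi_size (\<gamma>(i := k)) = k + multi_size \<gamma> - \<gamma> i"
proof -
  have "multi_size (\<gamma>(i := k)) = k + (\<Sum>j\<in>UNIV - {i}. \<gamma> j)"
    unfolding multi_size_def by (subst sum.remove[of _ i]) auto
  moreover have "multi_size \<gamma> = \<gamma> i + (\<Sum>j\<in>UNIV - {i}. \<gamma> j)"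
    unfolding multi_size_def by (subst sum.remove[of _ i]) auto
  ultimately show ?thesis by simp
qed

text \<open>Turns hypotheses on derivatives of A of order k + 1 into hypotheses of order k on its
  partial derivatives, as the induction for the Taylor remainder requires.\<close>

lemma multi_deriv_partial_deriv:
  assumes f: "Ck (Suc (multi_size \<gamma>)) f"
  shows "multi_deriv \<gamma> (partial_deriv i f) = multi_deriv (\<gamma>(i := Suc (\<gamma> i))) f"
proof -
  obtain L where L: "\<forall>i. count_list L i = \<gamma> i" using ex_count_list_eq[of \<gamma>] by blast
  have "multi_deriv \<gamma> (partial_deriv i f) = fold partial_deriv L (partial_deriv i f)"
    using f by (intro multi_deriv_eq_fold L) simp
  moreover have "multi_deriv (\<gamma>(i := Suc (\<gamma> i))) f = fold partial_deriv (i # L) f"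
    using f L by (intro multi_deriv_eq_fold) (auto simp: multi_size_fun_upd)
  ultimately show ?thesis by simp
qed

lemma multi_deriv_zero [simp]: "multi_deriv (\<lambda>i. 0) f = f"
proof -
  have "(SOME is. \<forall>i::'a. count_list is i = 0) = []"
    by (rule some_equality) (auto simp: count_list_0_iff intro: ccontr)
  then show ?thesis by (simp add: multi_deriv_def)
qed

section \<open>Differentiation and size of the Taylor remainder\<close>

lemma multi_fact_fun_upd_Suc: "multi_fact (\<gamma>(i := Suc (\<gamma> i))) = Suc (\<gamma> i) * multi_fact \<gamma>"
proof -
  have "multi_fact (\<gamma>(i := Suc (\<gamma> i))) = fact (Suc (\<gamma> i)) * (\<Prod>j\<in>UNIV - {i}. fact (\<gamma> j))"
    unfolding multi_fact_def by (subst prod.remove[of _ i]) auto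
  moreover have "multi_fact \<gamma> = fact (\<gamma> i) * (\<Prod>j\<in>UNIV - {i}. fact (\<gamma> j))"
    unfolding multi_fact_def by (subst prod.remove[of _ i]) auto
  ultimately show ?thesis by (simp add: algebra_simps)
qed

text \<open>Only the i-th factor of the monomial varies. Truncated subtraction is harmless: for
  \<gamma> i = 0 the factor \<gamma> i makes the derivative vanish.\<close>

lemma has_vector_derivative_multi_power:
  fixes x y :: "real^'n"
  shows "((\<lambda>t. complex_of_real (multi_power (x + t *\<^sub>R axis i 1 - y) \<gamma>)) has_vector_derivative
     complex_of_real (of_nat (\<gamma> i) * multi_power (x + t *\<^sub>R axis i 1 - y) (\<gamma>(i := \<gamma> i - 1)))) (at t)"
proof -
  let ?c = "\<Prod>j\<in>UNIV - {i}. ((x - y) $ j) ^ \<gamma> j"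
  have eq: "multi_power (x + t *\<^sub>R axis i 1 - y) \<gamma>' = ((x - y) $ i + t) ^ \<gamma>' i * ?c"
    if "\<And>j. j \<noteq> i \<Longrightarrow> \<gamma>' j = \<gamma> j" for t \<gamma>'
  proof -
    have "multi_power (x + t *\<^sub>R axis i 1 - y) \<gamma>' = ((x + t *\<^sub>R axis i 1 - y) $ i) ^ \<gamma>' i * (\<Prod>j\<in>UNIV - {i}. ((x + t *\<^sub>R axis i 1 - y) $ j) ^ \<gamma>' j)"
      unfolding multi_power_def by (subst prod.remove[of _ i]) auto
    also have "(\<Prod>j\<in>UNIV - {i}. ((x + t *\<^sub>R axis i 1 - y) $ j) ^ \<gamma>' j) = ?c"
      using that by (intro prod.cong) (auto simp: axis_def)
    finally show ?thesis by (simp add: axis_def algebra_simps)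
  qed
  have "((\<lambda>t. ((x - y) $ i + t) ^ \<gamma> i * ?c) has_real_derivative (of_nat (\<gamma> i) * (((x - y) $ i + t) ^ (\<gamma> i - 1) * ?c))) (at t)"
    by (auto intro!: derivative_eq_intros)
  then have "((\<lambda>t. multi_power (x + t *\<^sub>R axis i 1 - y) \<gamma>) has_vector_derivative
     (of_nat (\<gamma> i) * multi_power (x + t *\<^sub>R axis i 1 - y) (\<gamma>(i := \<gamma> i - 1)))) (at t)"
    by (simp add: eq has_real_derivative_iff_has_vector_derivative)
  then show ?thesis by (rule bounded_linear.has_vector_derivative[OF bounded_linear_of_real])
qed

lemma finite_multi_size_less: "finite {\<gamma> :: 'n::finite \<Rightarrow> nat. multi_size \<gamma> < k}"
  by (rule finite_subset[OF _ finite_multi_size_le[of k]]) auto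

text \<open>Differentiation kills the monomials free of coordinate i, and the others are reindexed
  by \<delta> = \<gamma> - e_i. As \<gamma>! = \<gamma>_i \<delta>!, what remains is the Taylor
  polynomial of the i-th partial derivative, one order lower.\<close>

lemma has_vector_derivative_taylor_remainder:
  fixes A :: "real^'n \<Rightarrow> complex"
  assumes A: "Ck (Suc k) A"
  shows "((\<lambda>t. taylor_remainder (Suc (Suc k)) A (x + t *\<^sub>R axis i 1) y) has_vector_derivative
     taylor_remainder (Suc k) (partial_deriv i A) (x + t *\<^sub>R axis i 1) y) (at t)"
proof -
  let ?z = "x + t *\<^sub>R axis i 1"
  let ?c = "\<lambda>\<gamma>. 1 / of_nat (multi_fact \<gamma>) * multi_deriv \<gamma> A y"
  have "((\<lambda>t. taylor_remainder (Suc (Suc k)) A (x + t *\<^sub>R axis i 1) y) has_vector_derivative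
     (partial_deriv i A ?z - (\<Sum>\<gamma> | multi_size \<gamma> < Suc (Suc k). ?c \<gamma> * complex_of_real (of_nat (\<gamma> i) * multi_power (?z - y) (\<gamma>(i := \<gamma> i - 1)))))) (at t)"
    unfolding taylor_remainder_def
    using A by (intro has_vector_derivative_diff has_vector_derivative_sum has_vector_derivative_mult_right
        has_vector_derivative_multi_power has_vector_derivative_partial_deriv) simp
  also have "(\<Sum>\<gamma> | multi_size \<gamma> < Suc (Suc k). ?c \<gamma> * complex_of_real (of_nat (\<gamma> i) * multi_power (?z - y) (\<gamma>(i := \<gamma> i - 1))))
     = (\<Sum>\<gamma> | multi_size \<gamma> < Suc (Suc k) \<and> \<gamma> i \<noteq> 0. ?c \<gamma> * complex_of_real (of_nat (\<gamma> i) * multi_power (?z - y) (\<gamma>(i := \<gamma> i - 1))))"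
    by (rule sum.mono_neutral_right) (auto simp: finite_multi_size_less)
  also have "\<dots> = (\<Sum>\<gamma> | multi_size \<gamma> < Suc k. 1 / of_nat (multi_fact \<gamma>) * multi_deriv \<gamma> (partial_deriv i A) y * complex_of_real (multi_power (?z - y) \<gamma>))"
  proof (rule sum.reindex_bij_witness[of _ "\<lambda>\<gamma>. \<gamma>(i := Suc (\<gamma> i))" "\<lambda>\<gamma>. \<gamma>(i := \<gamma> i - 1)"])
    fix \<gamma> assume \<gamma>: "\<gamma> \<in> {\<gamma>. multi_size \<gamma> < Suc (Suc k) \<and> \<gamma> i \<noteq> 0}"
    define \<delta> where "\<delta> = \<gamma>(i := \<gamma> i - 1)"
    have \<gamma>\<delta>: "\<gamma> = \<delta>(i := Suc (\<delta> i))" using \<gamma> by (auto simp: \<delta>_def)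
    have "multi_size \<gamma> = Suc (multi_size \<delta>)" unfolding \<gamma>\<delta> by (simp add: multi_size_fun_upd)
    then have "multi_size \<delta> < Suc k" using \<gamma> by simp
    then show "\<gamma>(i := \<gamma> i - 1) \<in> {\<gamma>. multi_size \<gamma> < Suc k}" by (simp add: \<delta>_def)
    have "multi_deriv \<delta> (partial_deriv i A) = multi_deriv \<gamma> A"
      unfolding \<gamma>\<delta> by (rule multi_deriv_partial_deriv) (rule Ck_antimono[OF _ A], use \<open>multi_size \<delta> < Suc k\<close> in simp)
    moreover have "(of_nat (multi_fact \<gamma>) :: complex) = of_nat (\<gamma> i) * of_nat (multi_fact \<delta>)"
      unfolding \<gamma>\<delta> multi_fact_fun_upd_Suc by (simp add: algebra_simps)
    moreover have "of_nat (\<gamma> i) \<noteq> (0 :: complex)" using \<gamma> by simp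
    ultimately show "1 / of_nat (multi_fact (\<gamma>(i := \<gamma> i - 1))) * multi_deriv (\<gamma>(i := \<gamma> i - 1)) (partial_deriv i A) y * complex_of_real (multi_power (?z - y) (\<gamma>(i := \<gamma> i - 1)))
       = ?c \<gamma> * complex_of_real (of_nat (\<gamma> i) * multi_power (?z - y) (\<gamma>(i := \<gamma> i - 1)))"
      unfolding \<delta>_def[symmetric] by simp
  qed (auto simp: multi_size_fun_upd)
  finally show ?thesis unfolding taylor_remainder_def .
qed

lemma multi_size_zero [simp]: "multi_size (\<lambda>i. 0) = 0"
  by (simp add: multi_size_def)

lemma multi_size_eq_0_iff: "multi_size \<gamma> = 0 \<longleftrightarrow> \<gamma> = (\<lambda>i. 0)"
  by (auto simp: multi_size_def)

lemma taylor_remainder_self: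
  fixes A :: "real^'n \<Rightarrow> complex"
  shows "taylor_remainder (Suc k) A y y = 0"
proof -
  have "multi_power (0 :: real^'n) \<gamma> = 0" if "\<gamma> \<noteq> (\<lambda>i. 0)" for \<gamma>
    using that by (auto simp: multi_power_def fun_eq_iff)
  then have "(\<Sum>\<gamma> | multi_size \<gamma> < Suc k. 1 / of_nat (multi_fact \<gamma>) * multi_deriv \<gamma> A y * complex_of_real (multi_power (y - y) \<gamma>))
    = (\<Sum>\<gamma>\<in>{\<lambda>i. 0}. 1 / of_nat (multi_fact \<gamma>) * multi_deriv \<gamma> A y * complex_of_real (multi_power (y - y) \<gamma>))"
    by (intro sum.mono_neutral_right) (auto simp: finite_multi_size_less)
  then show ?thesis by (simp add: taylor_remainder_def multi_fact_def multi_power_def)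
qed

text \<open>The remainder vanishes at x = y, and its partial derivatives in x are remainders of
  lower order, bounded by induction. The path from y to x changes one coordinate at a time; each of
  its n pieces costs |x - y| times the inductive bound, whence the factor n^k.\<close>

lemma taylor_remainder_bound:
  fixes A :: "real^'n \<Rightarrow> complex"
  assumes "Ck k A" and "\<And>\<gamma> u v. multi_size \<gamma> = k \<Longrightarrow> cmod (multi_deriv \<gamma> A u - multi_deriv \<gamma> A v) \<le> \<Lambda> * norm (u - v) powr \<beta>"
    and \<Lambda>: "0 \<le> \<Lambda>" and \<beta>: "0 < \<beta>"
  shows "cmod (taylor_remainder (Suc k) A x y) \<le> real CARD('n) ^ k * \<Lambda> * norm (x - y) powr (k + \<beta>)"
  using assms(1,2)
proof (induction k arbitrary: A x y)
  case 0
  have "taylor_remainder (Suc 0) A x y = A x - A y"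
    by (simp add: taylor_remainder_def multi_size_eq_0_iff multi_fact_def multi_power_def)
  then show ?case using "0.prems"(2)[of "\<lambda>i. 0" x y] by (simp add: multi_size_def)
next
  case (Suc k)
  let ?n = "real CARD('n)"
  define b where "b = norm (x - y) * (?n ^ k * \<Lambda> * norm (x - y) powr (k + \<beta>))"
  have b: "0 \<le> b" using \<Lambda> by (simp add: b_def)
  have IH: "cmod (taylor_remainder (Suc k) (partial_deriv i A) z y) \<le> ?n ^ k * \<Lambda> * norm (z - y) powr (k + \<beta>)" for i z
  proof (rule Suc.IH)
    show "Ck k (partial_deriv i A)" using Suc.prems(1) by simp
    fix \<gamma> :: "'n \<Rightarrow> nat" and u v :: "real^'n" assume \<gamma>: "multi_size \<gamma> = k"
    have "multi_deriv \<gamma> (partial_deriv i A) = multi_deriv (\<gamma>(i := Suc (\<gamma> i))) A"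
      by (rule multi_deriv_partial_deriv) (use \<gamma> Suc.prems(1) in \<open>simp only:\<close>)
    moreover have "multi_size (\<gamma>(i := Suc (\<gamma> i))) = Suc k" using \<gamma> by (simp add: multi_size_fun_upd)
    ultimately show "cmod (multi_deriv \<gamma> (partial_deriv i A) u - multi_deriv \<gamma> (partial_deriv i A) v) \<le> \<Lambda> * norm (u - v) powr \<beta>"
      using Suc.prems(2) by metis
  qed
  \<comment> \<open>The corner of the path at which the coordinates in S have been switched to those
    of x.\<close>
  define z where "z S = (\<chi> j. if j \<in> S then x $ j else y $ j)" for S
  have "cmod (taylor_remainder (Suc (Suc k)) A (z S) y) \<le> real (card S) * b" if "finite S" for S
    using that
  proof induction
    case empty
    have "z {} = y" by (simp add: z_def vec_eq_iff)
    then show ?case by (simp add: taylor_remainder_self)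
  next
    case (insert i S)
    define d where "d = x $ i - y $ i"
    let ?f = "\<lambda>t. taylor_remainder (Suc (Suc k)) A (z S + t *\<^sub>R axis i 1) y"
    let ?f' = "\<lambda>t. taylor_remainder (Suc k) (partial_deriv i A) (z S + t *\<^sub>R axis i 1) y"
    have "norm (?f d - ?f 0) \<le> (?n ^ k * \<Lambda> * norm (x - y) powr (k + \<beta>)) * norm (d - 0)"
    proof (rule differentiable_bound[of "closed_segment 0 d"])
      fix t assume t: "t \<in> closed_segment 0 d"
      show "(?f has_derivative (\<lambda>h. h *\<^sub>R ?f' t)) (at t within closed_segment 0 d)"
        using has_vector_derivative_taylor_remainder[OF Suc.prems(1), of "z S" i y t]
        unfolding has_vector_derivative_def by (rule has_derivative_at_withinI)
      \<comment> \<open>Every point of the path is coordinatewise between y and x, hence no farther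
        from y than x is.\<close>
      have "\<bar>t\<bar> \<le> \<bar>d\<bar>" using t by (auto simp: closed_segment_eq_real_ivl split: if_splits)
      then have "norm (z S + t *\<^sub>R axis i 1 - y) \<le> norm (x - y)"
        using insert.hyps by (intro norm_le_componentwise_cart) (auto simp: z_def axis_def d_def)
      then have "?n ^ k * \<Lambda> * norm (z S + t *\<^sub>R axis i 1 - y) powr (k + \<beta>) \<le> ?n ^ k * \<Lambda> * norm (x - y) powr (k + \<beta>)"
        using \<Lambda> \<beta> by (intro mult_left_mono powr_mono2) auto
      with IH[of i "z S + t *\<^sub>R axis i 1"] have f': "norm (?f' t) \<le> ?n ^ k * \<Lambda> * norm (x - y) powr (k + \<beta>)" by linarith
      show "onorm (\<lambda>h. h *\<^sub>R ?f' t) \<le> ?n ^ k * \<Lambda> * norm (x - y) powr (k + \<beta>)"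
      proof (rule onorm_le)
        fix h :: real
        show "norm (h *\<^sub>R ?f' t) \<le> ?n ^ k * \<Lambda> * norm (x - y) powr (k + \<beta>) * norm h"
          using mult_right_mono[OF f', of "\<bar>h\<bar>"] by (simp add: mult.commute)
      qed
    qed auto
    also have "\<dots> \<le> b"
    proof -
      have "norm (d - 0) \<le> norm (x - y)" unfolding d_def using component_le_norm_cart[of "x - y" i] by simp
      then have "norm (d - 0) * (?n ^ k * \<Lambda> * norm (x - y) powr (k + \<beta>)) \<le> b"
        unfolding b_def using \<Lambda> by (intro mult_right_mono) auto
      then show ?thesis by (simp add: mult.commute)
    qed
    finally have step: "norm (?f d - ?f 0) \<le> b" .
    have "z (insert i S) = z S + d *\<^sub>R axis i 1"
      using insert.hyps by (auto simp: z_def d_def vec_eq_iff axis_def)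
    then have "cmod (taylor_remainder (Suc (Suc k)) A (z (insert i S)) y) \<le> cmod (?f 0) + norm (?f d - ?f 0)"
      using norm_triangle_sub[of "?f d" "?f 0"] by simp
    also have "\<dots> \<le> real (card S) * b + b" using insert.IH step by simp
    finally show ?case using insert.hyps by (simp add: algebra_simps)
  qed
  from this[of UNIV] have "cmod (taylor_remainder (Suc (Suc k)) A x y) \<le> ?n * b"
    by (simp add: z_def)
  also have "\<dots> = ?n ^ Suc k * \<Lambda> * (norm (x - y) powr 1 * norm (x - y) powr (k + \<beta>))"
    by (simp add: b_def)
  also have "norm (x - y) powr 1 * norm (x - y) powr (k + \<beta>) = norm (x - y) powr (Suc k + \<beta>)"
    unfolding powr_add[symmetric] by (simp add: add_ac)
  finally show ?case .
qed

lemma continuous_taylor_remainder: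
  fixes A :: "real^'n \<Rightarrow> complex"
  assumes A: "Ck k A"
  shows "continuous_on UNIV (\<lambda>z. taylor_remainder (Suc k) A (fst z) (snd z))"
proof -
  have D: "continuous_on UNIV (\<lambda>z::(real^'n) \<times> (real^'n). multi_deriv \<gamma> A (snd z))" if "multi_size \<gamma> < Suc k" for \<gamma>
  proof -
    have "Ck 0 (multi_deriv \<gamma> A)"
      by (rule Ck_multi_deriv) (rule Ck_antimono[OF _ A], use that in simp)
    then have "continuous_on UNIV (multi_deriv \<gamma> A)" by simp
    then show ?thesis by (rule continuous_on_compose2) (auto intro!: continuous_intros)
  qed
  have "continuous_on UNIV (\<lambda>z::(real^'n) \<times> (real^'n). A (fst z))"
    by (rule continuous_on_compose2[OF Ck_continuous[OF A]]) (auto intro!: continuous_intros)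
  then show ?thesis
    unfolding taylor_remainder_def multi_power_def
    by (intro continuous_on_diff continuous_on_sum continuous_on_mult D) (auto intro!: continuous_intros)
qed

text \<open>The infimum is itself admissible: for fixed x and y the inequality, divided by the
  positive power of |x - y|, passes to the infimum.\<close>

lemma Lip_norm_bound:
  assumes g: "g \<in> Lip_space \<beta>"
  shows "cmod (g x - g y) \<le> Lip_norm \<beta> g * norm (x - y) powr \<beta>"
proof (cases "x = y")
  case False
  let ?S = "{C. \<forall>x y. cmod (g x - g y) \<le> C * norm (x - y) powr \<beta>}"
  have ne: "?S \<noteq> {}" using g by (auto simp: Lip_space_def)
  have pos: "0 < norm (x - y) powr \<beta>" using False by simp
  have "cmod (g x - g y) / norm (x - y) powr \<beta> \<le> Inf ?S"
    using ne pos by (intro cInf_greatest) (auto simp: field_simps)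
  then show ?thesis using pos by (simp add: Lip_norm_def field_simps)
qed simp

lemma Lip_norm_nonneg:
  fixes g :: "real^'n \<Rightarrow> complex"
  assumes g: "g \<in> Lip_space \<beta>"
  shows "0 \<le> Lip_norm \<beta> g"
proof -
  obtain i :: 'n where True by blast
  have "0 \<le> cmod (g (axis i 1) - g 0)" by simp
  also have "\<dots> \<le> Lip_norm \<beta> g * norm (axis i 1 - 0 :: real^'n) powr \<beta>" by (rule Lip_norm_bound[OF g])
  finally show ?thesis by (simp add: norm_axis_1)
qed

subsection \<open>The Morrey bound for rough fractional integrals\<close>

text \<open>Covers integrands whose measurability is not known. A simple function below c f becomes
  one below f after division by c, which gives one inequality; the other is the same inequality for
  1/c.\<close>

lemma nn_integral_cmult_pos:
  assumes c: "0 < c"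
  shows "(\<integral>\<^sup>+x. ennreal c * f x \<partial>M) = ennreal c * (\<integral>\<^sup>+x. f x \<partial>M)"
proof -
  have le: "(\<integral>\<^sup>+x. ennreal c * f x \<partial>M) \<le> ennreal c * (\<integral>\<^sup>+x. f x \<partial>M)" if c: "0 < c" for c f
  proof -
    have inv: "ennreal c * ennreal (1/c) = 1" using c by (simp add: ennreal_mult[symmetric])
    have "integral\<^sup>S M g \<le> ennreal c * (\<integral>\<^sup>+x. f x \<partial>M)"
      if g: "simple_function M g" "g \<le> (\<lambda>x. ennreal c * f x)" for g
    proof -
      have "integral\<^sup>S M g = ennreal c * (ennreal (1/c) * integral\<^sup>S M g)"
        by (simp only: mult.assoc[symmetric] inv mult_1)
      also have "ennreal (1/c) * integral\<^sup>S M g = (\<integral>\<^sup>Sx. ennreal (1/c) * g x \<partial>M)"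
        using g by (simp add: simple_integral_mult)
      also have "\<dots> = (\<integral>\<^sup>+x. ennreal (1/c) * g x \<partial>M)"
        using g by (intro nn_integral_eq_simple_integral[symmetric] simple_function_mult) auto
      also have "\<dots> \<le> (\<integral>\<^sup>+x. f x \<partial>M)"
      proof (intro nn_integral_mono)
        fix x
        have "ennreal (1/c) * g x \<le> ennreal (1/c) * (ennreal c * f x)"
          using g(2) by (intro mult_left_mono) (auto simp: le_fun_def)
        also have "\<dots> = f x" using inv by (simp add: mult.assoc[symmetric] mult.commute[of "ennreal (1/c)"])
        finally show "ennreal (1/c) * g x \<le> f x" .
      qed
      finally show ?thesis by (simp add: mult_left_mono)
    qed
    then show ?thesis by (subst nn_integral_def) (auto intro!: SUP_least)
  qed
  have inv: "ennreal c * ennreal (1/c) = 1" using c by (simp add: ennreal_mult[symmetric])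
  have "ennreal c * (\<integral>\<^sup>+x. f x \<partial>M) = ennreal c * (\<integral>\<^sup>+x. ennreal (1/c) * (ennreal c * f x) \<partial>M)"
    using inv by (simp add: mult.assoc[symmetric] mult.commute[of "ennreal (1/c)"])
  also have "\<dots> \<le> ennreal c * (ennreal (1/c) * (\<integral>\<^sup>+x. ennreal c * f x \<partial>M))"
    using c by (intro mult_left_mono le) auto
  also have "\<dots> = (\<integral>\<^sup>+x. ennreal c * f x \<partial>M)" by (simp only: mult.assoc[symmetric] inv mult_1)
  finally show ?thesis using le[OF c] by (intro antisym)
qed

lemma ennreal_powr_divide:
  assumes "0 < b"
  shows "ennreal_powr (X / ennreal b) a = ennreal_powr X a * ennreal (b powr (- a))"
  using assms by (simp add: divide_ennreal_def inverse_ennreal ennreal_powr_mult inverse_powr powr_minus)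

lemma ennreal_le_mult_of_divide_le:
  assumes "0 < b" "X / ennreal b \<le> Y"
  shows "X \<le> Y * ennreal b"
proof -
  have "X = X / ennreal b * ennreal b"
    using assms(1) by (simp add: divide_ennreal_def inverse_ennreal mult.assoc ennreal_mult[symmetric])
  also have "\<dots> \<le> Y * ennreal b" using assms(2) by (rule mult_right_mono) simp
  finally show ?thesis .
qed

text \<open>Local integrability of both powers of w is extracted from the A(P,Q) bound: the product
  of the two factors is finite and neither vanishes, as w > 0 almost everywhere, so neither is
  infinite. K collects C and the volume of the unit ball.\<close>

lemma weight_pair_of_A_class:
  fixes w :: "real^'n \<Rightarrow> real" and P Q s :: real
  assumes w: "weight w" and PQ: "1 < P" "P < Q" and s: "0 < s" and A: "(\<lambda>x. w x powr s) \<in> A_class P Q"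
  shows "\<exists>K. weight_pair (\<lambda>x. w x powr (s * Q)) (\<lambda>x. w x powr (s * - (P / (P - 1)))) P Q K"
proof -
  let ?u = "\<lambda>x. w x powr (s * Q)" and ?v = "\<lambda>x. w x powr (s * - (P / (P - 1)))"
  let ?U = "\<lambda>x r. \<integral>\<^sup>+y\<in>ball x r. ennreal (?u y) \<partial>lebesgue" and ?V = "\<lambda>x r. \<integral>\<^sup>+y\<in>ball x r. ennreal (?v y) \<partial>lebesgue"
  have [measurable]: "w \<in> borel_measurable lebesgue" using w by (simp add: weight_def)
  have wpos: "AE x in lebesgue. 0 < w x" using w by (simp add: weight_def)
  obtain C where C: "1 < C" and "\<forall>B\<in>balls.
      ennreal_powr ((\<integral>\<^sup>+ x \<in> B. ennreal ((w x powr s) powr Q) \<partial>lebesgue) / emeasure lebesgue B) (1 / Q)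
    * ennreal_powr ((\<integral>\<^sup>+ x \<in> B. ennreal ((w x powr s) powr (- (P / (P - 1)))) \<partial>lebesgue)
                      / emeasure lebesgue B) ((P - 1) / P) \<le> ennreal C"
    using A unfolding A_class_def by blast
  then have AB: "ennreal_powr (?U x r / emeasure lebesgue (ball x r)) (1/Q)
      * ennreal_powr (?V x r / emeasure lebesgue (ball x r)) ((P - 1) / P) \<le> ennreal C" if "0 < r" for x r
    using that unfolding powr_powr balls_def by blast
  define vol where "vol = unit_ball_vol CARD('n)"
  have vol: "0 < vol" by (simp add: vol_def)
  define e where "e = 1/Q + (1 - 1/P)"
  define K where "K = C * vol powr e"
  have K: "0 < K" using C vol by (simp add: K_def)
  have main: "ennreal_powr (?U x r) (1/Q) * ennreal_powr (?V x r) (1 - 1/P) \<le> ennreal (K * r powr (CARD('n) * e))"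
    if r: "0 < r" for x r
  proof -
    let ?b = "vol * r ^ CARD('n)"
    have b: "0 < ?b" using vol r by simp
    have em: "emeasure lebesgue (ball x r) = ennreal ?b" using r by (simp add: emeasure_lborel_ball_cart vol_def)
    have PP: "(P - 1) / P = 1 - 1/P" using PQ by (simp add: diff_divide_distrib)
    have "ennreal_powr (?U x r) (1/Q) * ennreal_powr (?V x r) (1 - 1/P)
       = ennreal (?b powr e) * (ennreal_powr (?U x r / ennreal ?b) (1/Q) * ennreal_powr (?V x r / ennreal ?b) (1 - 1/P))"
    proof -
      have "?b powr e * (?b powr (- (1/Q)) * ?b powr (- (1 - 1/P))) = 1"
        using b vol r unfolding powr_add[symmetric] by (simp add: e_def)
      then have "ennreal (?b powr e) * (ennreal (?b powr (- (1/Q))) * ennreal (?b powr (- (1 - 1/P)))) = 1"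
        by (subst ennreal_mult[symmetric], simp, simp)+ simp
      moreover have "ennreal (?b powr e) * (ennreal_powr (?U x r / ennreal ?b) (1/Q) * ennreal_powr (?V x r / ennreal ?b) (1 - 1/P))
         = (ennreal (?b powr e) * (ennreal (?b powr (- (1/Q))) * ennreal (?b powr (- (1 - 1/P))))) * (ennreal_powr (?U x r) (1/Q) * ennreal_powr (?V x r) (1 - 1/P))"
        unfolding ennreal_powr_divide[OF b] by (simp only: mult_ac)
      ultimately show ?thesis by (simp only: mult_1)
    qed
    also have "\<dots> \<le> ennreal (?b powr e) * ennreal C"
      using AB[OF r, of x] unfolding em PP by (rule mult_left_mono) simp
    also have "\<dots> = ennreal (K * r powr (CARD('n) * e))"
      using C vol r by (simp add: K_def ennreal_mult[symmetric] powr_mult powr_realpow[symmetric] powr_powr mult_ac)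
    finally show ?thesis .
  qed
  have ne: "?U x r \<noteq> 0" "?V x r \<noteq> 0" if "0 < r" for x r
    using that wpos by (intro nn_integral_ball_pos; auto elim!: eventually_mono)+
  have fin: "?U x r \<noteq> top \<and> ?V x r \<noteq> top" for x r
  proof (cases "0 < r")
    case True
    show ?thesis
      using main[OF True, of x] ne[OF True, of x] by (auto simp: ennreal_mult_top ennreal_top_mult top_unique)
  next
    case False
    then have empty: "ball x r = {}" by simp
    show ?thesis unfolding empty by simp
  qed
  have "weight_pair ?u ?v P Q K"
  proof
    show "AE x in lebesgue. 0 < ?u x \<and> 0 < ?v x \<and> ?u x powr (1/Q) * ?v x powr (1 - 1/P) = 1"
      using wpos
    proof eventually_elim
      case (elim x)
      have "s * Q * (1/Q) + s * - (P / (P - 1)) * (1 - 1/P) = 0" using PQ by (simp add: field_simps)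
      then have "w x powr (s * Q * (1/Q)) * w x powr (s * - (P / (P - 1)) * (1 - 1/P)) = 1"
        using elim unfolding powr_add[symmetric] by simp
      then show ?case using elim unfolding powr_powr by simp
    qed
  qed (use PQ K fin main in \<open>auto simp: e_def\<close>)
  then show ?thesis by blast
qed

lemma rough_integral_cong:
  fixes \<Omega> \<Omega>' f f' :: "real^'n \<Rightarrow> complex"
  assumes "AE z in lborel. \<Omega> z = \<Omega>' z" "AE y in lborel. f y = f' y"
  shows "rough_integral \<beta> \<Omega> f x = rough_integral \<beta> \<Omega>' f' x"
  unfolding rough_integral_def
proof (rule nn_integral_cong_AE, rule AE_completion)
  show "AE y in lborel. ennreal (cmod (\<Omega> (x - y)) * norm (x - y) powr (\<beta> - CARD('n)) * cmod (f y))
     = ennreal (cmod (\<Omega>' (x - y)) * norm (x - y) powr (\<beta> - CARD('n)) * cmod (f' y))"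
    using AE_lborel_reflect[OF assms(1), of x] assms(2) by eventually_elim simp
qed

text \<open>Measurability in x comes from joint measurability of the integrand on the Borel product;
  f is replaced by a Borel version, which changes no value of the integral.\<close>

lemma borel_measurable_rough_integral:
  fixes \<Omega> f :: "real^'n \<Rightarrow> complex"
  assumes [measurable]: "\<Omega> \<in> borel_measurable borel" and f: "f \<in> borel_measurable lebesgue"
  shows "rough_integral \<beta> \<Omega> f \<in> borel_measurable lebesgue"
proof -
  obtain f' where f' [measurable]: "f' \<in> borel_measurable lborel" and ae: "AE y in lborel. f y = f' y"
    using completion_ex_borel_measurable_complex[OF f] by blast
  have "(\<lambda>x. rough_integral \<beta> \<Omega> f' x) \<in> borel_measurable lborel"
    unfolding rough_integral_def nn_integral_completion
    by (intro sigma_finite_measure.borel_measurable_nn_integral lborel.sigma_finite_measure_axioms) measurable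
  moreover have "rough_integral \<beta> \<Omega> f = (\<lambda>x. rough_integral \<beta> \<Omega> f' x)"
    by (intro ext rough_integral_cong ae) simp
  ultimately show ?thesis using measurable_completion by metis
qed

text \<open>Formulated for any F dominated by a multiple c of the rough integral, with C independent
  of c. It serves T and M with c proportional to the Lipschitz norms, and the rough integral itself
  with c = 1, where it yields finiteness almost everywhere.\<close>

lemma rough_integral_morrey:
  fixes \<Omega> :: "real^'n \<Rightarrow> complex" and w :: "real^'n \<Rightarrow> real" and \<beta> s s' p q \<kappa> :: real
  assumes \<Omega> [measurable]: "\<Omega> \<in> borel_measurable borel" and hom: "homogeneous_zero \<Omega>"
    and fin: "(\<integral>\<^sup>+z\<in>ball 0 1. ennreal (cmod (\<Omega> z) powr s) \<partial>lborel) < top"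
    and \<beta>: "0 < \<beta>" "\<beta> < 1" and s: "s > 1" "1 < s'" "1 / s + 1 / s' = 1"
    and p: "s' < p" and q: "p < q" "1 / q = 1 / p - \<beta> / CARD('n)"
    and \<kappa>: "0 < \<kappa>" "\<kappa> < p / q"
    and w: "weight w" and A: "(\<lambda>x. w x powr s') \<in> A_class (p / s') (q / s')"
  shows "\<exists>C>0. \<forall>f \<in> morrey_space p \<kappa> (\<lambda>x. w x powr p) (\<lambda>x. w x powr q). \<forall>F c. 0 \<le> c \<longrightarrow>
    (\<forall>x. F x \<le> ennreal c * rough_integral \<beta> \<Omega> f x) \<longrightarrow>
    morrey_norm q (\<kappa> * q / p) (\<lambda>x. w x powr q) (\<lambda>x. w x powr q) F
      \<le> ennreal (C * c) * morrey_norm p \<kappa> (\<lambda>x. w x powr p) (\<lambda>x. w x powr q) (modulus f)"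
proof -
  define P Q where "P = p / s'" and "Q = q / s'"
  have PQ: "1 < P" "P < Q" using s p q by (auto simp: P_def Q_def divide_strict_right_mono)
  have Pp: "s' * P = p" "s' * Q = q" using s by (auto simp: P_def Q_def)
  have pq: "0 < p" "0 < q" using s p q by auto
  have QP: "Q / P = q / p" "P / Q = p / q" using s by (auto simp: P_def Q_def)
  obtain K where "weight_pair (\<lambda>x. w x powr (s' * Q)) (\<lambda>x. w x powr (s' * - (P / (P - 1)))) P Q K"
    using weight_pair_of_A_class[OF w PQ _ A[folded P_def Q_def]] s by auto
  then interpret W: weight_pair "\<lambda>x. w x powr q" "\<lambda>x. w x powr (s' * - (P / (P - 1)))" P Q K unfolding Pp .
  obtain Du \<theta>u where "growth_measure W.Mu Du \<theta>u" using W.growth_u by blast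
  then interpret U: growth_measure W.Mu Du \<theta>u .
  let ?v = "\<lambda>x. w x powr (s' * - (P / (P - 1)))"
  \<comment> \<open>Matches the homogeneity of the weight pair, by way of 1/q = 1/p - \<beta>/n,
    with the exponent that Hoelder's inequality leaves on the annuli.\<close>
  have \<nu>: "W.\<nu> = CARD('n) - \<beta> * s'"
  proof -
    have "1/Q = s' * (1/q)" "1/P = s' * (1/p)" by (simp_all add: P_def Q_def)
    then have "1/Q - 1/P = - (\<beta> * s' / CARD('n))" using q(2) by (simp add: algebra_simps)
    then have "CARD('n) * (1/Q + (1 - 1/P)) = CARD('n) * (1 - \<beta> * s' / CARD('n))" by simp
    also have "\<dots> = CARD('n) - \<beta> * s'" by (simp add: field_simps)
    finally show ?thesis unfolding W.\<nu>_def .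
  qed
  have mu: "weight_of (\<lambda>x. w x powr q) (ball x r) = ennreal (measure W.Mu (ball x r))" for x r
  proof -
    have "weight_of (\<lambda>x. w x powr q) (ball x r) = emeasure W.Mu (ball x r)"
      using W.u unfolding weight_of_def W.Mu_def by (simp add: emeasure_density)
    then show ?thesis by (simp add: U.emeasure_ball_eq)
  qed
  have "\<kappa> < P / Q" using \<kappa> QP by simp
  from W.dyadic_sum_morrey[OF s(2) \<kappa>(1) this]
  obtain C1 where C1: "0 < C1" and dyadic: "\<And>g N x r. \<lbrakk>0 \<le> N; g \<in> borel_measurable lebesgue; \<forall>x. 0 \<le> g x;
      \<forall>x. \<forall>r>0. (\<integral>\<^sup>+y\<in>ball x r. ennreal (g y powr P * ?v y powr (1 - P)) \<partial>lebesgue) \<le> ennreal (N * measure W.Mu (ball x r) powr \<kappa>);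
      0 < r\<rbrakk> \<Longrightarrow> (\<integral>\<^sup>+y\<in>ball x r. ennreal_powr (W.dyadic_sum s' g y) q \<partial>W.Mu)
       \<le> ennreal (C1 * N powr (q/p) * measure W.Mu (ball x r) powr (\<kappa> * q/p))"
    using QP Pp by (auto simp: mult.commute[of Q s'] times_divide_eq_right[symmetric] simp del: times_divide_eq_right)
  have "\<beta> < CARD('n)"
  proof -
    have "1 \<le> CARD('n)" by (simp add: Suc_leI)
    then show ?thesis using \<beta> by linarith
  qed
  from rough_integral_le_dyadic_sum[OF \<Omega> hom fin s(1,2,3) this]
  obtain C2 where C2: "0 < C2" and rough: "\<And>f x. f \<in> borel_measurable lebesgue \<Longrightarrow>
      rough_integral \<beta> \<Omega> f x \<le> ennreal C2 * W.dyadic_sum s' (\<lambda>y. cmod (f y) powr s') x"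
    unfolding W.dyadic_sum_def \<nu> by auto
  define C where "C = C1 powr (1/q) * C2"
  have C: "0 < C" using C1 C2 by (simp add: C_def)
  show ?thesis
  proof (intro exI[of _ C] conjI C ballI allI impI)
    fix f F c assume f: "f \<in> morrey_space p \<kappa> (\<lambda>x. w x powr p) (\<lambda>x. w x powr q)" and c: "0 \<le> c"
      and F: "\<forall>x. F x \<le> ennreal c * rough_integral \<beta> \<Omega> f x"
    let ?X = "morrey_norm p \<kappa> (\<lambda>x. w x powr p) (\<lambda>x. w x powr q) (modulus f)"
    have fm [measurable]: "f \<in> borel_measurable lebesgue" and X: "?X < top"
      using f by (auto simp: morrey_space_def)
    define S where "S = (SUP B\<in>balls. (\<integral>\<^sup>+ x \<in> B. ennreal_powr (modulus f x) p * ennreal (w x powr p) \<partial>lebesgue)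
                      / ennreal_powr (weight_of (\<lambda>x. w x powr q) B) \<kappa>)"
    have XS: "?X = ennreal_powr S (1/p)" by (simp add: morrey_norm_def S_def)
    with X have "S \<noteq> top" by auto
    then obtain N where N: "S = ennreal N" "0 \<le> N" by (cases S) auto
    define g where "g y = cmod (f y) powr s'" for y
    have [measurable]: "g \<in> borel_measurable lebesgue" unfolding g_def by measurable
    have morrey: "(\<integral>\<^sup>+y\<in>ball x r. ennreal (g y powr P * ?v y powr (1 - P)) \<partial>lebesgue) \<le> ennreal (N * measure W.Mu (ball x r) powr \<kappa>)"
      if r: "0 < r" for x r
    proof -
      \<comment> \<open>Hence g^P v^(1-P) = |f|^p w^p, and the Morrey condition on f becomes the
        hypothesis of \<open>dyadic\<close>.\<close>
      have e: "s' * - (P / (P - 1)) * (1 - P) = p" using PQ Pp by (simp add: field_simps)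
      let ?m = "measure W.Mu (ball x r)"
      have m: "0 < ?m" using r by (rule U.measure_ball_pos)
      have "(\<integral>\<^sup>+y\<in>ball x r. ennreal (g y powr P * ?v y powr (1 - P)) \<partial>lebesgue) = (\<integral>\<^sup>+ y \<in> ball x r. ennreal_powr (modulus f y) p * ennreal (w y powr p) \<partial>lebesgue)"
        unfolding g_def powr_powr e Pp by (simp add: modulus_def ennreal_mult)
      also have "\<dots> \<le> S * ennreal (?m powr \<kappa>)"
      proof (rule ennreal_le_mult_of_divide_le)
        have "ball x r \<in> balls" using r by (auto simp: balls_def)
        then have "(\<integral>\<^sup>+ y \<in> ball x r. ennreal_powr (modulus f y) p * ennreal (w y powr p) \<partial>lebesgue) / ennreal_powr (weight_of (\<lambda>x. w x powr q) (ball x r)) \<kappa> \<le> S"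
          unfolding S_def by (rule SUP_upper)
        then show "(\<integral>\<^sup>+ y \<in> ball x r. ennreal_powr (modulus f y) p * ennreal (w y powr p) \<partial>lebesgue) / ennreal (?m powr \<kappa>) \<le> S"
          by (simp add: mu)
      qed (use m in simp)
      finally show ?thesis using N by (simp add: ennreal_mult)
    qed
    have R [measurable]: "rough_integral \<beta> \<Omega> f \<in> borel_measurable lebesgue"
      by (rule borel_measurable_rough_integral[OF \<Omega> fm])
    have local: "(\<integral>\<^sup>+y\<in>ball x r. ennreal_powr (F y) q * ennreal (w y powr q) \<partial>lebesgue)
        \<le> ennreal ((C * c) powr q * N powr (q/p) * measure W.Mu (ball x r) powr (\<kappa> * q/p))" if r: "0 < r" for x r
    proof -
      let ?m = "measure W.Mu (ball x r)"
      have [measurable]: "ball x r \<in> sets lebesgue" by simp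
      have [measurable]: "(\<lambda>x. w x powr q) \<in> borel_measurable lebesgue" by (rule W.u)
      have "(\<integral>\<^sup>+y\<in>ball x r. ennreal_powr (F y) q * ennreal (w y powr q) \<partial>lebesgue)
        \<le> (\<integral>\<^sup>+y. ennreal (c powr q) * (ennreal (w y powr q) * (ennreal_powr (rough_integral \<beta> \<Omega> f y) q * indicator (ball x r) y)) \<partial>lebesgue)"
      proof (intro nn_integral_mono)
        fix y
        have "ennreal_powr (F y) q \<le> ennreal_powr (ennreal c * rough_integral \<beta> \<Omega> f y) q"
          using F pq by (intro ennreal_powr_mono) auto
        also have "\<dots> = ennreal (c powr q) * ennreal_powr (rough_integral \<beta> \<Omega> f y) q"
          using c by (simp add: ennreal_powr_mult)
        finally have "ennreal_powr (F y) q * (ennreal (w y powr q) * indicator (ball x r) y) \<le> ennreal (c powr q) * ennreal_powr (rough_integral \<beta> \<Omega> f y) q * (ennreal (w y powr q) * indicator (ball x r) y)"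
          by (rule mult_right_mono) simp
        then show "ennreal_powr (F y) q * ennreal (w y powr q) * indicator (ball x r) y \<le> ennreal (c powr q) * (ennreal (w y powr q) * (ennreal_powr (rough_integral \<beta> \<Omega> f y) q * indicator (ball x r) y))"
          by (simp only: mult_ac)
      qed
      also have "\<dots> = ennreal (c powr q) * (\<integral>\<^sup>+y. ennreal (w y powr q) * (ennreal_powr (rough_integral \<beta> \<Omega> f y) q * indicator (ball x r) y) \<partial>lebesgue)"
        by (rule nn_integral_cmult) measurable
      also have "(\<integral>\<^sup>+y. ennreal (w y powr q) * (ennreal_powr (rough_integral \<beta> \<Omega> f y) q * indicator (ball x r) y) \<partial>lebesgue)
         = (\<integral>\<^sup>+y\<in>ball x r. ennreal_powr (rough_integral \<beta> \<Omega> f y) q \<partial>W.Mu)"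
        unfolding W.Mu_def by (rule nn_integral_density[symmetric]) measurable
      also have "\<dots> \<le> (\<integral>\<^sup>+y. ennreal (C2 powr q) * (ennreal_powr (W.dyadic_sum s' g y) q * indicator (ball x r) y) \<partial>W.Mu)"
      proof (intro nn_integral_mono)
        fix y
        have "ennreal_powr (rough_integral \<beta> \<Omega> f y) q \<le> ennreal_powr (ennreal C2 * W.dyadic_sum s' g y) q"
          unfolding g_def using rough[OF fm, of y] pq by (intro ennreal_powr_mono) auto
        also have "\<dots> = ennreal (C2 powr q) * ennreal_powr (W.dyadic_sum s' g y) q"
          using C2 by (simp add: ennreal_powr_mult)
        finally show "ennreal_powr (rough_integral \<beta> \<Omega> f y) q * indicator (ball x r) y \<le> ennreal (C2 powr q) * (ennreal_powr (W.dyadic_sum s' g y) q * indicator (ball x r) y)"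
          by (simp add: mult_right_mono flip: mult.assoc)
      qed
      \<comment> \<open>No measurability of \<open>dyadic_sum\<close> is at hand, so the constant is
        pulled out by \<open>nn_integral_cmult_pos\<close>.\<close>
      also have "\<dots> = ennreal (C2 powr q) * (\<integral>\<^sup>+y\<in>ball x r. ennreal_powr (W.dyadic_sum s' g y) q \<partial>W.Mu)"
        using C2 by (intro nn_integral_cmult_pos) simp
      also have "(\<integral>\<^sup>+y\<in>ball x r. ennreal_powr (W.dyadic_sum s' g y) q \<partial>W.Mu) \<le> ennreal (C1 * N powr (q/p) * ?m powr (\<kappa> * q/p))"
        using morrey r N by (intro dyadic) (auto simp: g_def)
      also have "ennreal (c powr q) * (ennreal (C2 powr q) * ennreal (C1 * N powr (q/p) * ?m powr (\<kappa> * q/p)))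
         = ennreal ((C * c) powr q * N powr (q/p) * ?m powr (\<kappa> * q/p))"
        using C1 pq by (simp add: C_def powr_mult powr_powr ennreal_mult[symmetric] mult_ac)
      finally show ?thesis by (simp add: mult_left_mono)
    qed
    show "morrey_norm q (\<kappa> * q / p) (\<lambda>x. w x powr q) (\<lambda>x. w x powr q) F \<le> ennreal (C * c) * ?X"
      unfolding morrey_norm_def[of q]
    proof (subst ennreal_powr_le_iff, use pq in simp, rule SUP_least)
      fix B :: "(real^'n) set" assume "B \<in> balls"
      then obtain x r where B: "B = ball x r" "0 < r" by (auto simp: balls_def)
      let ?m = "measure W.Mu (ball x r)"
      have m: "0 < ?m" using B(2) by (rule U.measure_ball_pos)
      have "(\<integral>\<^sup>+ y \<in> B. ennreal_powr (F y) q * ennreal (w y powr q) \<partial>lebesgue)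
         \<le> ennreal ((C * c) powr q * N powr (q/p)) * ennreal (?m powr (\<kappa> * q / p))"
        using local[OF B(2), of x] unfolding B(1) by (simp add: ennreal_mult)
      then have "(\<integral>\<^sup>+ y \<in> B. ennreal_powr (F y) q * ennreal (w y powr q) \<partial>lebesgue) / ennreal (?m powr (\<kappa> * q / p))
         \<le> ennreal ((C * c) powr q * N powr (q/p))"
        using m by (intro divide_le_posI_ennreal) (auto simp: mult.commute)
      also have "\<dots> = ennreal_powr (ennreal (C * c) * ?X) (1 / (1 / q))"
        using N pq C c unfolding XS by (simp add: ennreal_mult[symmetric] powr_mult powr_powr)
      finally show "(\<integral>\<^sup>+ y \<in> B. ennreal_powr (F y) q * ennreal (w y powr q) \<partial>lebesgue)
          / ennreal_powr (weight_of (\<lambda>x. w x powr q) B) (\<kappa> * q / p) \<le> ennreal_powr (ennreal (C * c) * ?X) (1 / (1 / q))"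
        unfolding B(1) mu by simp
    qed
  qed
qed

text \<open>On each ball F^q u has a finite integral, hence is finite almost everywhere, and u > 0
  passes this to F; countably many balls cover the space. The measure v(B) has to be finite, since
  dividing by infinity would erase the information.\<close>

lemma AE_finite_of_morrey_norm:
  fixes F :: "real^'n \<Rightarrow> ennreal" and u v :: "real^'n \<Rightarrow> real"
  assumes [measurable]: "F \<in> borel_measurable lebesgue" "u \<in> borel_measurable lebesgue"
    and pos: "AE x in lebesgue. 0 < u x" and q: "0 < q" and fin: "\<And>x r. weight_of v (ball x r) \<noteq> top"
    and norm: "morrey_norm q \<kappa> u v F < top"
  shows "AE x in lebesgue. F x < top"
proof -
  have "AE x in lebesgue. x \<in> ball 0 (real (Suc n)) \<longrightarrow> F x < top" for n
  proof -
    let ?B = "ball (0 :: real^'n) (real (Suc n))"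
    have [measurable]: "?B \<in> sets lebesgue" by simp
    let ?I = "\<integral>\<^sup>+ x \<in> ?B. ennreal_powr (F x) q * ennreal (u x) \<partial>lebesgue"
    have "0 < real (Suc n)" by (simp only: of_nat_0_less_iff zero_less_Suc)
    then have "?B \<in> balls" unfolding balls_def by blast
    then have "?I / ennreal_powr (weight_of v ?B) \<kappa> \<le> (SUP B\<in>balls. (\<integral>\<^sup>+ x \<in> B. ennreal_powr (F x) q * ennreal (u x) \<partial>lebesgue) / ennreal_powr (weight_of v B) \<kappa>)"
      by (rule SUP_upper)
    also have "\<dots> < top" using less_imp_neq[OF norm] unfolding morrey_norm_def ennreal_powr_eq_top_iff less_top .
    finally have "?I \<noteq> top" using fin[of 0 "real (Suc n)"] by (auto simp: ennreal_top_divide)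
    then have ne: "?I \<noteq> \<infinity>" by simp
    have "(\<lambda>x. ennreal_powr (F x) q * ennreal (u x) * indicator ?B x) \<in> borel_measurable lebesgue" by measurable
    from nn_integral_PInf_AE[OF this ne]
    have "AE x in lebesgue. ennreal_powr (F x) q * ennreal (u x) * indicator ?B x \<noteq> \<infinity>" .
    with pos show ?thesis
    proof eventually_elim
      case (elim x)
      show ?case
      proof (intro impI, rule ccontr)
        assume "x \<in> ?B" "\<not> F x < top"
        then have "F x = top" by (metis less_top)
        with elim \<open>x \<in> ?B\<close> show False by (auto simp: ennreal_top_mult ennreal_eq_0_iff)
      qed
    qed
  qed
  then have "AE x in lebesgue. \<forall>n. x \<in> ball 0 (real (Suc n)) \<longrightarrow> F x < top"
    unfolding AE_all_countable by blast
  then show ?thesis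
  proof eventually_elim
    case (elim x)
    obtain n where "norm x < real n" using reals_Archimedean2 by blast
    then have "x \<in> ball 0 (real (Suc n))" by simp
    then show ?case using elim by blast
  qed
qed

subsection \<open>The operators\<close>

text \<open>One estimate for both kernels: T takes r = |z|, M takes r > |z|. The exponent m - 1 +
  \<beta> of the remainder against n + m - 1 in the denominator leaves \<beta> - n. At z = 0 the
  hypothesis forces R = 0.\<close>

lemma kernel_bound:
  fixes z :: "real^'n"
  assumes m: "1 \<le> m" and R: "\<bar>R\<bar> \<le> c * norm z powr (real (m - 1) + \<beta>)" and \<beta>: "0 < \<beta>" and r: "norm z \<le> r" "0 < r" and c: "0 \<le> c"
  shows "\<bar>R\<bar> / r ^ (CARD('n) + m - 1) \<le> c * norm z powr (\<beta> - CARD('n))"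
proof (cases "z = 0")
  case True
  then show ?thesis using R \<beta> by simp
next
  case False
  then have z: "0 < norm z" by simp
  have e: "real (CARD('n) + m - 1) = real CARD('n) + real (m - 1)" using m by simp
  have "\<bar>R\<bar> / r ^ (CARD('n) + m - 1) \<le> (c * norm z powr (real (m - 1) + \<beta>)) / norm z ^ (CARD('n) + m - 1)"
    using R c r z by (intro frac_le power_mono) auto
  also have "norm z ^ (CARD('n) + m - 1) = norm z powr (real CARD('n) + real (m - 1))"
    using z by (simp only: powr_realpow[symmetric] e)
  also have "(c * norm z powr (real (m - 1) + \<beta>)) / norm z powr (real CARD('n) + real (m - 1)) = c * norm z powr (\<beta> - CARD('n))"
    unfolding times_divide_eq_right[symmetric] powr_diff[symmetric] by (simp add: algebra_simps)
  finally show ?thesis .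
qed

lemma T_integrand_bound:
  fixes \<Omega> f A :: "real^'n \<Rightarrow> complex"
  assumes m: "1 \<le> m" and \<beta>: "0 < \<beta>" and c: "0 \<le> c"
    and R: "cmod (taylor_remainder m A x y) \<le> c * norm (x - y) powr (real (m - 1) + \<beta>)"
  shows "cmod (T_integrand m \<Omega> A f x y) \<le> c * (cmod (\<Omega> (x - y)) * norm (x - y) powr (\<beta> - CARD('n)) * cmod (f y))"
proof (cases "x = y")
  case True
  then show ?thesis using R \<beta> by (simp add: T_integrand_def)
next
  case False
  have "cmod (taylor_remainder m A x y) / norm (x - y) ^ (CARD('n) + m - 1) \<le> c * norm (x - y) powr (\<beta> - CARD('n))"
    using kernel_bound[of m "cmod (taylor_remainder m A x y)" c "x - y" \<beta> "norm (x - y)"] m R \<beta> False c by simp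
  then have "(cmod (\<Omega> (x - y)) * cmod (f y)) * (cmod (taylor_remainder m A x y) / norm (x - y) ^ (CARD('n) + m - 1))
     \<le> (cmod (\<Omega> (x - y)) * cmod (f y)) * (c * norm (x - y) powr (\<beta> - CARD('n)))"
    by (rule mult_left_mono) simp
  then show ?thesis by (simp add: T_integrand_def norm_mult norm_divide norm_power mult_ac)
qed

text \<open>The first bound yields integrability of the integrand wherever the rough integral is
  finite. The bound for M holds for each radius separately, so it passes to the supremum.\<close>

lemma T_op_le_rough_integral:
  fixes \<Omega> f A :: "real^'n \<Rightarrow> complex"
  assumes m: "1 \<le> m" and \<beta>: "0 < \<beta>" and c: "0 \<le> c"
    and R: "\<And>y. cmod (taylor_remainder m A x y) \<le> c * norm (x - y) powr (real (m - 1) + \<beta>)"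
    and meas [measurable]: "(\<lambda>y. ennreal (cmod (\<Omega> (x - y)) * norm (x - y) powr (\<beta> - CARD('n)) * cmod (f y))) \<in> borel_measurable lebesgue"
  shows "(\<integral>\<^sup>+y. ennreal (cmod (T_integrand m \<Omega> A f x y)) \<partial>lebesgue) \<le> ennreal c * rough_integral \<beta> \<Omega> f x"
    and "modulus (T_op m \<Omega> A f) x \<le> ennreal c * rough_integral \<beta> \<Omega> f x"
    and "M_op m \<Omega> A f x \<le> ennreal c * rough_integral \<beta> \<Omega> f x"
proof -
  let ?k = "\<lambda>y. cmod (\<Omega> (x - y)) * norm (x - y) powr (\<beta> - CARD('n)) * cmod (f y)"
  have rough: "ennreal c * rough_integral \<beta> \<Omega> f x = (\<integral>\<^sup>+y. ennreal (c * ?k y) \<partial>lebesgue)"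
    unfolding rough_integral_def nn_integral_cmult[OF meas, symmetric] by (simp only: ennreal_mult'[OF c])
  show 1: "(\<integral>\<^sup>+y. ennreal (cmod (T_integrand m \<Omega> A f x y)) \<partial>lebesgue) \<le> ennreal c * rough_integral \<beta> \<Omega> f x"
    unfolding rough by (intro nn_integral_mono ennreal_leI T_integrand_bound m \<beta> c R)
  show "modulus (T_op m \<Omega> A f) x \<le> ennreal c * rough_integral \<beta> \<Omega> f x"
  proof (cases "integrable lebesgue (T_integrand m \<Omega> A f x)")
    case True
    have "modulus (T_op m \<Omega> A f) x \<le> (\<integral>\<^sup>+y. ennreal (cmod (T_integrand m \<Omega> A f x y)) \<partial>lebesgue)"
      unfolding modulus_def T_op_def by (rule integral_norm_bound_ennreal[OF True])
    with 1 show ?thesis by (rule order_trans[rotated])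
  next
    \<comment> \<open>The Bochner integral of a non-integrable function is 0 by convention, so the
      bound is trivial here; integrability almost everywhere is proved separately.\<close>
    case False
    then show ?thesis by (simp add: modulus_def T_op_def not_integrable_integral_eq)
  qed
  show "M_op m \<Omega> A f x \<le> ennreal c * rough_integral \<beta> \<Omega> f x"
    unfolding M_op_def
  proof (rule SUP_least)
    fix r :: real assume "r \<in> {0<..}"
    then have r: "0 < r" by simp
    let ?N = "CARD('n) + m - 1"
    have "ennreal (1 / r ^ ?N) * (\<integral>\<^sup>+ y \<in> {y. norm (x - y) < r}. ennreal (cmod (\<Omega> (x - y) * taylor_remainder m A x y * f y)) \<partial>lebesgue)
       = (\<integral>\<^sup>+ y. ennreal (1 / r ^ ?N) * (ennreal (cmod (\<Omega> (x - y) * taylor_remainder m A x y * f y)) * indicator {y. norm (x - y) < r} y) \<partial>lebesgue)"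
      using r by (intro nn_integral_cmult_pos[symmetric]) simp
    also have "\<dots> \<le> (\<integral>\<^sup>+y. ennreal (c * ?k y) \<partial>lebesgue)"
    proof (intro nn_integral_mono)
      fix y
      show "ennreal (1 / r ^ ?N) * (ennreal (cmod (\<Omega> (x - y) * taylor_remainder m A x y * f y)) * indicator {y. norm (x - y) < r} y)
        \<le> ennreal (c * ?k y)"
      proof (cases "norm (x - y) < r")
        case True
        have "cmod (taylor_remainder m A x y) / r ^ ?N \<le> c * norm (x - y) powr (\<beta> - CARD('n))"
          using kernel_bound[of m "cmod (taylor_remainder m A x y)" c "x - y" \<beta> r] m R[of y] \<beta> True r c by simp
        then have "(cmod (\<Omega> (x - y)) * cmod (f y)) * (cmod (taylor_remainder m A x y) / r ^ ?N)
           \<le> (cmod (\<Omega> (x - y)) * cmod (f y)) * (c * norm (x - y) powr (\<beta> - CARD('n)))"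
          by (rule mult_left_mono) simp
        then have "1 / r ^ ?N * cmod (\<Omega> (x - y) * taylor_remainder m A x y * f y) \<le> c * ?k y"
          by (simp add: norm_mult mult_ac)
        then show ?thesis using True r by (simp add: ennreal_mult[symmetric] ennreal_leI)
      qed simp
    qed
    finally show "ennreal (1 / r ^ ?N) * (\<integral>\<^sup>+ y \<in> {y. norm (x - y) < r}. ennreal (cmod (\<Omega> (x - y) * taylor_remainder m A x y * f y)) \<partial>lebesgue)
      \<le> ennreal c * rough_integral \<beta> \<Omega> f x" unfolding rough .
  qed
qed

section \<open>Measurability of the operators\<close>

lemma borel_measurable_lebesgue_cong_AE:
  fixes f g :: "'a::euclidean_space \<Rightarrow> 'b::topological_space"
  assumes g: "g \<in> borel_measurable lebesgue" and ae: "AE x in lborel. f x = g x"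
  shows "f \<in> borel_measurable lebesgue"
proof (rule measurableI)
  fix S :: "'b set" assume S: "S \<in> sets borel"
  have "AE x in lborel. \<not> (f x \<noteq> g x \<and> f x \<in> S)" "AE x in lborel. \<not> (f x \<noteq> g x \<and> g x \<in> S)"
    using ae by (auto elim!: eventually_mono)
  from this[THEN sets_completion_AE]
  have "Measurable.pred lebesgue (\<lambda>x. f x \<noteq> g x \<and> f x \<in> S)" "Measurable.pred lebesgue (\<lambda>x. f x \<noteq> g x \<and> g x \<in> S)" .
  then have "{x. f x \<noteq> g x \<and> f x \<in> S} \<in> sets lebesgue" "{x. f x \<noteq> g x \<and> g x \<in> S} \<in> sets lebesgue"
    by (simp_all add: pred_def)
  moreover have "g -` S \<in> sets lebesgue" using measurable_sets[OF g S] by simp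
  ultimately have "(g -` S - {x. f x \<noteq> g x \<and> g x \<in> S}) \<union> {x. f x \<noteq> g x \<and> f x \<in> S} \<in> sets lebesgue"
    by blast
  also have "(g -` S - {x. f x \<noteq> g x \<and> g x \<in> S}) \<union> {x. f x \<noteq> g x \<and> f x \<in> S} = f -` S \<inter> space lebesgue"
    by auto
  finally show "f -` S \<inter> space lebesgue \<in> sets lebesgue" .
qed simp

lemma borel_measurable_taylor_remainder:
  fixes A :: "real^'n \<Rightarrow> complex"
  assumes "Ck k A"
  shows "(\<lambda>z. taylor_remainder (Suc k) A (fst z) (snd z)) \<in> borel_measurable (lborel \<Otimes>\<^sub>M lborel)"
proof -
  have "(\<lambda>z. taylor_remainder (Suc k) A (fst z) (snd z)) \<in> borel_measurable (borel \<Otimes>\<^sub>M borel)"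
    unfolding borel_prod by (rule borel_measurable_continuous_onI[OF continuous_taylor_remainder[OF assms]])
  then show ?thesis
    by (simp cong: measurable_cong_sets add: sets_pair_measure_cong[OF sets_lborel sets_lborel])
qed

lemma borel_measurable_T_integrand:
  fixes \<Omega> f A :: "real^'n \<Rightarrow> complex"
  assumes [measurable]: "\<Omega> \<in> borel_measurable borel" "f \<in> borel_measurable borel" and A: "Ck (m - 1) A" and m: "1 \<le> m"
  shows "(\<lambda>z. T_integrand m \<Omega> A f (fst z) (snd z)) \<in> borel_measurable (lborel \<Otimes>\<^sub>M lborel)"
    and "(\<lambda>z. cmod (\<Omega> (fst z - snd z) * taylor_remainder m A (fst z) (snd z) * f (snd z))) \<in> borel_measurable (lborel \<Otimes>\<^sub>M lborel)"
proof -
  have [measurable]: "(\<lambda>z. taylor_remainder m A (fst z) (snd z)) \<in> borel_measurable (lborel \<Otimes>\<^sub>M lborel)"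
    using borel_measurable_taylor_remainder[OF A] m by simp
  show "(\<lambda>z. T_integrand m \<Omega> A f (fst z) (snd z)) \<in> borel_measurable (lborel \<Otimes>\<^sub>M lborel)"
    unfolding T_integrand_def by measurable
  show "(\<lambda>z. cmod (\<Omega> (fst z - snd z) * taylor_remainder m A (fst z) (snd z) * f (snd z))) \<in> borel_measurable (lborel \<Otimes>\<^sub>M lborel)"
    by measurable
qed

lemma T_integrand_AE_eq:
  fixes \<Omega> \<Omega>' f f' A :: "real^'n \<Rightarrow> complex"
  assumes "AE z in lborel. \<Omega> z = \<Omega>' z" "AE y in lborel. f y = f' y"
  shows "AE y in lborel. T_integrand m \<Omega> A f x y = T_integrand m \<Omega>' A f' x y"
  using AE_lborel_reflect[OF assms(1), of x] assms(2) by eventually_elim (simp add: T_integrand_def)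

lemma borel_measurable_T_integrand_lebesgue:
  fixes \<Omega> f A :: "real^'n \<Rightarrow> complex"
  assumes "\<Omega> \<in> borel_measurable borel" "f \<in> borel_measurable borel" "Ck (m - 1) A" "1 \<le> m"
  shows "T_integrand m \<Omega> A f x \<in> borel_measurable lborel"
  using measurable_compose[OF measurable_Pair1' borel_measurable_T_integrand(1)[OF assms], of x]
  by (simp add: space_pair_measure)

text \<open>Changing \<Omega> and f on null sets alters the integrand, for every fixed x, only on a
  null set of y, since reflecting y to x - y preserves null sets. So the operator equals at every x
  the integral of a jointly Borel measurable function.\<close>

lemma borel_measurable_T_op:
  fixes \<Omega> \<Omega>' f f' A :: "real^'n \<Rightarrow> complex"
  assumes \<Omega>': "\<Omega>' \<in> borel_measurable borel" and f': "f' \<in> borel_measurable borel" and A: "Ck (m - 1) A" and m: "1 \<le> m"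
    and ae: "AE z in lborel. \<Omega> z = \<Omega>' z" "AE y in lborel. f y = f' y"
  shows "T_op m \<Omega> A f \<in> borel_measurable lebesgue"
proof -
  note meas = borel_measurable_T_integrand_lebesgue[OF \<Omega>' f' A m]
  have "T_op m \<Omega> A f = (\<lambda>x. LINT y|lborel. T_integrand m \<Omega>' A f' x y)"
  proof
    fix x
    have "T_op m \<Omega> A f x = (LINT y|lebesgue. T_integrand m \<Omega>' A f' x y)"
      unfolding T_op_def
    proof (rule integral_cong_AE)
      show "T_integrand m \<Omega>' A f' x \<in> borel_measurable lebesgue" by (rule measurable_completion[OF meas])
      then show "T_integrand m \<Omega> A f x \<in> borel_measurable lebesgue"
        by (rule borel_measurable_lebesgue_cong_AE[OF _ T_integrand_AE_eq[OF ae]])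
      show "AE y in lebesgue. T_integrand m \<Omega> A f x y = T_integrand m \<Omega>' A f' x y"
        by (rule AE_completion[OF T_integrand_AE_eq[OF ae]])
    qed
    also have "\<dots> = (LINT y|lborel. T_integrand m \<Omega>' A f' x y)"
      by (rule integral_completion[OF meas])
    finally show "T_op m \<Omega> A f x = (LINT y|lborel. T_integrand m \<Omega>' A f' x y)" .
  qed
  moreover have "(\<lambda>x. LINT y|lborel. T_integrand m \<Omega>' A f' x y) \<in> borel_measurable lborel"
    using borel_measurable_T_integrand(1)[OF \<Omega>' f' A m]
    by (intro sigma_finite_measure.borel_measurable_lebesgue_integral lborel.sigma_finite_measure_axioms) (simp add: case_prod_beta')
  ultimately show ?thesis using measurable_completion by metis
qed

text \<open>Makes the maximal operator a countable supremum. Rational radii \<rho> are taken above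
  r, because then I(r) \<le> I(\<rho>) by monotonicity alone, and the price (\<rho>/r)^N tends to
  1.\<close>

lemma SUP_radii_eq_rational:
  fixes I :: "real \<Rightarrow> ennreal"
  assumes mono: "\<And>r r'. r \<le> r' \<Longrightarrow> I r \<le> I r'"
  shows "(SUP r\<in>{0<..}. ennreal (1 / r ^ N) * I r) = (SUP r\<in>{0<..} \<inter> \<rat>. ennreal (1 / r ^ N) * I r)"
proof (rule antisym)
  let ?S = "SUP r\<in>{0<..} \<inter> \<rat>. ennreal (1 / r ^ N) * I r"
  show "(SUP r\<in>{0<..}. ennreal (1 / r ^ N) * I r) \<le> ?S"
  proof (rule SUP_least)
    fix r :: real assume "r \<in> {0<..}"
    then have r: "0 < r" by simp
    show "ennreal (1 / r ^ N) * I r \<le> ?S"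
    proof (cases ?S)
      case (real \<sigma>)
      have "\<exists>\<rho>\<in>\<rat>. r < \<rho> \<and> \<rho> < r + 1 / real (Suc n)" for n by (intro Rats_dense_in_real) simp
      then have "\<forall>n. \<exists>\<rho>. \<rho> \<in> \<rat> \<and> r < \<rho> \<and> \<rho> < r + 1 / real (Suc n)" by blast
      then obtain \<rho> where \<rho>: "\<And>n. \<rho> n \<in> \<rat> \<and> r < \<rho> n \<and> \<rho> n < r + 1 / real (Suc n)"
        using choice[of "\<lambda>n \<rho>. \<rho> \<in> \<rat> \<and> r < \<rho> \<and> \<rho> < r + 1 / real (Suc n)"] by blast
      have "(\<lambda>n. r + 1 / real (Suc n)) \<longlonglongrightarrow> r + 0"
        by (intro tendsto_add tendsto_const LIMSEQ_Suc[OF lim_1_over_n])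
      then have upper: "(\<lambda>n. r + 1 / real (Suc n)) \<longlonglongrightarrow> r" by simp
      have lim: "\<rho> \<longlonglongrightarrow> r"
      proof (rule tendsto_sandwich[OF _ _ tendsto_const upper])
        show "\<forall>\<^sub>F n in sequentially. r \<le> \<rho> n" using \<rho> by (intro always_eventually allI less_imp_le) blast
        show "\<forall>\<^sub>F n in sequentially. \<rho> n \<le> r + 1 / real (Suc n)" using \<rho> by (intro always_eventually allI less_imp_le) blast
      qed
      have "ennreal (1 / r ^ N) * I r \<le> ennreal ((\<rho> n / r) ^ N * \<sigma>)" for n
      proof -
        have \<rho>n: "0 < \<rho> n" "r \<le> \<rho> n" "\<rho> n \<in> \<rat>" using \<rho>[of n] r by (blast intro: less_trans less_imp_le)+
        have "ennreal (1 / r ^ N) * I r \<le> ennreal (1 / r ^ N) * I (\<rho> n)"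
          by (intro mult_left_mono mono \<rho>n) simp
        also have "\<dots> = ennreal ((\<rho> n / r) ^ N) * (ennreal (1 / \<rho> n ^ N) * I (\<rho> n))"
          using \<rho>n r by (simp add: mult.assoc[symmetric] ennreal_mult[symmetric] power_divide)
        also have "\<dots> \<le> ennreal ((\<rho> n / r) ^ N) * ?S"
          using \<rho>n by (intro mult_left_mono SUP_upper) auto
        also have "\<dots> = ennreal ((\<rho> n / r) ^ N * \<sigma>)" using real \<rho>n r by (simp add: ennreal_mult)
        finally show ?thesis .
      qed
      moreover have "(\<lambda>n. ennreal ((\<rho> n / r) ^ N * \<sigma>)) \<longlonglongrightarrow> ennreal ((r / r) ^ N * \<sigma>)"
        using r by (intro tendsto_ennrealI tendsto_intros lim) simp
      ultimately have "ennreal (1 / r ^ N) * I r \<le> ennreal ((r / r) ^ N * \<sigma>)"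
        by (intro LIMSEQ_le_const) auto
      then show ?thesis using real r by simp
    next
      case top
      show ?thesis unfolding top by simp
    qed
  qed
  show "?S \<le> (SUP r\<in>{0<..}. ennreal (1 / r ^ N) * I r)" by (rule SUP_subset_mono) auto
qed

lemma borel_measurable_M_op:
  fixes \<Omega> \<Omega>' f f' A :: "real^'n \<Rightarrow> complex"
  assumes \<Omega>': "\<Omega>' \<in> borel_measurable borel" and f': "f' \<in> borel_measurable borel" and A: "Ck (m - 1) A" and m: "1 \<le> m"
    and ae: "AE z in lborel. \<Omega> z = \<Omega>' z" "AE y in lborel. f y = f' y"
  shows "M_op m \<Omega> A f \<in> borel_measurable lebesgue"
proof -
  let ?N = "CARD('n) + m - 1"
  let ?h = "\<lambda>x y. ennreal (cmod (\<Omega>' (x - y) * taylor_remainder m A x y * f' y))"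
  let ?I = "\<lambda>x r. \<integral>\<^sup>+ y \<in> {y. norm (x - y) < r}. ?h x y \<partial>lborel"
  have eq: "M_op m \<Omega> A f = (\<lambda>x. SUP r\<in>{0<..} \<inter> \<rat>. ennreal (1 / r ^ ?N) * ?I x r)"
  proof
    fix x
    have "(\<integral>\<^sup>+ y \<in> {y. norm (x - y) < r}. ennreal (cmod (\<Omega> (x - y) * taylor_remainder m A x y * f y)) \<partial>lebesgue) = ?I x r" for r
      unfolding nn_integral_completion
    proof (rule nn_integral_cong_AE)
      show "AE y in lborel. ennreal (cmod (\<Omega> (x - y) * taylor_remainder m A x y * f y)) * indicator {y. norm (x - y) < r} y
         = ?h x y * indicator {y. norm (x - y) < r} y"
        using AE_lborel_reflect[OF ae(1), of x] ae(2) by eventually_elim simp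
    qed
    then have "M_op m \<Omega> A f x = (SUP r\<in>{0<..}. ennreal (1 / r ^ ?N) * ?I x r)" by (simp add: M_op_def)
    also have "\<dots> = (SUP r\<in>{0<..} \<inter> \<rat>. ennreal (1 / r ^ ?N) * ?I x r)"
      by (intro SUP_radii_eq_rational nn_integral_mono) (auto simp: indicator_def)
    finally show "M_op m \<Omega> A f x = (SUP r\<in>{0<..} \<inter> \<rat>. ennreal (1 / r ^ ?N) * ?I x r)" .
  qed
  have I: "(\<lambda>x. ?I x r) \<in> borel_measurable lborel" for r
  proof (intro sigma_finite_measure.borel_measurable_nn_integral lborel.sigma_finite_measure_axioms)
    note [measurable] = borel_measurable_T_integrand(2)[OF \<Omega>' f' A m]
    have "(\<lambda>z. ennreal (cmod (\<Omega>' (fst z - snd z) * taylor_remainder m A (fst z) (snd z) * f' (snd z))) * indicator {z. norm (fst z - snd z) < r} z)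
      \<in> borel_measurable (lborel \<Otimes>\<^sub>M lborel)" by measurable
    then show "case_prod (\<lambda>x y. ?h x y * indicator {y. norm (x - y) < r} y) \<in> borel_measurable (lborel \<Otimes>\<^sub>M lborel)"
      by (simp add: case_prod_beta' indicator_def)
  qed
  have "countable ({0<..} \<inter> \<rat> :: real set)" by (intro countable_Int2 countable_rat)
  then have "(\<lambda>x. SUP r\<in>{0<..} \<inter> \<rat>. ennreal (1 / r ^ ?N) * ?I x r) \<in> borel_measurable lborel"
    using I by (intro borel_measurable_SUP) auto
  then show ?thesis unfolding eq by (rule measurable_completion)
qed

text \<open>Integrability at almost every x belongs to the claim because \<open>T_op\<close> takes
  the value 0 where it fails, so the norm bound alone would not show that the operator is well
  defined.\<close>

theorem theorem3p2:
  fixes \<Omega> :: "real^'n \<Rightarrow> complex" and w :: "real^'n \<Rightarrow> real"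
    and m :: nat and \<beta> s s' p q \<kappa> :: real
  assumes "m \<ge> 1"
    and "0 < \<beta>" and "\<beta> < 1"
    and "s > 1" and "\<Omega> \<in> sphere_Lp s" and "homogeneous_zero \<Omega>"
    and "1 / s + 1 / s' = 1" and "1 < s'" and "s' < p" and "p < CARD('n) / \<beta>"
    and "1 / q = 1 / p - \<beta> / CARD('n)"
    and "0 < \<kappa>" and "\<kappa> < p / q"
    and "weight w" and "(\<lambda>x. w x powr s') \<in> A_class (p / s') (q / s')"
  shows "\<exists>C::real. C > 0 \<and> (\<forall>A :: real^'n \<Rightarrow> complex.
    Ck (m - 1) A \<and> (\<forall>\<gamma>. multi_size \<gamma> = m - 1 \<longrightarrow> multi_deriv \<gamma> A \<in> Lip_space \<beta>) \<longrightarrow>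
    (\<forall>f \<in> morrey_space p \<kappa> (\<lambda>x. w x powr p) (\<lambda>x. w x powr q).
       (AE x in lebesgue. integrable lebesgue (T_integrand m \<Omega> A f x))
     \<and> T_op m \<Omega> A f \<in> borel_measurable lebesgue
     \<and> morrey_norm q (\<kappa> * q / p) (\<lambda>x. w x powr q) (\<lambda>x. w x powr q) (modulus (T_op m \<Omega> A f))
         \<le> ennreal (C * (\<Sum>\<gamma> | multi_size \<gamma> = m - 1. Lip_norm \<beta> (multi_deriv \<gamma> A)))
            * morrey_norm p \<kappa> (\<lambda>x. w x powr p) (\<lambda>x. w x powr q) (modulus f)
     \<and> M_op m \<Omega> A f \<in> borel_measurable lebesgue
     \<and> morrey_norm q (\<kappa> * q / p) (\<lambda>x. w x powr q) (\<lambda>x. w x powr q) (M_op m \<Omega> A f)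
         \<le> ennreal (C * (\<Sum>\<gamma> | multi_size \<gamma> = m - 1. Lip_norm \<beta> (multi_deriv \<gamma> A)))
            * morrey_norm p \<kappa> (\<lambda>x. w x powr p) (\<lambda>x. w x powr q) (modulus f)))"
proof -
  have m: "1 \<le> m" and \<beta>: "0 < \<beta>" "\<beta> < 1" and s: "s > 1" "1 < s'" "1 / s + 1 / s' = 1" and sp: "s' < p"
    and w: "weight w" using assms by auto
  let ?n = "real CARD('n)"
  have n: "0 < ?n" by simp
  have p: "0 < p" using s sp by linarith
  \<comment> \<open>p < n/\<beta> makes 1/q positive, so that q is a genuine exponent with p <
    q.\<close>
  have "\<beta> / ?n < 1 / p"
    using \<open>p < CARD('n) / \<beta>\<close> \<beta> p n by (simp add: field_simps)
  then have iq: "0 < 1 / q" "1 / q < 1 / p" using \<open>1 / q = 1 / p - \<beta> / CARD('n)\<close> \<beta> n by auto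
  then have q: "0 < q" "p < q" using p by (simp_all add: field_simps)
  obtain \<Omega>' where \<Omega>' [measurable]: "\<Omega>' \<in> borel_measurable borel" and hom: "homogeneous_zero \<Omega>'"
    and ae\<Omega>: "AE z in lborel. \<Omega> z = \<Omega>' z"
    and fin: "(\<integral>\<^sup>+z\<in>ball 0 1. ennreal (cmod (\<Omega>' z) powr s) \<partial>lborel) < top"
    using borel_homogeneous_version[OF \<open>\<Omega> \<in> sphere_Lp s\<close> \<open>homogeneous_zero \<Omega>\<close>] by blast
  let ?u = "\<lambda>x. w x powr p" and ?v = "\<lambda>x. w x powr q"
  obtain C where C: "0 < C" and bound: "\<And>f F c. f \<in> morrey_space p \<kappa> ?u ?v \<Longrightarrow> 0 \<le> c \<Longrightarrow>
    \<forall>x. F x \<le> ennreal c * rough_integral \<beta> \<Omega>' f x \<Longrightarrow>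
    morrey_norm q (\<kappa> * q / p) ?v ?v F \<le> ennreal (C * c) * morrey_norm p \<kappa> ?u ?v (modulus f)"
    using rough_integral_morrey[OF \<Omega>' hom fin \<beta> s sp q(2) \<open>1 / q = 1 / p - \<beta> / CARD('n)\<close> \<open>0 < \<kappa>\<close> \<open>\<kappa> < p / q\<close> w
        \<open>(\<lambda>x. w x powr s') \<in> A_class (p / s') (q / s')\<close>] by blast
  have wm [measurable]: "w \<in> borel_measurable lebesgue" and wpos: "AE x in lebesgue. 0 < w x"
    using w by (auto simp: weight_def)
  have PQ: "1 < p / s'" "p / s' < q / s'" using s sp q by (auto simp: divide_strict_right_mono)
  \<comment> \<open>Provides local integrability of w^q, which is needed to deduce finiteness almost
    everywhere from a finite Morrey norm.\<close>
  obtain K where "weight_pair (\<lambda>x. w x powr (s' * (q / s'))) (\<lambda>x. w x powr (s' * - ((p / s') / (p / s' - 1)))) (p / s') (q / s') K"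
    using weight_pair_of_A_class[OF w PQ _ \<open>(\<lambda>x. w x powr s') \<in> A_class (p / s') (q / s')\<close>] s by auto
  then have finite_v: "weight_of ?v (ball x r) \<noteq> top" for x r
    using weight_pair.finite_u[of "\<lambda>x. w x powr (s' * (q / s'))"] s by (fastforce simp: weight_of_def)
  \<comment> \<open>The constant of the Taylor estimate; the final constant C * D depends on neither
    f nor A.\<close>
  define D where "D = ?n ^ (m - 1)"
  have D: "0 < D" by (simp add: D_def)
  show ?thesis
  proof (intro exI[of _ "C * D"] conjI allI impI ballI)
    show "0 < C * D" using C D by simp
    fix A f :: "real^'n \<Rightarrow> complex"
    assume A: "Ck (m - 1) A \<and> (\<forall>\<gamma>. multi_size \<gamma> = m - 1 \<longrightarrow> multi_deriv \<gamma> A \<in> Lip_space \<beta>)"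
      and f: "f \<in> morrey_space p \<kappa> ?u ?v"
    define \<Lambda> where "\<Lambda> = (\<Sum>\<gamma> | multi_size \<gamma> = m - 1. Lip_norm \<beta> (multi_deriv \<gamma> A))"
    have finS: "finite {\<gamma> :: 'n \<Rightarrow> nat. multi_size \<gamma> = m - 1}"
      by (rule finite_subset[OF _ finite_multi_size_le[of "m - 1"]]) auto
    have Lip: "0 \<le> Lip_norm \<beta> (multi_deriv \<gamma> A)" if "multi_size \<gamma> = m - 1" for \<gamma>
      using A that by (intro Lip_norm_nonneg) auto
    have \<Lambda>: "0 \<le> \<Lambda>" unfolding \<Lambda>_def by (intro sum_nonneg Lip) auto
    have "cmod (taylor_remainder (Suc (m - 1)) A x y) \<le> ?n ^ (m - 1) * \<Lambda> * norm (x - y) powr (real (m - 1) + \<beta>)" for x y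
    proof (rule taylor_remainder_bound)
      fix \<gamma> :: "'n \<Rightarrow> nat" and a b assume \<gamma>: "multi_size \<gamma> = m - 1"
      have "cmod (multi_deriv \<gamma> A a - multi_deriv \<gamma> A b) \<le> Lip_norm \<beta> (multi_deriv \<gamma> A) * norm (a - b) powr \<beta>"
        using A \<gamma> by (intro Lip_norm_bound) auto
      also have "\<dots> \<le> \<Lambda> * norm (a - b) powr \<beta>"
        unfolding \<Lambda>_def using \<gamma> finS Lip by (intro mult_right_mono member_le_sum) auto
      finally show "cmod (multi_deriv \<gamma> A a - multi_deriv \<gamma> A b) \<le> \<Lambda> * norm (a - b) powr \<beta>" .
    qed (use A \<Lambda> \<beta> in auto)
    then have R: "cmod (taylor_remainder m A x y) \<le> D * \<Lambda> * norm (x - y) powr (real (m - 1) + \<beta>)" for x y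
      using m by (simp add: D_def)
    have c: "0 \<le> D * \<Lambda>" using D \<Lambda> by simp
    have Ck: "Ck (m - 1) A" using A by simp
    have fm: "f \<in> borel_measurable lebesgue" and fnorm: "morrey_norm p \<kappa> ?u ?v (modulus f) < top"
      using f by (auto simp: morrey_space_def)
    obtain f' where f': "f' \<in> borel_measurable borel" and aef: "AE y in lborel. f y = f' y"
      using completion_ex_borel_measurable_complex[OF fm] by auto
    have rough: "rough_integral \<beta> \<Omega> f x = rough_integral \<beta> \<Omega>' f x" for x
      by (rule rough_integral_cong[OF ae\<Omega>]) simp
    have kernel: "(\<lambda>y. ennreal (cmod (\<Omega> (x - y)) * norm (x - y) powr (\<beta> - CARD('n)) * cmod (f y))) \<in> borel_measurable lebesgue" for x
    proof (rule borel_measurable_lebesgue_cong_AE)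
      have "(\<lambda>y. ennreal (cmod (\<Omega>' (x - y)) * norm (x - y) powr (\<beta> - CARD('n)) * cmod (f' y))) \<in> borel_measurable lborel"
        using f' by measurable
      then show "(\<lambda>y. ennreal (cmod (\<Omega>' (x - y)) * norm (x - y) powr (\<beta> - CARD('n)) * cmod (f' y))) \<in> borel_measurable lebesgue"
        by (rule measurable_completion)
      show "AE y in lborel. ennreal (cmod (\<Omega> (x - y)) * norm (x - y) powr (\<beta> - CARD('n)) * cmod (f y))
         = ennreal (cmod (\<Omega>' (x - y)) * norm (x - y) powr (\<beta> - CARD('n)) * cmod (f' y))"
        using AE_lborel_reflect[OF ae\<Omega>, of x] aef by eventually_elim simp
    qed
    note pointwise = T_op_le_rough_integral[OF m \<beta>(1) c R kernel, unfolded rough]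
    have const: "C * (D * \<Lambda>) = C * D * \<Lambda>" by simp
    show "T_op m \<Omega> A f \<in> borel_measurable lebesgue"
      by (rule borel_measurable_T_op[OF \<Omega>' f' Ck m ae\<Omega> aef])
    show "M_op m \<Omega> A f \<in> borel_measurable lebesgue"
      by (rule borel_measurable_M_op[OF \<Omega>' f' Ck m ae\<Omega> aef])
    show "morrey_norm q (\<kappa> * q / p) ?v ?v (modulus (T_op m \<Omega> A f))
       \<le> ennreal (C * D * (\<Sum>\<gamma> | multi_size \<gamma> = m - 1. Lip_norm \<beta> (multi_deriv \<gamma> A))) * morrey_norm p \<kappa> ?u ?v (modulus f)"
      unfolding \<Lambda>_def[symmetric] const[symmetric] using pointwise(2) by (intro bound[OF f c]) blast
    show "morrey_norm q (\<kappa> * q / p) ?v ?v (M_op m \<Omega> A f)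
       \<le> ennreal (C * D * (\<Sum>\<gamma> | multi_size \<gamma> = m - 1. Lip_norm \<beta> (multi_deriv \<gamma> A))) * morrey_norm p \<kappa> ?u ?v (modulus f)"
      unfolding \<Lambda>_def[symmetric] const[symmetric] using pointwise(3) by (intro bound[OF f c]) blast
    \<comment> \<open>With the rough integral itself as F, its finite Morrey norm makes it finite
      almost everywhere. Up to a constant it dominates the absolute integral defining T.\<close>
    have "morrey_norm q (\<kappa> * q / p) ?v ?v (rough_integral \<beta> \<Omega>' f) \<le> ennreal (C * 1) * morrey_norm p \<kappa> ?u ?v (modulus f)"
      by (rule bound[OF f]) auto
    also have "\<dots> < top" using fnorm by (simp add: ennreal_mult_less_top)
    finally have "AE x in lebesgue. rough_integral \<beta> \<Omega>' f x < top"
      using wpos q finite_v borel_measurable_rough_integral[OF \<Omega>' fm]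
      by (intro AE_finite_of_morrey_norm[where u="?v" and v="?v"]) (auto elim!: eventually_mono)
    then show "AE x in lebesgue. integrable lebesgue (T_integrand m \<Omega> A f x)"
    proof eventually_elim
      case (elim x)
      have "(\<integral>\<^sup>+y. ennreal (cmod (T_integrand m \<Omega> A f x y)) \<partial>lebesgue) \<le> ennreal (D * \<Lambda>) * rough_integral \<beta> \<Omega>' f x"
        by (rule pointwise(1))
      also have "\<dots> < top" using elim by (simp add: ennreal_mult_less_top)
      finally have "(\<integral>\<^sup>+y. ennreal (cmod (T_integrand m \<Omega> A f x y)) \<partial>lebesgue) < \<infinity>" by simp
      moreover have "T_integrand m \<Omega> A f x \<in> borel_measurable lebesgue"
        by (rule borel_measurable_lebesgue_cong_AE[OF _ T_integrand_AE_eq[OF ae\<Omega> aef]])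
          (rule measurable_completion[OF borel_measurable_T_integrand_lebesgue[OF \<Omega>' f' Ck m]])
      ultimately show ?case by (intro integrableI_bounded) auto
    qed
  qed
qed

end
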